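(* Let $\pi\colon E\to I$ be a fibred site satisfying (i)--(iii) of the context, $I'$ a $\mathbb U$-site in which fibre products are representable, $\varphi\colon I'\to I$ a continuous functor which commutes with fibre products, $\pi'\colon E'\to I'$ the base change of $\pi$ by $\varphi$, and $\Phi\colon E'\to E$ the canonical projection. Equip $E$ and $E'$ with the co-evanescent topologies associated with $\pi$ and $\pi'$, and let $\widetilde E$, $\widetilde E'$ be the topoi of sheaves of $\mathbb U$-sets on $E$, $E'$. Suppose moreover that: (i) the category $I'$ is $\mathbb U$-small and the functor $\varphi$ is fully faithful; (ii) the topology of $I'$ is induced by that of $I$ via $\varphi$; (iii) every object of $I$ can be covered by objects coming from $I'$ (i.e. of the form $\varphi(i')$). Then the functor $\Phi_s\colon \widetilde E\to\widetilde E'$, $F\mapsto F\circ\Phi$, is an equivalence of categories.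
   Context: Fix a universe $\mathbb U$ containing an element of infinite cardinality; sheaves are of $\mathbb U$-sets. Let $I$ be a $\mathbb U$-site and $\pi\colon E\to I$ a cleaved and normalized fibred category over the category underlying $I$, such that: (i) fibre products are representable in $I$; (ii) for every $i\in\mathrm{Ob}(I)$, the fibre category $E_i$ is equipped with a topology making it a $\mathbb U$-site, and finite limits are representable in $E_i$; (iii) for every morphism $f\colon i\to j$ of $I$, the inverse image functor $f^+\colon E_j\to E_i$ is continuous and left exact. The co-evanescent topology on $E$ is the topology generated by the families $(V_n\to V)_{n\in\Sigma}$ of the following two types: (v) there is $i\in \mathrm{Ob}(I)$ such that $(V_n\to V)_{n\in\Sigma}$ is a covering family of $E_i$; (c) there is a covering family $(f_n\colon i_n\to i)_{n\in\Sigma}$ of $I$, with $i=\pi(V)$, such that $V_n$ is isomorphic to $f_n^+(V)$ for all $n$ (with $V_n\to V$ the canonical morphism). The base change $\pi'\colon E'\to I'$ has fibre $E'_{i'}=E_{\varphi(i')}$ over $i'\in\mathrm{Ob}(I')$, with the same topology, and satisfies the analogues of (i)--(iii); $E'$ is given the co-evanescent topology associated with $\pi'$. The functor $\Phi$ is continuous for the co-evanescent topologies, so $F\mapsto F\circ\Phi$ maps $\widetilde E$ to $\widetilde E'$. The topology of $I'$ induced by that of $I$ via $\varphi$ is the finest topology on $I'$ making $\varphi$ continuous. *)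

theory Defs
  imports "HOL-Library.FuncSet" "HOL-Library.Equipollence"
begin

section \<open>Universes\<close>

text \<open>
  A Grothendieck universe with an element of infinite cardinality. The type \<open>'u\<close> is the universe
  itself, and \<open>elts x\<close> is the set of the elements of \<open>x\<close>; since a universe is transitive, all the
  elements of \<open>x\<close> are again in \<open>'u\<close>. The sets outside the universe are the sets of HOL.
\<close>

locale universe =
  fixes elts :: "'u \<Rightarrow> 'u set"
  assumes extensionality: "inj elts"
    and pairing: "\<exists>z. elts z = {x, y}"
    and powerset: "\<exists>z. elts ` elts z = Pow (elts x)"
    and union: "\<exists>z. elts z = (\<Union>i\<in>elts x. elts (f i))"
    and infinity: "\<exists>x. infinite (elts x)"

definition small :: "('u \<Rightarrow> 'u set) \<Rightarrow> 'b set \<Rightarrow> bool" where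
  "small elts A \<longleftrightarrow> (\<exists>x. A \<approx> elts x)"


section \<open>Categories and functors\<close>

text \<open>\<open>Cmp C g f\<close> is the composite of \<open>f\<close> followed by \<open>g\<close>. Values outside \<open>Ob\<close> and \<open>Mor\<close> are
  irrelevant.\<close>

record ('o, 'a) cat =
  Ob :: "'o set"
  Mor :: "'a set"
  Dom :: "'a \<Rightarrow> 'o"
  Cod :: "'a \<Rightarrow> 'o"
  Id :: "'o \<Rightarrow> 'a"
  Cmp :: "'a \<Rightarrow> 'a \<Rightarrow> 'a"

definition hom :: "('o, 'a) cat \<Rightarrow> 'o \<Rightarrow> 'o \<Rightarrow> 'a set" where
  "hom C X Y = {f \<in> Mor C. Dom C f = X \<and> Cod C f = Y}"

locale category =
  fixes C :: "('o, 'a) cat"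
  assumes dom_in: "f \<in> Mor C \<Longrightarrow> Dom C f \<in> Ob C"
    and cod_in: "f \<in> Mor C \<Longrightarrow> Cod C f \<in> Ob C"
    and id_in: "X \<in> Ob C \<Longrightarrow> Id C X \<in> hom C X X"
    and cmp_in: "f \<in> hom C X Y \<Longrightarrow> g \<in> hom C Y Z \<Longrightarrow> Cmp C g f \<in> hom C X Z"
    and id_right: "f \<in> hom C X Y \<Longrightarrow> Cmp C f (Id C X) = f"
    and id_left: "f \<in> hom C X Y \<Longrightarrow> Cmp C (Id C Y) f = f"
    and assoc: "f \<in> hom C W X \<Longrightarrow> g \<in> hom C X Y \<Longrightarrow> h \<in> hom C Y Z
      \<Longrightarrow> Cmp C h (Cmp C g f) = Cmp C (Cmp C h g) f"

definition is_iso :: "('o, 'a) cat \<Rightarrow> 'a \<Rightarrow> bool" where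
  "is_iso C f \<longleftrightarrow> f \<in> Mor C \<and> (\<exists>g\<in>hom C (Cod C f) (Dom C f).
     Cmp C g f = Id C (Dom C f) \<and> Cmp C f g = Id C (Cod C f))"

record ('o, 'a, 'p, 'b) functr =
  Fo :: "'o \<Rightarrow> 'p"
  Fm :: "'a \<Rightarrow> 'b"

definition is_functor :: "('o, 'a) cat \<Rightarrow> ('p, 'b) cat \<Rightarrow> ('o, 'a, 'p, 'b) functr \<Rightarrow> bool" where
  "is_functor C D F \<longleftrightarrow> category C \<and> category D
    \<and> (\<forall>X\<in>Ob C. Fo F X \<in> Ob D)
    \<and> (\<forall>f\<in>Mor C. Fm F f \<in> hom D (Fo F (Dom C f)) (Fo F (Cod C f)))
    \<and> (\<forall>X\<in>Ob C. Fm F (Id C X) = Id D (Fo F X))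
    \<and> (\<forall>f\<in>Mor C. \<forall>g\<in>Mor C. Cod C f = Dom C g \<longrightarrow>
         Fm F (Cmp C g f) = Cmp D (Fm F g) (Fm F f))"

definition id_functor :: "('o, 'a, 'o, 'a) functr" where
  "id_functor = \<lparr>Fo = (\<lambda>X. X), Fm = (\<lambda>f. f)\<rparr>"

definition comp_functor ::
  "('p, 'b, 'q, 'c) functr \<Rightarrow> ('o, 'a, 'p, 'b) functr \<Rightarrow> ('o, 'a, 'q, 'c) functr" where
  "comp_functor G F = \<lparr>Fo = Fo G \<circ> Fo F, Fm = Fm G \<circ> Fm F\<rparr>"

definition fully_faithful :: "('o, 'a) cat \<Rightarrow> ('p, 'b) cat \<Rightarrow> ('o, 'a, 'p, 'b) functr \<Rightarrow> bool" where
  "fully_faithful C D F \<longleftrightarrow> (\<forall>X\<in>Ob C. \<forall>Y\<in>Ob C.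
     bij_betw (Fm F) (hom C X Y) (hom D (Fo F X) (Fo F Y)))"

definition is_nat_iso :: "('o, 'a) cat \<Rightarrow> ('p, 'b) cat \<Rightarrow> ('o, 'a, 'p, 'b) functr
    \<Rightarrow> ('o, 'a, 'p, 'b) functr \<Rightarrow> ('o \<Rightarrow> 'b) \<Rightarrow> bool" where
  "is_nat_iso C D F G \<eta> \<longleftrightarrow>
     (\<forall>X\<in>Ob C. \<eta> X \<in> hom D (Fo F X) (Fo G X) \<and> is_iso D (\<eta> X))
   \<and> (\<forall>f\<in>Mor C. Cmp D (\<eta> (Cod C f)) (Fm F f) = Cmp D (Fm G f) (\<eta> (Dom C f)))"

definition is_equivalence :: "('o, 'a) cat \<Rightarrow> ('p, 'b) cat \<Rightarrow> ('o, 'a, 'p, 'b) functr \<Rightarrow> bool" where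
  "is_equivalence C D F \<longleftrightarrow> is_functor C D F \<and> (\<exists>G. is_functor D C G
     \<and> (\<exists>\<eta>. is_nat_iso C C id_functor (comp_functor G F) \<eta>)
     \<and> (\<exists>\<epsilon>. is_nat_iso D D (comp_functor F G) id_functor \<epsilon>))"

definition small_category :: "('u \<Rightarrow> 'u set) \<Rightarrow> ('o, 'a) cat \<Rightarrow> bool" where
  "small_category elts C \<longleftrightarrow> category C \<and> small elts (Ob C) \<and> small elts (Mor C)"


section \<open>Finite limits and fibre products\<close>

definition is_cone :: "('j, 'k) cat \<Rightarrow> ('o, 'a) cat \<Rightarrow> ('j, 'k, 'o, 'a) functr
    \<Rightarrow> 'o \<Rightarrow> ('j \<Rightarrow> 'a) \<Rightarrow> bool" where
  "is_cone J C D L p \<longleftrightarrow> L \<in> Ob C \<and> (\<forall>j\<in>Ob J. p j \<in> hom C L (Fo D j))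
    \<and> (\<forall>k\<in>Mor J. Cmp C (Fm D k) (p (Dom J k)) = p (Cod J k))"

definition is_limit :: "('j, 'k) cat \<Rightarrow> ('o, 'a) cat \<Rightarrow> ('j, 'k, 'o, 'a) functr
    \<Rightarrow> 'o \<Rightarrow> ('j \<Rightarrow> 'a) \<Rightarrow> bool" where
  "is_limit J C D L p \<longleftrightarrow> is_cone J C D L p \<and> (\<forall>M q. is_cone J C D M q \<longrightarrow>
     (\<exists>!h. h \<in> hom C M L \<and> (\<forall>j\<in>Ob J. Cmp C (p j) h = q j)))"

text \<open>Every finite category is isomorphic to one whose objects and arrows are natural numbers, so
  only these are used as index categories of finite diagrams.\<close>

definition finite_diagram :: "(nat, nat) cat \<Rightarrow> ('o, 'a) cat \<Rightarrow> (nat, nat, 'o, 'a) functr \<Rightarrow> bool"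
  where "finite_diagram J C D \<longleftrightarrow> finite (Ob J) \<and> finite (Mor J) \<and> is_functor J C D"

definition has_finite_limits :: "('o, 'a) cat \<Rightarrow> bool" where
  "has_finite_limits C \<longleftrightarrow> (\<forall>J D. finite_diagram J C D \<longrightarrow> (\<exists>L p. is_limit J C D L p))"

definition left_exact :: "('o, 'a) cat \<Rightarrow> ('p, 'b) cat \<Rightarrow> ('o, 'a, 'p, 'b) functr \<Rightarrow> bool" where
  "left_exact C C' F \<longleftrightarrow> is_functor C C' F \<and>
     (\<forall>J D L p. finite_diagram J C D \<and> is_limit J C D L p \<longrightarrow>
        is_limit J C' (comp_functor F D) (Fo F L) (Fm F \<circ> p))"

text \<open>\<open>p\<close> and \<open>q\<close> are the projections of \<open>P\<close> to the sources of \<open>f\<close> and \<open>g\<close>.\<close>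

definition is_fibre_product :: "('o, 'a) cat \<Rightarrow> 'a \<Rightarrow> 'a \<Rightarrow> 'o \<Rightarrow> 'a \<Rightarrow> 'a \<Rightarrow> bool" where
  "is_fibre_product C f g P p q \<longleftrightarrow>
     f \<in> Mor C \<and> g \<in> Mor C \<and> Cod C f = Cod C g
   \<and> p \<in> hom C P (Dom C f) \<and> q \<in> hom C P (Dom C g) \<and> Cmp C f p = Cmp C g q
   \<and> (\<forall>Q r s. r \<in> hom C Q (Dom C f) \<and> s \<in> hom C Q (Dom C g) \<and> Cmp C f r = Cmp C g s \<longrightarrow>
        (\<exists>!h. h \<in> hom C Q P \<and> Cmp C p h = r \<and> Cmp C q h = s))"

definition has_fibre_products :: "('o, 'a) cat \<Rightarrow> bool" where
  "has_fibre_products C \<longleftrightarrow> (\<forall>f\<in>Mor C. \<forall>g\<in>Mor C. Cod C f = Cod C g \<longrightarrow>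
     (\<exists>P p q. is_fibre_product C f g P p q))"

definition commutes_with_fibre_products ::
  "('o, 'a) cat \<Rightarrow> ('p, 'b) cat \<Rightarrow> ('o, 'a, 'p, 'b) functr \<Rightarrow> bool" where
  "commutes_with_fibre_products C D F \<longleftrightarrow> (\<forall>f g P p q. is_fibre_product C f g P p q \<longrightarrow>
     is_fibre_product D (Fm F f) (Fm F g) (Fo F P) (Fm F p) (Fm F q))"


section \<open>Sites\<close>

definition is_sieve :: "('o, 'a) cat \<Rightarrow> 'o \<Rightarrow> 'a set \<Rightarrow> bool" where
  "is_sieve C X R \<longleftrightarrow> R \<subseteq> {f \<in> Mor C. Cod C f = X}
    \<and> (\<forall>f\<in>R. \<forall>g\<in>Mor C. Cod C g = Dom C f \<longrightarrow> Cmp C f g \<in> R)"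

definition pull_sieve :: "('o, 'a) cat \<Rightarrow> 'a \<Rightarrow> 'a set \<Rightarrow> 'a set" where
  "pull_sieve C f R = {g \<in> Mor C. Cod C g = Dom C f \<and> Cmp C f g \<in> R}"

text \<open>A topology is given by the set \<open>J X\<close> of covering sieves of each object \<open>X\<close>.\<close>

locale grothendieck_topology = category C for C :: "('o, 'a) cat" +
  fixes J :: "'o \<Rightarrow> 'a set set"
  assumes sieves: "X \<in> Ob C \<Longrightarrow> R \<in> J X \<Longrightarrow> is_sieve C X R"
    and stable: "f \<in> Mor C \<Longrightarrow> R \<in> J (Cod C f) \<Longrightarrow> pull_sieve C f R \<in> J (Dom C f)"
    and local_character: "X \<in> Ob C \<Longrightarrow> R \<in> J X \<Longrightarrow> is_sieve C X S
      \<Longrightarrow> (\<And>f. f \<in> R \<Longrightarrow> pull_sieve C f S \<in> J (Dom C f)) \<Longrightarrow> S \<in> J X"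
    and maximal: "X \<in> Ob C \<Longrightarrow> {f \<in> Mor C. Cod C f = X} \<in> J X"

definition generated_sieve :: "('o, 'a) cat \<Rightarrow> 'a set \<Rightarrow> 'a set" where
  "generated_sieve C S = {Cmp C f g |f g. f \<in> S \<and> g \<in> Mor C \<and> Cod C g = Dom C f}"

text \<open>A family of arrows with target \<open>X\<close> is represented by the set of its members; whether it is
  covering depends only on this set.\<close>

definition covering :: "('o, 'a) cat \<Rightarrow> ('o \<Rightarrow> 'a set set) \<Rightarrow> 'o \<Rightarrow> 'a set \<Rightarrow> bool" where
  "covering C J X S \<longleftrightarrow> X \<in> Ob C \<and> S \<subseteq> {f \<in> Mor C. Cod C f = X} \<and> generated_sieve C S \<in> J X"

text \<open>The coarsest topology on \<open>C\<close> for which the families in \<open>\<F> X\<close> cover \<open>X\<close>, for all objects \<open>X\<close>.\<close>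

definition generated_topology ::
  "('o, 'a) cat \<Rightarrow> ('o \<Rightarrow> 'a set set) \<Rightarrow> 'o \<Rightarrow> 'a set set" where
  "generated_topology C \<F> X = {R. is_sieve C X R \<and>
     (\<forall>K. grothendieck_topology C K \<and> (\<forall>Y\<in>Ob C. \<forall>S\<in>\<F> Y. covering C K Y S) \<longrightarrow> R \<in> K X)}"

text \<open>A \<open>\<U>\<close>-site: the sets of morphisms are small and there is a small topologically generating
  set of objects.\<close>

definition U_site :: "('u \<Rightarrow> 'u set) \<Rightarrow> ('o, 'a) cat \<Rightarrow> ('o \<Rightarrow> 'a set set) \<Rightarrow> bool" where
  "U_site elts C J \<longleftrightarrow> grothendieck_topology C J
    \<and> (\<forall>X\<in>Ob C. \<forall>Y\<in>Ob C. small elts (hom C X Y))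
    \<and> (\<exists>G \<subseteq> Ob C. small elts G \<and> (\<forall>X\<in>Ob C. \<exists>S. covering C J X S \<and> Dom C ` S \<subseteq> G))"


section \<open>Sheaves of \<open>\<U>\<close>-sets\<close>

text \<open>Presheaves and their morphisms are extensional functions, so that the equality of HOL is the
  equality of presheaves.\<close>

record ('o, 'a, 'u) psh =
  Po :: "'o \<Rightarrow> 'u"
  Pm :: "'a \<Rightarrow> 'u \<Rightarrow> 'u"

definition presheaf :: "('u \<Rightarrow> 'u set) \<Rightarrow> ('o, 'a) cat \<Rightarrow> ('o, 'a, 'u) psh \<Rightarrow> bool" where
  "presheaf elts C F \<longleftrightarrow> Po F \<in> extensional (Ob C) \<and> Pm F \<in> extensional (Mor C)
    \<and> (\<forall>f\<in>Mor C. Pm F f \<in> elts (Po F (Cod C f)) \<rightarrow>\<^sub>E elts (Po F (Dom C f)))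
    \<and> (\<forall>X\<in>Ob C. \<forall>x\<in>elts (Po F X). Pm F (Id C X) x = x)
    \<and> (\<forall>f\<in>Mor C. \<forall>g\<in>Mor C. Cod C f = Dom C g \<longrightarrow>
         (\<forall>x\<in>elts (Po F (Cod C g)). Pm F (Cmp C g f) x = Pm F f (Pm F g x)))"

text \<open>A morphism of presheaves from the sieve \<open>R\<close>, seen as a subfunctor of a representable functor,
  to \<open>F\<close>.\<close>

definition matching_family ::
  "('u \<Rightarrow> 'u set) \<Rightarrow> ('o, 'a) cat \<Rightarrow> ('o, 'a, 'u) psh \<Rightarrow> 'a set \<Rightarrow> ('a \<Rightarrow> 'u) \<Rightarrow> bool" where
  "matching_family elts C F R s \<longleftrightarrow> (\<forall>f\<in>R. s f \<in> elts (Po F (Dom C f)))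
    \<and> (\<forall>f\<in>R. \<forall>g\<in>Mor C. Cod C g = Dom C f \<longrightarrow> s (Cmp C f g) = Pm F g (s f))"

definition sheaf ::
  "('u \<Rightarrow> 'u set) \<Rightarrow> ('o, 'a) cat \<Rightarrow> ('o \<Rightarrow> 'a set set) \<Rightarrow> ('o, 'a, 'u) psh \<Rightarrow> bool" where
  "sheaf elts C J F \<longleftrightarrow> presheaf elts C F
    \<and> (\<forall>X\<in>Ob C. \<forall>R\<in>J X. \<forall>s. matching_family elts C F R s \<longrightarrow>
         (\<exists>!x. x \<in> elts (Po F X) \<and> (\<forall>f\<in>R. Pm F f x = s f)))"

text \<open>An arrow of the category of sheaves is a triple (source, target, natural transformation).\<close>

type_synonym ('o, 'a, 'u) psh_mor =
  "('o, 'a, 'u) psh \<times> ('o, 'a, 'u) psh \<times> ('o \<Rightarrow> 'u \<Rightarrow> 'u)"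

definition presheaf_nat :: "('u \<Rightarrow> 'u set) \<Rightarrow> ('o, 'a) cat
    \<Rightarrow> ('o, 'a, 'u) psh \<Rightarrow> ('o, 'a, 'u) psh \<Rightarrow> ('o \<Rightarrow> 'u \<Rightarrow> 'u) \<Rightarrow> bool" where
  "presheaf_nat elts C F G \<alpha> \<longleftrightarrow> \<alpha> \<in> extensional (Ob C)
    \<and> (\<forall>X\<in>Ob C. \<alpha> X \<in> elts (Po F X) \<rightarrow>\<^sub>E elts (Po G X))
    \<and> (\<forall>f\<in>Mor C. \<forall>x\<in>elts (Po F (Cod C f)).
         \<alpha> (Dom C f) (Pm F f x) = Pm G f (\<alpha> (Cod C f) x))"

definition sheaf_cat :: "('u \<Rightarrow> 'u set) \<Rightarrow> ('o, 'a) cat \<Rightarrow> ('o \<Rightarrow> 'a set set)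
    \<Rightarrow> (('o, 'a, 'u) psh, ('o, 'a, 'u) psh_mor) cat" where
  "sheaf_cat elts C J = \<lparr>
     Ob = {F. sheaf elts C J F},
     Mor = {(F, G, \<alpha>). sheaf elts C J F \<and> sheaf elts C J G \<and> presheaf_nat elts C F G \<alpha>},
     Dom = (\<lambda>(F, G, \<alpha>). F),
     Cod = (\<lambda>(F, G, \<alpha>). G),
     Id = (\<lambda>F. (F, F, \<lambda>X\<in>Ob C. \<lambda>x\<in>elts (Po F X). x)),
     Cmp = (\<lambda>(G', H, \<beta>) (F, G, \<alpha>). (F, H, \<lambda>X\<in>Ob C. compose (elts (Po F X)) (\<beta> X) (\<alpha> X)))\<rparr>"

definition restrict_presheaf ::
  "('o, 'a) cat \<Rightarrow> ('o, 'a, 'p, 'b) functr \<Rightarrow> ('p, 'b, 'u) psh \<Rightarrow> ('o, 'a, 'u) psh" where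
  "restrict_presheaf C \<phi> F =
     \<lparr>Po = (\<lambda>X\<in>Ob C. Po F (Fo \<phi> X)), Pm = (\<lambda>f\<in>Mor C. Pm F (Fm \<phi> f))\<rparr>"

text \<open>The functor \<open>F \<mapsto> F \<circ> \<phi>\<close> on (pre)sheaves, where \<open>C\<close> is the source of \<open>\<phi>\<close>.\<close>

definition restriction_functor :: "('o, 'a) cat \<Rightarrow> ('o, 'a, 'p, 'b) functr
    \<Rightarrow> (('p, 'b, 'u) psh, ('p, 'b, 'u) psh_mor, ('o, 'a, 'u) psh, ('o, 'a, 'u) psh_mor) functr"
  where
  "restriction_functor C \<phi> = \<lparr>
     Fo = restrict_presheaf C \<phi>,
     Fm = (\<lambda>(F, G, \<alpha>). (restrict_presheaf C \<phi> F, restrict_presheaf C \<phi> G,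
                         \<lambda>X\<in>Ob C. \<alpha> (Fo \<phi> X)))\<rparr>"

definition continuous_functor :: "('u \<Rightarrow> 'u set) \<Rightarrow> ('o, 'a) cat \<Rightarrow> ('o \<Rightarrow> 'a set set)
    \<Rightarrow> ('p, 'b) cat \<Rightarrow> ('p \<Rightarrow> 'b set set) \<Rightarrow> ('o, 'a, 'p, 'b) functr \<Rightarrow> bool" where
  "continuous_functor elts C J D K \<phi> \<longleftrightarrow> is_functor C D \<phi>
    \<and> (\<forall>F. sheaf elts D K F \<longrightarrow> sheaf elts C J (restrict_presheaf C \<phi> F))"

text \<open>\<open>J\<close> is the finest topology on \<open>C\<close> for which \<open>\<phi>\<close> is continuous.\<close>

definition induced_topology :: "('u \<Rightarrow> 'u set) \<Rightarrow> ('o, 'a) cat \<Rightarrow> ('o \<Rightarrow> 'a set set)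
    \<Rightarrow> ('p, 'b) cat \<Rightarrow> ('p \<Rightarrow> 'b set set) \<Rightarrow> ('o, 'a, 'p, 'b) functr \<Rightarrow> bool" where
  "induced_topology elts C J D K \<phi> \<longleftrightarrow> grothendieck_topology C J \<and> continuous_functor elts C J D K \<phi>
    \<and> (\<forall>J'. grothendieck_topology C J' \<and> continuous_functor elts C J' D K \<phi> \<longrightarrow> (\<forall>X\<in>Ob C. J' X \<subseteq> J X))"


section \<open>Fibred categories\<close>

text \<open>Fibred categories, cleavages and inverse image functors in the sense of SGA 1, Expose VI:
  the cartesian arrows only have the universal property with respect to arrows over the same arrow
  of the base, and their stability under composition is part of the definition of a fibred
  category.\<close>

definition fibre :: "('e, 'm) cat \<Rightarrow> ('i, 'k) cat \<Rightarrow> ('e, 'm, 'i, 'k) functr \<Rightarrow> 'i \<Rightarrow> ('e, 'm) cat"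
  where
  "fibre E I \<pi> i = \<lparr>
     Ob = {V \<in> Ob E. Fo \<pi> V = i},
     Mor = {u \<in> Mor E. Fo \<pi> (Dom E u) = i \<and> Fo \<pi> (Cod E u) = i \<and> Fm \<pi> u = Id I i},
     Dom = Dom E, Cod = Cod E, Id = Id E, Cmp = Cmp E\<rparr>"

definition cartesian :: "('e, 'm) cat \<Rightarrow> ('i, 'k) cat \<Rightarrow> ('e, 'm, 'i, 'k) functr \<Rightarrow> 'm \<Rightarrow> bool" where
  "cartesian E I \<pi> u \<longleftrightarrow> u \<in> Mor E \<and>
     (\<forall>v\<in>Mor E. Cod E v = Cod E u \<and> Fm \<pi> v = Fm \<pi> u \<longrightarrow>
        (\<exists>!w. w \<in> hom (fibre E I \<pi> (Fo \<pi> (Dom E u))) (Dom E v) (Dom E u) \<and> Cmp E u w = v))"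

definition fibred :: "('e, 'm) cat \<Rightarrow> ('i, 'k) cat \<Rightarrow> ('e, 'm, 'i, 'k) functr \<Rightarrow> bool" where
  "fibred E I \<pi> \<longleftrightarrow> is_functor E I \<pi>
    \<and> (\<forall>f\<in>Mor I. \<forall>V\<in>Ob (fibre E I \<pi> (Cod I f)).
         \<exists>u. cartesian E I \<pi> u \<and> Cod E u = V \<and> Fm \<pi> u = f)
    \<and> (\<forall>u v. cartesian E I \<pi> u \<and> cartesian E I \<pi> v \<and> Cod E u = Dom E v \<longrightarrow>
         cartesian E I \<pi> (Cmp E v u))"

text \<open>A normalized cleavage: \<open>cl f V\<close> is the chosen cartesian arrow \<open>f\<^sup>+(V) \<rightarrow> V\<close> over \<open>f\<close>.\<close>

definition normalized_cleavage :: "('e, 'm) cat \<Rightarrow> ('i, 'k) cat \<Rightarrow> ('e, 'm, 'i, 'k) functr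
    \<Rightarrow> ('k \<Rightarrow> 'e \<Rightarrow> 'm) \<Rightarrow> bool" where
  "normalized_cleavage E I \<pi> cl \<longleftrightarrow>
     (\<forall>f\<in>Mor I. \<forall>V\<in>Ob (fibre E I \<pi> (Cod I f)).
        cartesian E I \<pi> (cl f V) \<and> Cod E (cl f V) = V \<and> Fm \<pi> (cl f V) = f)
   \<and> (\<forall>V\<in>Ob E. cl (Id I (Fo \<pi> V)) V = Id E V)"

definition inverse_image :: "('e, 'm) cat \<Rightarrow> ('i, 'k) cat \<Rightarrow> ('e, 'm, 'i, 'k) functr
    \<Rightarrow> ('k \<Rightarrow> 'e \<Rightarrow> 'm) \<Rightarrow> 'k \<Rightarrow> ('e, 'm, 'e, 'm) functr" where
  "inverse_image E I \<pi> cl f = \<lparr>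
     Fo = (\<lambda>V. Dom E (cl f V)),
     Fm = (\<lambda>u. THE w.
       w \<in> hom (fibre E I \<pi> (Dom I f)) (Dom E (cl f (Dom E u))) (Dom E (cl f (Cod E u)))
       \<and> Cmp E (cl f (Cod E u)) w = Cmp E u (cl f (Dom E u)))\<rparr>"


section \<open>Fibred sites and the co-evanescent topology\<close>

text \<open>\<open>J\<close> is the topology of \<open>I\<close> and \<open>T i\<close> that of the fibre over \<open>i\<close>.\<close>

definition fibred_site :: "('u \<Rightarrow> 'u set) \<Rightarrow> ('i, 'k) cat \<Rightarrow> ('i \<Rightarrow> 'k set set) \<Rightarrow> ('e, 'm) cat
    \<Rightarrow> ('e, 'm, 'i, 'k) functr \<Rightarrow> ('k \<Rightarrow> 'e \<Rightarrow> 'm) \<Rightarrow> ('i \<Rightarrow> 'e \<Rightarrow> 'm set set) \<Rightarrow> bool" where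
  "fibred_site elts I J E \<pi> cl T \<longleftrightarrow>
     U_site elts I J
   \<and> fibred E I \<pi> \<and> normalized_cleavage E I \<pi> cl
   \<and> has_fibre_products I
   \<and> (\<forall>i\<in>Ob I. U_site elts (fibre E I \<pi> i) (T i) \<and> has_finite_limits (fibre E I \<pi> i))
   \<and> (\<forall>f\<in>Mor I.
        continuous_functor elts (fibre E I \<pi> (Cod I f)) (T (Cod I f))
          (fibre E I \<pi> (Dom I f)) (T (Dom I f)) (inverse_image E I \<pi> cl f)
      \<and> left_exact (fibre E I \<pi> (Cod I f)) (fibre E I \<pi> (Dom I f)) (inverse_image E I \<pi> cl f))"

definition vertical_family :: "('i, 'k) cat \<Rightarrow> ('e, 'm) cat \<Rightarrow> ('e, 'm, 'i, 'k) functr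
    \<Rightarrow> ('i \<Rightarrow> 'e \<Rightarrow> 'm set set) \<Rightarrow> 'e \<Rightarrow> 'm set \<Rightarrow> bool" where
  "vertical_family I E \<pi> T V S \<longleftrightarrow> (\<exists>i\<in>Ob I. covering (fibre E I \<pi> i) (T i) V S)"

text \<open>The family is indexed by its own members \<open>u : V\<^sub>n \<rightarrow> V\<close>; \<open>f u\<close> is the corresponding \<open>f\<^sub>n\<close> and
  \<open>w u\<close> the isomorphism from \<open>V\<^sub>n\<close> to \<open>f\<^sub>n\<^sup>+(V)\<close> in the fibre over the source of \<open>f\<^sub>n\<close>.\<close>

definition cartesian_family :: "('i, 'k) cat \<Rightarrow> ('i \<Rightarrow> 'k set set) \<Rightarrow> ('e, 'm) cat
    \<Rightarrow> ('e, 'm, 'i, 'k) functr \<Rightarrow> ('k \<Rightarrow> 'e \<Rightarrow> 'm) \<Rightarrow> 'e \<Rightarrow> 'm set \<Rightarrow> bool" where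
  "cartesian_family I J E \<pi> cl V S \<longleftrightarrow> V \<in> Ob E \<and> S \<subseteq> Mor E \<and>
     (\<exists>f w. covering I J (Fo \<pi> V) (f ` S) \<and>
        (\<forall>u\<in>S. is_iso (fibre E I \<pi> (Dom I (f u))) (w u)
             \<and> Dom E (w u) = Dom E u \<and> Cod E (w u) = Fo (inverse_image E I \<pi> cl (f u)) V
             \<and> u = Cmp E (cl (f u) V) (w u)))"

definition coevanescent_topology :: "('i, 'k) cat \<Rightarrow> ('i \<Rightarrow> 'k set set) \<Rightarrow> ('e, 'm) cat
    \<Rightarrow> ('e, 'm, 'i, 'k) functr \<Rightarrow> ('k \<Rightarrow> 'e \<Rightarrow> 'm) \<Rightarrow> ('i \<Rightarrow> 'e \<Rightarrow> 'm set set)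
    \<Rightarrow> 'e \<Rightarrow> 'm set set" where
  "coevanescent_topology I J E \<pi> cl T = generated_topology E
     (\<lambda>V. {S. vertical_family I E \<pi> T V S \<or> cartesian_family I J E \<pi> cl V S})"


section \<open>Base change\<close>

definition base_change_cat :: "('e, 'm) cat \<Rightarrow> ('e, 'm, 'i, 'k) functr \<Rightarrow> ('i', 'k') cat
    \<Rightarrow> ('i', 'k', 'i, 'k) functr \<Rightarrow> ('e \<times> 'i', 'm \<times> 'k') cat" where
  "base_change_cat E \<pi> I' \<phi> = \<lparr>
     Ob = {(V, i). V \<in> Ob E \<and> i \<in> Ob I' \<and> Fo \<pi> V = Fo \<phi> i},
     Mor = {(u, f). u \<in> Mor E \<and> f \<in> Mor I' \<and> Fm \<pi> u = Fm \<phi> f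
       \<and> Fo \<pi> (Dom E u) = Fo \<phi> (Dom I' f) \<and> Fo \<pi> (Cod E u) = Fo \<phi> (Cod I' f)},
     Dom = (\<lambda>(u, f). (Dom E u, Dom I' f)),
     Cod = (\<lambda>(u, f). (Cod E u, Cod I' f)),
     Id = (\<lambda>(V, i). (Id E V, Id I' i)),
     Cmp = (\<lambda>(v, g) (u, f). (Cmp E v u, Cmp I' g f))\<rparr>"

text \<open>The structure functor \<open>\<pi>'\<close> and the canonical projection \<open>\<Phi>\<close> of the base change.\<close>

definition base_change_functor :: "('e \<times> 'i', 'm \<times> 'k', 'i', 'k') functr" where
  "base_change_functor = \<lparr>Fo = snd, Fm = snd\<rparr>"

definition base_change_projection :: "('e \<times> 'i', 'm \<times> 'k', 'e, 'm) functr" where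
  "base_change_projection = \<lparr>Fo = fst, Fm = fst\<rparr>"

definition base_change_cleavage :: "('i', 'k', 'i, 'k) functr \<Rightarrow> ('k \<Rightarrow> 'e \<Rightarrow> 'm)
    \<Rightarrow> 'k' \<Rightarrow> 'e \<times> 'i' \<Rightarrow> 'm \<times> 'k'" where
  "base_change_cleavage \<phi> cl f V = (cl (Fm \<phi> f) (fst V), f)"

text \<open>The topology of the fibre over \<open>\<phi>(i)\<close>, transported along the isomorphism from that fibre to
  the fibre of the base change over \<open>i\<close>, which sends an arrow \<open>u\<close> to \<open>(u, id\<^sub>i)\<close>.\<close>

definition base_change_fibre_topology :: "('i', 'k') cat \<Rightarrow> ('i', 'k', 'i, 'k) functr
    \<Rightarrow> ('i \<Rightarrow> 'e \<Rightarrow> 'm set set) \<Rightarrow> 'i' \<Rightarrow> 'e \<times> 'i' \<Rightarrow> ('m \<times> 'k') set set" where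
  "base_change_fibre_topology I' \<phi> T i V =
     (\<lambda>R. (\<lambda>u. (u, Id I' i)) ` R) ` T (Fo \<phi> i) (fst V)"

end

theory Submission
  imports Defs
begin

text \<open>
  The theorem is an instance of the comparison lemma. The functor \<open>\<Phi> : E' \<rightarrow> E\<close> is fully faithful
  because \<open>\<phi>\<close> is, and every object \<open>V\<close> of \<open>E\<close> is covered by objects of \<open>E'\<close>: if the arrows
  \<open>f\<^sub>n : \<phi>(i\<^sub>n) \<rightarrow> \<pi>(V)\<close> form a covering family, then so do the arrows \<open>f\<^sub>n\<^sup>+(V) \<rightarrow> V\<close>. Restriction along
  \<open>\<Phi>\<close> is therefore an equivalence onto the sheaves for the topology induced on \<open>E'\<close>, in which a sieve
  covers \<open>X\<close> if and only if its image generates a covering sieve of \<open>\<Phi>(X)\<close>. A sheaf \<open>G\<close> on \<open>E'\<close> is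
  extended to \<open>E\<close> by sending \<open>V\<close> to the limit of \<open>G\<close> over the arrows \<open>\<Phi>(X) \<rightarrow> V\<close>. This limit is a
  small set because all these arrows factor through the arrows \<open>f\<^sup>+(V) \<rightarrow> V\<close>, for \<open>f : \<phi>(i') \<rightarrow> \<pi>(V)\<close>
  and \<open>i'\<close> in the small set of objects of \<open>I'\<close> (\<open>comparison_lemma\<close>, \<open>small_dense_arrows\<close>).

  It remains to see that the induced topology is the co-evanescent one (\<open>coevanescent_eq_induced\<close>).
  Both inclusions are checked on generating families. For the first one, \<open>\<Phi>\<close> sends the generating
  families of \<open>E'\<close> to covering families of \<open>E\<close>, since \<open>\<phi>\<close> sends covering families to covering
  families. For the second one, the sieves on \<open>V\<close> whose inverse images along all the arrows
  \<open>\<Phi>(X) \<rightarrow> V\<close> are co-evanescent coverings of \<open>X\<close> form a topology on \<open>E\<close>, for which the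
  generating families of \<open>E\<close> are covering. The inverse image of a vertical family contains a vertical family,
  because the functors \<open>f\<^sup>+\<close> send covering families to covering families; that of a cartesian family
  contains a cartesian family, because the topology of \<open>I'\<close> is induced by that of \<open>I\<close> and cartesian
  arrows can be composed.

  Continuity of a functor is defined by its effect on sheaves of small sets. That such a functor
  sends covering sieves to covering sieves (\<open>continuous_preserves_covering_sieves\<close>) follows by testing
  on one sheaf, the sheaf of closed sieves of the target, which has small values on a \<open>\<U>\<close>-site.
\<close>


section \<open>Small sets\<close>

context universe
begin

lemma small_elts [simp]: "small elts (elts x)"
  unfolding small_def by (blast intro: eqpoll_refl)

lemma small_lepoll:
  assumes "small elts B" and "A \<lesssim> B"
  shows "small elts A"
proof -
  obtain x where "B \<approx> elts x" using assms(1) by (auto simp: small_def)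
  then have "A \<lesssim> elts x" using assms(2) by (meson eqpoll_imp_lepoll lepoll_trans)
  then obtain f where f: "inj_on f A" "f ` A \<subseteq> elts x" by (auto simp: lepoll_def)
  obtain z where "elts ` elts z = Pow (elts x)" using powerset by blast
  then obtain y where "elts y = f ` A" using f(2) by (metis Pow_iff image_iff)
  then have "A \<approx> elts y" using f(1) by (metis inj_on_image_eqpoll_self eqpoll_sym)
  then show ?thesis by (auto simp: small_def)
qed

lemma small_inj:
  assumes "small elts B" and "inj_on f A" and "f ` A \<subseteq> B"
  shows "small elts A"
  using assms by (meson small_lepoll lepoll_def)

lemma small_image: "small elts A \<Longrightarrow> small elts (f ` A)"
  by (meson small_lepoll image_lepoll)

lemma small_Pow:
  assumes "small elts A"
  shows "small elts (Pow A)"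
proof -
  obtain x where "A \<approx> elts x" using assms by (auto simp: small_def)
  then obtain f where f: "bij_betw f A (elts x)" by (auto simp: eqpoll_def)
  obtain z where z: "elts ` elts z = Pow (elts x)" using powerset by blast
  have "small elts (elts ` elts z)" by (simp add: small_image)
  moreover have "inj_on ((`) f) (Pow A)" using f
    by (meson PowD bij_betw_def inj_on_def inj_on_image_eq_iff)
  moreover have "(`) f ` Pow A \<subseteq> elts ` elts z"
    using f unfolding z bij_betw_def by blast
  ultimately show ?thesis by (rule small_inj)
qed

lemma ex_singleton: "\<exists>z. elts z = {x}"
  using pairing[of x x] by simp

lemma replacement: "\<exists>z. elts z = f ` elts x"
proof -
  obtain s where s: "\<And>y. elts (s y) = {y}" using ex_singleton by metis
  have "(\<Union>i\<in>elts x. elts (s (f i))) = f ` elts x" by (auto simp: s)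
  then show ?thesis using union[where x = x and f = "s \<circ> f"] by auto
qed

text \<open>Kuratowski pairs.\<close>

lemma ex_pair: "\<exists>op :: 'u \<times> 'u \<Rightarrow> 'u. inj op"
proof -
  obtain d where d: "\<And>x y. elts (d x y) = {x, y}" using pairing by metis
  have d_eq: "d x y = d a b \<longleftrightarrow> {x, y} = {a, b}" for x y a b
    using d extensionality by (metis injD)
  have "inj (\<lambda>(x, y). d (d x x) (d x y))"
    by (rule injI) (auto simp: d_eq doubleton_eq_iff)
  then show ?thesis by blast
qed

lemma small_Sigma:
  assumes A: "small elts A" and B: "\<And>a. a \<in> A \<Longrightarrow> small elts (B a)"
  shows "small elts (Sigma A B)"
proof -
  obtain op :: "'u \<times> 'u \<Rightarrow> 'u" where op: "inj op" using ex_pair by blast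
  obtain x f where f: "bij_betw f A (elts x)" using A by (auto simp: small_def eqpoll_def)
  have "\<exists>b g. bij_betw g (B a) (elts b)" if "a \<in> A" for a
    using B[OF that] by (auto simp: small_def eqpoll_def)
  then obtain b g where g: "\<And>a. a \<in> A \<Longrightarrow> bij_betw (g a) (B a) (elts (b a))" by metis
  define c where "c i = (SOME z. elts z = (\<lambda>y. op (i, y)) ` elts (b (inv_into A f i)))" for i
  have c: "elts (c i) = (\<lambda>y. op (i, y)) ` elts (b (inv_into A f i))" for i
    unfolding c_def by (rule someI_ex) (rule replacement)
  obtain z where z: "elts z = (\<Union>i\<in>elts x. elts (c i))" using union by blast
  show ?thesis
  proof (rule small_inj[OF small_elts])
    show "inj_on (\<lambda>(a, y). op (f a, g a y)) (Sigma A B)"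
    proof (rule inj_onI, clarsimp simp: inj_eq[OF op])
      fix a y a' y'
      assume *: "a \<in> A" "y \<in> B a" "a' \<in> A" "y' \<in> B a'" "f a = f a'" "g a y = g a' y'"
      then have "a = a'" using f by (meson bij_betw_def inj_onD)
      moreover from this have "y = y'" using * g[of a] by (metis bij_betw_def inj_onD)
      ultimately show "a = a' \<and> y = y'" by simp
    qed
    show "(\<lambda>(a, y). op (f a, g a y)) ` Sigma A B \<subseteq> elts z"
    proof clarify
      fix a y assume ay: "a \<in> A" "y \<in> B a"
      then have "inv_into A f (f a) = a" "f a \<in> elts x" "g a y \<in> elts (b a)"
        using f g[of a] by (auto simp: bij_betw_def inv_into_f_f)
      then show "op (f a, g a y) \<in> elts z" unfolding z by (force simp: c)
    qed
  qed
qed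

lemma small_UN:
  assumes "small elts A" and "\<And>a. a \<in> A \<Longrightarrow> small elts (B a)"
  shows "small elts (\<Union>a\<in>A. B a)"
proof -
  have "(\<Union>a\<in>A. B a) = snd ` Sigma A B" by force
  then show ?thesis using small_image[OF small_Sigma[OF assms]] by simp
qed

lemma small_PiE:
  assumes "small elts A" and "\<And>a. a \<in> A \<Longrightarrow> small elts (B a)"
  shows "small elts (Pi\<^sub>E A B)"
proof (rule small_inj[OF small_Pow[OF small_Sigma[OF assms]]])
  show "inj_on (\<lambda>f. (\<lambda>a. (a, f a)) ` A) (Pi\<^sub>E A B)"
  proof (rule inj_onI)
    fix f g assume fg: "f \<in> Pi\<^sub>E A B" "g \<in> Pi\<^sub>E A B" "(\<lambda>a. (a, f a)) ` A = (\<lambda>a. (a, g a)) ` A"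
    then have "f a = g a" if "a \<in> A" for a using that by blast
    with fg(1,2) show "f = g" by (rule PiE_ext)
  qed
  show "(\<lambda>f. (\<lambda>a. (a, f a)) ` A) ` Pi\<^sub>E A B \<subseteq> Pow (Sigma A B)" by auto
qed auto

end


section \<open>Categories and functors\<close>

lemma homD:
  assumes "f \<in> hom C X Y"
  shows "f \<in> Mor C" "Dom C f = X" "Cod C f = Y"
  using assms by (auto simp: hom_def)

context category
begin

lemma Cmp_mor [simp]:
  assumes "f \<in> Mor C" "g \<in> Mor C" "Cod C f = Dom C g"
  shows "Cmp C g f \<in> Mor C" "Dom C (Cmp C g f) = Dom C f" "Cod C (Cmp C g f) = Cod C g"
  using cmp_in[of f "Dom C f" "Cod C f" g "Cod C g"] assms by (auto simp: hom_def)

lemma Id_mor [simp]: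
  assumes "X \<in> Ob C"
  shows "Id C X \<in> Mor C" "Dom C (Id C X) = X" "Cod C (Id C X) = X"
  using id_in[OF assms] by (auto simp: hom_def)

lemma Cmp_Id_right [simp]: "f \<in> Mor C \<Longrightarrow> Dom C f = X \<Longrightarrow> Cmp C f (Id C X) = f"
  using id_right by (auto simp: hom_def)

lemma Cmp_Id_left [simp]: "f \<in> Mor C \<Longrightarrow> Cod C f = X \<Longrightarrow> Cmp C (Id C X) f = f"
  using id_left by (auto simp: hom_def)

lemma Cmp_assoc:
  assumes "f \<in> Mor C" "g \<in> Mor C" "h \<in> Mor C" "Cod C f = Dom C g" "Cod C g = Dom C h"
  shows "Cmp C (Cmp C h g) f = Cmp C h (Cmp C g f)"
  using assoc[of f _ "Dom C g" g "Cod C g" h "Cod C h"] assms by (auto simp: hom_def)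

lemma dom_cod_Ob [simp]: "f \<in> Mor C \<Longrightarrow> Dom C f \<in> Ob C" "f \<in> Mor C \<Longrightarrow> Cod C f \<in> Ob C"
  using dom_in cod_in by auto

end

lemma isoI:
  assumes "f \<in> hom C X Y" "g \<in> hom C Y X" "Cmp C g f = Id C X" "Cmp C f g = Id C Y"
  shows "is_iso C f"
  using assms unfolding is_iso_def hom_def by auto

lemma isoE:
  assumes "is_iso C f" and "f \<in> hom C X Y"
  obtains g where "g \<in> hom C Y X" "Cmp C g f = Id C X" "Cmp C f g = Id C Y"
  using assms unfolding is_iso_def hom_def by auto

locale cat_functor =
  fixes C :: "('o, 'a) cat" and D :: "('p, 'b) cat" and \<Phi> :: "('o, 'a, 'p, 'b) functr"
  assumes is_functor: "is_functor C D \<Phi>"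
begin

sublocale src: category C
  using is_functor by (simp add: is_functor_def)

sublocale tgt: category D
  using is_functor by (simp add: is_functor_def)

lemma Fo_in [simp]: "X \<in> Ob C \<Longrightarrow> Fo \<Phi> X \<in> Ob D"
  using is_functor by (simp add: is_functor_def)

lemma Fm_mor [simp]:
  assumes "f \<in> Mor C"
  shows "Fm \<Phi> f \<in> Mor D" "Dom D (Fm \<Phi> f) = Fo \<Phi> (Dom C f)" "Cod D (Fm \<Phi> f) = Fo \<Phi> (Cod C f)"
  using is_functor assms by (auto simp: is_functor_def hom_def)

lemma Fm_Id [simp]: "X \<in> Ob C \<Longrightarrow> Fm \<Phi> (Id C X) = Id D (Fo \<Phi> X)"
  using is_functor by (simp add: is_functor_def)

lemma Fm_Cmp [simp]:
  "f \<in> Mor C \<Longrightarrow> g \<in> Mor C \<Longrightarrow> Cod C f = Dom C g \<Longrightarrow> Fm \<Phi> (Cmp C g f) = Cmp D (Fm \<Phi> g) (Fm \<Phi> f)"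
  using is_functor by (simp add: is_functor_def)

end


section \<open>Equivalences of categories\<close>

text \<open>A quasi-inverse of a fully faithful and essentially surjective functor is obtained by choosing
  a preimage \<open>G Y\<close> of every object \<open>Y\<close>, up to an isomorphism \<open>\<epsilon> Y\<close>.\<close>

lemma is_equivalenceI:
  assumes F: "is_functor C D F" and ff: "fully_faithful C D F"
    and surj: "\<And>Y. Y \<in> Ob D \<Longrightarrow> \<exists>X\<in>Ob C. \<exists>e. e \<in> hom D (Fo F X) Y \<and> is_iso D e"
  shows "is_equivalence C D F"
proof -
  interpret cat_functor C D F by unfold_locales (rule F)
  obtain G0 \<epsilon> where G0: "\<And>Y. Y \<in> Ob D \<Longrightarrow> G0 Y \<in> Ob C"
    and \<epsilon>: "\<And>Y. Y \<in> Ob D \<Longrightarrow> \<epsilon> Y \<in> hom D (Fo F (G0 Y)) Y"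
    and iso: "\<And>Y. Y \<in> Ob D \<Longrightarrow> is_iso D (\<epsilon> Y)"
    using surj by metis
  have "\<exists>d. d \<in> hom D Y (Fo F (G0 Y)) \<and> Cmp D d (\<epsilon> Y) = Id D (Fo F (G0 Y)) \<and> Cmp D (\<epsilon> Y) d = Id D Y"
    if "Y \<in> Ob D" for Y
    using isoE[OF iso \<epsilon>] that by metis
  then obtain \<delta> where \<delta>: "\<And>Y. Y \<in> Ob D \<Longrightarrow> \<delta> Y \<in> hom D Y (Fo F (G0 Y))"
    and \<delta>\<epsilon>: "\<And>Y. Y \<in> Ob D \<Longrightarrow> Cmp D (\<delta> Y) (\<epsilon> Y) = Id D (Fo F (G0 Y))"
    and \<epsilon>\<delta>: "\<And>Y. Y \<in> Ob D \<Longrightarrow> Cmp D (\<epsilon> Y) (\<delta> Y) = Id D Y"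
    by metis
  note E = homD[OF \<epsilon>] and Dl = homD[OF \<delta>]
  \<comment> \<open>the unique preimage of an arrow under the bijection on hom sets\<close>
  define lift where "lift X Y v = inv_into (hom C X Y) (Fm F) v" for X Y v
  have bij: "bij_betw (Fm F) (hom C X Y) (hom D (Fo F X) (Fo F Y))" if "X \<in> Ob C" "Y \<in> Ob C" for X Y
    using ff that by (auto simp: fully_faithful_def)
  have lift: "lift X Y v \<in> hom C X Y" "Fm F (lift X Y v) = v"
    if "X \<in> Ob C" "Y \<in> Ob C" "v \<in> hom D (Fo F X) (Fo F Y)" for X Y v
    using bij[OF that(1,2)] that(3) unfolding lift_def bij_betw_def
    by (auto intro: inv_into_into f_inv_into_f)
  have faithful: "u = u'"
    if "Fm F u = Fm F u'" "u \<in> Mor C" "u' \<in> Mor C" "Dom C u = Dom C u'" "Cod C u = Cod C u'" for u u'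
    using bij[of "Dom C u" "Cod C u"] that unfolding bij_betw_def inj_on_def hom_def by auto
  define tr where "tr f = Cmp D (\<delta> (Cod D f)) (Cmp D f (\<epsilon> (Dom D f)))" for f
  define G where "G = \<lparr>Fo = G0, Fm = (\<lambda>f. lift (G0 (Dom D f)) (G0 (Cod D f)) (tr f))\<rparr>"
  have GFo: "Fo G X = G0 X" for X by (simp add: G_def)
  have tr: "tr f \<in> hom D (Fo F (G0 (Dom D f))) (Fo F (G0 (Cod D f)))" if "f \<in> Mor D" for f
    using that by (simp add: tr_def hom_def E Dl)
  have Gm: "Fm G f \<in> Mor C" "Dom C (Fm G f) = G0 (Dom D f)" "Cod C (Fm G f) = G0 (Cod D f)"
      "Fm F (Fm G f) = tr f" if "f \<in> Mor D" for f
    using lift[OF G0 G0 tr[OF that]] that by (auto simp: G_def hom_def)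
  have tr_cancel: "Cmp D (\<epsilon> (Cod D f)) (tr f) = Cmp D f (\<epsilon> (Dom D f))" if "f \<in> Mor D" for f
  proof -
    have "Cmp D (\<epsilon> (Cod D f)) (tr f) = Cmp D (Cmp D (\<epsilon> (Cod D f)) (\<delta> (Cod D f))) (Cmp D f (\<epsilon> (Dom D f)))"
      unfolding tr_def using that by (intro tgt.Cmp_assoc[symmetric]) (simp_all add: E Dl)
    then show ?thesis using that by (simp add: \<epsilon>\<delta> E Dl)
  qed
  have tr_comp: "tr (Cmp D g f) = Cmp D (tr g) (tr f)" if "f \<in> Mor D" "g \<in> Mor D" "Cod D f = Dom D g" for f g
  proof -
    have "Cmp D (tr g) (tr f) = Cmp D (\<delta> (Cod D g)) (Cmp D g (Cmp D (\<epsilon> (Dom D g)) (tr f)))"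
      using that homD[OF tr[OF that(1)]]
      by (simp add: tr_def[of g] E Dl tgt.Cmp_assoc)
    also have "Cmp D (\<epsilon> (Dom D g)) (tr f) = Cmp D f (\<epsilon> (Dom D f))" using tr_cancel[OF that(1)] that(3) by simp
    also have "Cmp D (\<delta> (Cod D g)) (Cmp D g (Cmp D f (\<epsilon> (Dom D f)))) = tr (Cmp D g f)"
      using that by (simp add: tr_def E tgt.Cmp_assoc)
    finally show ?thesis by simp
  qed
  have Gf: "is_functor D C G"
    unfolding is_functor_def
  proof (intro conjI ballI impI)
    show "category D" "category C" by unfold_locales
    show "Fo G X \<in> Ob C" if "X \<in> Ob D" for X using that by (simp add: G_def G0)
    show "Fm G f \<in> hom C (Fo G (Dom D f)) (Fo G (Cod D f))" if "f \<in> Mor D" for f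
      using Gm[OF that] by (simp add: G_def hom_def)
    show "Fm G (Id D X) = Id C (Fo G X)" if "X \<in> Ob D" for X
      using that by (intro faithful) (simp_all add: Gm GFo G0 tr_def E Dl \<delta>\<epsilon>)
    show "Fm G (Cmp D g f) = Cmp C (Fm G g) (Fm G f)"
      if "f \<in> Mor D" "g \<in> Mor D" "Cod D f = Dom D g" for f g
      using that by (intro faithful) (simp_all add: Gm tr_comp)
  qed
  define \<eta> where "\<eta> X = lift X (G0 (Fo F X)) (\<delta> (Fo F X))" for X
  have \<eta>: "\<eta> X \<in> hom C X (G0 (Fo F X))" "Fm F (\<eta> X) = \<delta> (Fo F X)" if "X \<in> Ob C" for X
    using lift[of X "G0 (Fo F X)" "\<delta> (Fo F X)"] that by (auto simp: \<eta>_def G0 \<delta>)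
  note H = homD[OF \<eta>(1)]
  have "is_nat_iso C C id_functor (comp_functor G F) \<eta>"
    unfolding is_nat_iso_def
  proof (intro conjI ballI)
    fix X assume X: "X \<in> Ob C"
    show "\<eta> X \<in> hom C (Fo id_functor X) (Fo (comp_functor G F) X)"
      using \<eta>[OF X] by (simp add: id_functor_def comp_functor_def G_def)
    define \<theta> where "\<theta> = lift (G0 (Fo F X)) X (\<epsilon> (Fo F X))"
    have \<theta>: "\<theta> \<in> hom C (G0 (Fo F X)) X" "Fm F \<theta> = \<epsilon> (Fo F X)"
      using lift[of "G0 (Fo F X)" X "\<epsilon> (Fo F X)"] X by (auto simp: \<theta>_def G0 \<epsilon>)
    note T = homD[OF \<theta>(1)]
    show "is_iso C (\<eta> X)"
    proof (rule isoI[OF \<eta>(1)[OF X] \<theta>(1)])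
      show "Cmp C \<theta> (\<eta> X) = Id C X" "Cmp C (\<eta> X) \<theta> = Id C (G0 (Fo F X))"
        using X by (intro faithful; simp add: H T \<eta> \<theta> G0 \<epsilon>\<delta> \<delta>\<epsilon>)+
    qed
  next
    fix f assume f: "f \<in> Mor C"
    have "Cmp D (tr (Fm F f)) (\<delta> (Fo F (Dom C f))) = Cmp D (\<delta> (Fo F (Cod C f))) (Fm F f)"
      using f by (simp add: tr_def E Dl tgt.Cmp_assoc \<epsilon>\<delta>)
    then show "Cmp C (\<eta> (Cod C f)) (Fm id_functor f) = Cmp C (Fm (comp_functor G F) f) (\<eta> (Dom C f))"
      using f by (intro faithful) (simp_all add: id_functor_def comp_functor_def H Gm \<eta>)
  qed
  moreover have "is_nat_iso D D (comp_functor F G) id_functor \<epsilon>"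
    unfolding is_nat_iso_def
  proof (intro conjI ballI)
    fix X assume X: "X \<in> Ob D"
    show "\<epsilon> X \<in> hom D (Fo (comp_functor F G) X) (Fo id_functor X)"
      using \<epsilon>[OF X] by (simp add: id_functor_def comp_functor_def G_def)
    show "is_iso D (\<epsilon> X)" using iso[OF X] .
  next
    fix f assume f: "f \<in> Mor D"
    show "Cmp D (\<epsilon> (Cod D f)) (Fm (comp_functor F G) f) = Cmp D (Fm id_functor f) (\<epsilon> (Dom D f))"
      using f tr_cancel by (simp add: id_functor_def comp_functor_def Gm)
  qed
  ultimately show ?thesis using F Gf by (auto simp: is_equivalence_def)
qed


section \<open>Sieves and topologies\<close>

context category
begin

lemma is_sieveD:
  assumes "is_sieve C X R" "f \<in> R"
  shows "f \<in> Mor C" "Cod C f = X" "g \<in> Mor C \<Longrightarrow> Cod C g = Dom C f \<Longrightarrow> Cmp C f g \<in> R"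
  using assms by (auto simp: is_sieve_def)

lemma is_sieve_subset: "is_sieve C X R \<Longrightarrow> R \<subseteq> {f \<in> Mor C. Cod C f = X}"
  by (simp add: is_sieve_def)

lemma is_sieve_maximal: "is_sieve C X {f \<in> Mor C. Cod C f = X}"
  unfolding is_sieve_def by simp

lemma is_sieve_pull:
  assumes "is_sieve C (Cod C f) R" "f \<in> Mor C"
  shows "is_sieve C (Dom C f) (pull_sieve C f R)"
  unfolding is_sieve_def
proof (intro conjI ballI impI)
  show "pull_sieve C f R \<subseteq> {g \<in> Mor C. Cod C g = Dom C f}" by (auto simp: pull_sieve_def)
  fix g h assume g: "g \<in> pull_sieve C f R" and h: "h \<in> Mor C" "Cod C h = Dom C g"
  then have g': "g \<in> Mor C" "Cod C g = Dom C f" "Cmp C f g \<in> R" by (auto simp: pull_sieve_def)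
  have "Cmp C (Cmp C f g) h \<in> R" using is_sieveD(3)[OF assms(1) g'(3)] g' h assms(2) by simp
  then show "Cmp C g h \<in> pull_sieve C f R" using g' h assms(2) by (simp add: pull_sieve_def Cmp_assoc)
qed

lemma is_sieve_generated:
  assumes "S \<subseteq> {f \<in> Mor C. Cod C f = X}"
  shows "is_sieve C X (generated_sieve C S)"
  unfolding is_sieve_def generated_sieve_def
proof (intro conjI ballI impI subsetI)
  fix u assume "u \<in> {Cmp C f g |f g. f \<in> S \<and> g \<in> Mor C \<and> Cod C g = Dom C f}"
  then obtain f g where u: "u = Cmp C f g" "f \<in> S" "g \<in> Mor C" "Cod C g = Dom C f" by auto
  then show "u \<in> {f \<in> Mor C. Cod C f = X}" using assms by auto
  fix h assume h: "h \<in> Mor C" "Cod C h = Dom C u"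
  have "Cmp C u h = Cmp C f (Cmp C g h)" using u h assms by (auto simp: Cmp_assoc)
  then show "Cmp C u h \<in> {Cmp C f g |f g. f \<in> S \<and> g \<in> Mor C \<and> Cod C g = Dom C f}"
    using u h assms by fastforce
qed

lemma generated_superset:
  assumes "S \<subseteq> Mor C" "f \<in> S"
  shows "f \<in> generated_sieve C S"
proof -
  have "f = Cmp C f (Id C (Dom C f)) \<and> f \<in> S \<and> Id C (Dom C f) \<in> Mor C \<and> Cod C (Id C (Dom C f)) = Dom C f"
    using assms by (simp add: subset_iff)
  then show ?thesis unfolding generated_sieve_def by blast
qed

lemma generated_least: "is_sieve C X R \<Longrightarrow> S \<subseteq> R \<Longrightarrow> generated_sieve C S \<subseteq> R"
  by (auto simp: generated_sieve_def is_sieve_def)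

lemma generated_mono: "S \<subseteq> S' \<Longrightarrow> generated_sieve C S \<subseteq> generated_sieve C S'"
  unfolding generated_sieve_def by blast

lemma generated_of_sieve: "is_sieve C X R \<Longrightarrow> generated_sieve C R = R"
  using generated_least[of X R R] generated_superset[of R] by (auto simp: is_sieve_def)

lemma pull_sieve_Cmp:
  assumes "f \<in> Mor C" "g \<in> Mor C" "Cod C g = Dom C f"
  shows "pull_sieve C (Cmp C f g) R = pull_sieve C g (pull_sieve C f R)"
  unfolding pull_sieve_def
proof (rule Collect_cong)
  fix h show "h \<in> Mor C \<and> Cod C h = Dom C (Cmp C f g) \<and> Cmp C (Cmp C f g) h \<in> R \<longleftrightarrow>
      h \<in> Mor C \<and> Cod C h = Dom C g \<and> Cmp C g h \<in> {h \<in> Mor C. Cod C h = Dom C f \<and> Cmp C f h \<in> R}"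
    using assms by (auto simp: Cmp_assoc)
qed

lemma pull_sieve_Id: "is_sieve C X R \<Longrightarrow> X \<in> Ob C \<Longrightarrow> pull_sieve C (Id C X) R = R"
proof (rule set_eqI)
  fix f assume R: "is_sieve C X R" and X: "X \<in> Ob C"
  have "f \<in> R \<Longrightarrow> f \<in> Mor C \<and> Cod C f = X" using is_sieveD(1,2)[OF R] by blast
  moreover have "f \<in> Mor C \<and> Cod C f = X \<Longrightarrow> Cmp C (Id C X) f = f" by simp
  ultimately show "f \<in> pull_sieve C (Id C X) R \<longleftrightarrow> f \<in> R"
    using X by (cases "f \<in> Mor C \<and> Cod C f = X") (auto simp: pull_sieve_def)
qed

lemma pull_sieve_mem:
  assumes "is_sieve C X R" "f \<in> R"
  shows "pull_sieve C f R = {g \<in> Mor C. Cod C g = Dom C f}"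
  using is_sieveD(3)[OF assms] by (auto simp: pull_sieve_def)

lemma Id_mem_pull_sieve:
  assumes "f \<in> Mor C"
  shows "Id C (Dom C f) \<in> pull_sieve C f R \<longleftrightarrow> f \<in> R"
  using assms by (auto simp: pull_sieve_def)

end

context grothendieck_topology
begin

lemma covering_local:
  assumes X: "X \<in> Ob C" and R: "R \<in> J X" and S: "is_sieve C X S"
    and loc: "\<And>f. f \<in> R \<Longrightarrow> \<exists>Q\<in>J (Dom C f). \<forall>h\<in>Q. Cmp C f h \<in> S"
  shows "S \<in> J X"
proof (rule local_character[OF X R S])
  note R' = is_sieveD[OF sieves[OF X R]]
  fix f assume f: "f \<in> R"
  then obtain Q where Q: "Q \<in> J (Dom C f)" "\<forall>h\<in>Q. Cmp C f h \<in> S" using loc by blast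
  have D: "Dom C f \<in> Ob C" and m: "f \<in> Mor C" "Cod C f = X" using R'[OF f] by auto
  have P: "is_sieve C (Dom C f) (pull_sieve C f S)" using is_sieve_pull S m by auto
  show "pull_sieve C f S \<in> J (Dom C f)"
  proof (rule local_character[OF D Q(1) P])
    fix h assume h: "h \<in> Q"
    note h' = is_sieveD[OF sieves[OF D Q(1)] h]
    have "h \<in> pull_sieve C f S" using Q(2) h h' by (auto simp: pull_sieve_def)
    then show "pull_sieve C h (pull_sieve C f S) \<in> J (Dom C h)"
      using pull_sieve_mem[OF P] maximal h' by simp
  qed
qed

lemma covering_superset:
  assumes "X \<in> Ob C" "R \<in> J X" "is_sieve C X S" "R \<subseteq> S"
  shows "S \<in> J X"
proof (rule covering_local[OF assms(1-3)])
  fix f assume f: "f \<in> R"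
  then have "f \<in> S" using assms(4) by auto
  note f' = is_sieveD[OF assms(3) this]
  show "\<exists>Q\<in>J (Dom C f). \<forall>h\<in>Q. Cmp C f h \<in> S"
  proof (intro bexI ballI)
    show "{h \<in> Mor C. Cod C h = Dom C f} \<in> J (Dom C f)" using maximal f'(1) by simp
  qed (simp add: f'(3))
qed

lemma covering_sieve: "X \<in> Ob C \<Longrightarrow> R \<in> J X \<Longrightarrow> covering C J X R"
  using sieves[of X R] is_sieve_subset[of X R] by (simp add: covering_def generated_of_sieve)

end

text \<open>The generated topology is an intersection of topologies, hence a topology. If no topology makes
  all the given families covering, the intersection is that of no topologies, and all sieves cover.\<close>

context category
begin

lemma generated_topology_topology: "grothendieck_topology C (generated_topology C \<F>)"
proof unfold_locales
  show "is_sieve C X R" if "R \<in> generated_topology C \<F> X" for X R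
    using that by (auto simp: generated_topology_def)
  show "pull_sieve C f R \<in> generated_topology C \<F> (Dom C f)"
    if "f \<in> Mor C" "R \<in> generated_topology C \<F> (Cod C f)" for f R
    using that by (auto simp: generated_topology_def is_sieve_pull intro: grothendieck_topology.stable)
  show "S \<in> generated_topology C \<F> X"
    if "X \<in> Ob C" "R \<in> generated_topology C \<F> X" "is_sieve C X S"
      "\<And>f. f \<in> R \<Longrightarrow> pull_sieve C f S \<in> generated_topology C \<F> (Dom C f)" for X R S
    unfolding generated_topology_def
  proof (clarsimp simp: that(3))
    fix K assume K: "grothendieck_topology C K" "\<forall>Y\<in>Ob C. \<forall>S\<in>\<F> Y. covering C K Y S"
    from K(1) show "S \<in> K X"
      by (rule grothendieck_topology.local_character[OF _ that(1) _ that(3)])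
        (use that K in \<open>auto simp: generated_topology_def\<close>)
  qed
  show "{f \<in> Mor C. Cod C f = X} \<in> generated_topology C \<F> X" if "X \<in> Ob C" for X
    using that by (auto simp: generated_topology_def is_sieve_maximal intro: grothendieck_topology.maximal)
qed

lemma generated_topology_covering:
  assumes "X \<in> Ob C" "S \<in> \<F> X" "S \<subseteq> {f \<in> Mor C. Cod C f = X}"
  shows "covering C (generated_topology C \<F>) X S"
  using assms is_sieve_generated[OF assms(3)]
  unfolding covering_def generated_topology_def by auto

lemma generated_topology_least:
  assumes "grothendieck_topology C K" "\<And>Y S. Y \<in> Ob C \<Longrightarrow> S \<in> \<F> Y \<Longrightarrow> covering C K Y S"
  shows "generated_topology C \<F> X \<subseteq> K X"
  using assms unfolding generated_topology_def by auto

end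


section \<open>Presheaves and sheaves\<close>

lemma presheafD:
  assumes "presheaf elts C F"
  shows "Po F \<in> extensional (Ob C)" "Pm F \<in> extensional (Mor C)"
    and "f \<in> Mor C \<Longrightarrow> Pm F f \<in> elts (Po F (Cod C f)) \<rightarrow>\<^sub>E elts (Po F (Dom C f))"
    and "f \<in> Mor C \<Longrightarrow> Cod C f = X \<Longrightarrow> x \<in> elts (Po F X) \<Longrightarrow> Pm F f x \<in> elts (Po F (Dom C f))"
    and "X \<in> Ob C \<Longrightarrow> x \<in> elts (Po F X) \<Longrightarrow> Pm F (Id C X) x = x"
    and "f \<in> Mor C \<Longrightarrow> g \<in> Mor C \<Longrightarrow> Cod C f = Dom C g \<Longrightarrow> Cod C g = X \<Longrightarrow> x \<in> elts (Po F X)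
      \<Longrightarrow> Pm F (Cmp C g f) x = Pm F f (Pm F g x)"
  using assms by (auto simp: presheaf_def PiE_def Pi_def)

lemma sheaf_presheaf: "sheaf elts C J F \<Longrightarrow> presheaf elts C F"
  by (simp add: sheaf_def)

lemma sheaf_glue:
  assumes "sheaf elts C J F" "X \<in> Ob C" "R \<in> J X" "matching_family elts C F R s"
  shows "\<exists>!x. x \<in> elts (Po F X) \<and> (\<forall>f\<in>R. Pm F f x = s f)"
  using assms unfolding sheaf_def by blast

lemma (in grothendieck_topology) sheaf_separated:
  assumes F: "sheaf elts C J F" and X: "X \<in> Ob C" "R \<in> J X"
    and x: "x \<in> elts (Po F X)" and y: "y \<in> elts (Po F X)"
    and eq: "\<And>f. f \<in> R \<Longrightarrow> Pm F f x = Pm F f y"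
  shows "x = y"
proof -
  note P = presheafD[OF sheaf_presheaf[OF F]] and R = is_sieveD[OF sieves[OF X]]
  have "matching_family elts C F R (\<lambda>f. Pm F f x)"
    unfolding matching_family_def using R x P(4)[of _ X x] P(6)[of _ _ X x] by auto
  from sheaf_glue[OF F X this] show ?thesis using x y eq by metis
qed

text \<open>A presheaf of small sets is isomorphic to a presheaf with values in the universe.\<close>

lemma (in category) presheaf_of_small_sets:
  fixes A :: "'o \<Rightarrow> 'x set" and res :: "'a \<Rightarrow> 'x \<Rightarrow> 'x"
  assumes small: "\<And>X. X \<in> Ob C \<Longrightarrow> small elts (A X)"
    and res: "\<And>f a. f \<in> Mor C \<Longrightarrow> a \<in> A (Cod C f) \<Longrightarrow> res f a \<in> A (Dom C f)"
    and res_Id: "\<And>X a. X \<in> Ob C \<Longrightarrow> a \<in> A X \<Longrightarrow> res (Id C X) a = a"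
    and res_Cmp: "\<And>f g a. f \<in> Mor C \<Longrightarrow> g \<in> Mor C \<Longrightarrow> Cod C f = Dom C g \<Longrightarrow> a \<in> A (Cod C g)
      \<Longrightarrow> res (Cmp C g f) a = res f (res g a)"
  obtains F e where "presheaf elts C F"
    and "\<And>X. X \<in> Ob C \<Longrightarrow> bij_betw (e X) (A X) (elts (Po F X))"
    and "\<And>f a. f \<in> Mor C \<Longrightarrow> a \<in> A (Cod C f) \<Longrightarrow> Pm F f (e (Cod C f) a) = e (Dom C f) (res f a)"
proof -
  have "\<exists>p e. bij_betw e (A X) (elts p)" if "X \<in> Ob C" for X
    using small[OF that] by (auto simp: small_def eqpoll_def)
  then obtain P e where e: "\<And>X. X \<in> Ob C \<Longrightarrow> bij_betw (e X) (A X) (elts (P X))" by metis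
  define d where "d X = inv_into (A X) (e X)" for X
  have d: "d X y \<in> A X" "e X (d X y) = y" if "X \<in> Ob C" "y \<in> elts (P X)" for X y
    using e[OF that(1)] that(2) unfolding d_def bij_betw_def
    by (auto intro: inv_into_into f_inv_into_f)
  have de: "d X (e X a) = a" if "X \<in> Ob C" "a \<in> A X" for X a
    using e[OF that(1)] that(2) unfolding d_def bij_betw_def by (auto intro: inv_into_f_f)
  have eA: "e X a \<in> elts (P X)" if "X \<in> Ob C" "a \<in> A X" for X a
    using e[OF that(1)] that(2) by (auto simp: bij_betw_def)
  define F where "F = \<lparr>Po = restrict P (Ob C),
    Pm = (\<lambda>f\<in>Mor C. \<lambda>y\<in>elts (P (Cod C f)). e (Dom C f) (res f (d (Cod C f) y)))\<rparr>"
  show thesis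
  proof (rule that[of F e])
    show "presheaf elts C F"
      unfolding presheaf_def F_def
      by (auto simp: d eA res res_Id res_Cmp de)
    show "bij_betw (e X) (A X) (elts (Po F X))" if "X \<in> Ob C" for X
      using e that by (simp add: F_def)
    show "Pm F f (e (Cod C f) a) = e (Dom C f) (res f a)" if "f \<in> Mor C" "a \<in> A (Cod C f)" for f a
      using that by (simp add: F_def eA de)
  qed
qed

text \<open>The sheaf condition can be checked before the sets are replaced by elements of the universe.\<close>

lemma (in grothendieck_topology) sheaf_of_small_sets:
  fixes A :: "'o \<Rightarrow> 'x set" and res :: "'a \<Rightarrow> 'x \<Rightarrow> 'x"
  assumes small: "\<And>X. X \<in> Ob C \<Longrightarrow> small elts (A X)"
    and res: "\<And>f a. f \<in> Mor C \<Longrightarrow> a \<in> A (Cod C f) \<Longrightarrow> res f a \<in> A (Dom C f)"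
    and res_Id: "\<And>X a. X \<in> Ob C \<Longrightarrow> a \<in> A X \<Longrightarrow> res (Id C X) a = a"
    and res_Cmp: "\<And>f g a. f \<in> Mor C \<Longrightarrow> g \<in> Mor C \<Longrightarrow> Cod C f = Dom C g \<Longrightarrow> a \<in> A (Cod C g)
      \<Longrightarrow> res (Cmp C g f) a = res f (res g a)"
    and glue: "\<And>X R s. X \<in> Ob C \<Longrightarrow> R \<in> J X \<Longrightarrow> (\<And>f. f \<in> R \<Longrightarrow> s f \<in> A (Dom C f))
      \<Longrightarrow> (\<And>f g. f \<in> R \<Longrightarrow> g \<in> Mor C \<Longrightarrow> Cod C g = Dom C f \<Longrightarrow> s (Cmp C f g) = res g (s f))
      \<Longrightarrow> \<exists>a\<in>A X. \<forall>f\<in>R. res f a = s f"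
    and separated: "\<And>X R a b. X \<in> Ob C \<Longrightarrow> R \<in> J X \<Longrightarrow> a \<in> A X \<Longrightarrow> b \<in> A X
      \<Longrightarrow> (\<And>f. f \<in> R \<Longrightarrow> res f a = res f b) \<Longrightarrow> a = b"
  obtains F e where "sheaf elts C J F"
    and "\<And>X. X \<in> Ob C \<Longrightarrow> bij_betw (e X) (A X) (elts (Po F X))"
    and "\<And>f a. f \<in> Mor C \<Longrightarrow> a \<in> A (Cod C f) \<Longrightarrow> Pm F f (e (Cod C f) a) = e (Dom C f) (res f a)"
proof -
  obtain F e where F: "presheaf elts C F"
    and e: "\<And>X. X \<in> Ob C \<Longrightarrow> bij_betw (e X) (A X) (elts (Po F X))"
    and nat: "\<And>f a. f \<in> Mor C \<Longrightarrow> a \<in> A (Cod C f) \<Longrightarrow> Pm F f (e (Cod C f) a) = e (Dom C f) (res f a)"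
    using presheaf_of_small_sets[of elts A res, OF small res res_Id res_Cmp] by blast
  have inj: "a = b" if "e X a = e X b" "X \<in> Ob C" "a \<in> A X" "b \<in> A X" for X a b
    using e[OF that(2)] that by (auto simp: bij_betw_def inj_on_def)
  have surj: "\<exists>a\<in>A X. y = e X a" if "X \<in> Ob C" "y \<in> elts (Po F X)" for X y
    using e[OF that(1)] that(2) by (auto simp: bij_betw_def)
  have eA: "e X a \<in> elts (Po F X)" if "X \<in> Ob C" "a \<in> A X" for X a
    using e[OF that(1)] that(2) by (auto simp: bij_betw_def)
  have "sheaf elts C J F"
    unfolding sheaf_def
  proof (intro conjI ballI allI impI F)
    fix X R s assume X: "X \<in> Ob C" and R: "R \<in> J X" and s: "matching_family elts C F R s"
    note R' = is_sieveD[OF sieves[OF X R]]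
    have "\<exists>a\<in>A (Dom C f). s f = e (Dom C f) a" if "f \<in> R" for f
      using s surj R'[OF that] that by (auto simp: matching_family_def)
    then obtain t where t: "\<And>f. f \<in> R \<Longrightarrow> t f \<in> A (Dom C f)"
      and st: "\<And>f. f \<in> R \<Longrightarrow> s f = e (Dom C f) (t f)" by metis
    have "t (Cmp C f g) = res g (t f)" if fg: "f \<in> R" "g \<in> Mor C" "Cod C g = Dom C f" for f g
    proof (rule inj[of "Dom C g"])
      note f' = R'[OF fg(1)] and c = R'(3)[OF fg]
      have "e (Dom C g) (t (Cmp C f g)) = s (Cmp C f g)" using st[OF c] f' fg by simp
      also have "\<dots> = Pm F g (s f)" using s fg by (auto simp: matching_family_def)
      also have "\<dots> = e (Dom C g) (res g (t f))" using st nat[of g "t f"] t fg by simp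
      finally show "e (Dom C g) (t (Cmp C f g)) = e (Dom C g) (res g (t f))" .
      show "t (Cmp C f g) \<in> A (Dom C g)" using t[OF c] f' fg by simp
      show "res g (t f) \<in> A (Dom C g)" using res t fg by simp
    qed (use fg in auto)
    then obtain a where a: "a \<in> A X" "\<And>f. f \<in> R \<Longrightarrow> res f a = t f"
      using glue[OF X R, of t] t by blast
    show "\<exists>!x. x \<in> elts (Po F X) \<and> (\<forall>f\<in>R. Pm F f x = s f)"
    proof (rule ex1I[of _ "e X a"])
      show "e X a \<in> elts (Po F X) \<and> (\<forall>f\<in>R. Pm F f (e X a) = s f)"
      proof (intro conjI ballI)
        show "Pm F f (e X a) = s f" if f: "f \<in> R" for f
          using nat[of f a] a R'[OF f] st f by simp
      qed (rule eA[OF X a(1)])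
      fix y assume y: "y \<in> elts (Po F X) \<and> (\<forall>f\<in>R. Pm F f y = s f)"
      then obtain b where b: "b \<in> A X" "y = e X b" using surj X by blast
      have "res f b = res f a" if f: "f \<in> R" for f
      proof (rule inj[of "Dom C f"])
        show "e (Dom C f) (res f b) = e (Dom C f) (res f a)"
          using y b f nat[of f b] a st R'[OF f] by auto
      qed (use R'[OF f] res a b in auto)
      then have "b = a" by (rule separated[OF X R b(1) a(1)])
      then show "y = e X a" using b by simp
    qed
  qed
  then show thesis using that e nat by blast
qed


section \<open>The sheaf of closed sieves\<close>

text \<open>A sieve is closed if it contains every arrow along which its inverse image is covering. The
  closed sieves form a sheaf, with inverse images as restrictions. A sieve is covering if and only if
  its closure is maximal, so that this sheaf detects the covering sieves.\<close>

context grothendieck_topology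
begin

definition closed_sieves :: "'o \<Rightarrow> 'a set set" where
  "closed_sieves X = {S. is_sieve C X S
     \<and> (\<forall>f\<in>Mor C. Cod C f = X \<and> pull_sieve C f S \<in> J (Dom C f) \<longrightarrow> f \<in> S)}"

text \<open>The arrows to \<open>X\<close> along which the inverse image of \<open>S\<close> is covering.\<close>

definition closure :: "'o \<Rightarrow> 'a set \<Rightarrow> 'a set" where
  "closure X S = {f \<in> Mor C. Cod C f = X \<and> pull_sieve C f S \<in> J (Dom C f)}"

lemma closure_superset: "is_sieve C X S \<Longrightarrow> S \<subseteq> closure X S"
proof
  fix f assume S: "is_sieve C X S" and f: "f \<in> S"
  show "f \<in> closure X S"
    using is_sieveD(1,2)[OF S f] pull_sieve_mem[OF S f] maximal[of "Dom C f"] by (simp add: closure_def)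
qed

lemma closure_closed:
  assumes X: "X \<in> Ob C" and S: "is_sieve C X S"
  shows "closure X S \<in> closed_sieves X"
proof -
  have 1: "is_sieve C X (closure X S)"
    unfolding is_sieve_def
  proof (intro conjI ballI impI)
    show "closure X S \<subseteq> {f \<in> Mor C. Cod C f = X}" by (auto simp: closure_def)
    fix f g assume "f \<in> closure X S" "g \<in> Mor C" "Cod C g = Dom C f"
    then show "Cmp C f g \<in> closure X S"
      using stable[of g "pull_sieve C f S"] by (simp add: closure_def pull_sieve_Cmp)
  qed
  have "f \<in> closure X S"
    if f: "f \<in> Mor C" "Cod C f = X" "pull_sieve C f (closure X S) \<in> J (Dom C f)" for f
  proof -
    have "pull_sieve C f S \<in> J (Dom C f)"
    proof (rule local_character[OF _ f(3)])
      show "is_sieve C (Dom C f) (pull_sieve C f S)" using is_sieve_pull f S by auto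
      fix g assume "g \<in> pull_sieve C f (closure X S)"
      then have "g \<in> Mor C" "Cod C g = Dom C f" "pull_sieve C (Cmp C f g) S \<in> J (Dom C (Cmp C f g))"
        by (auto simp: pull_sieve_def[of C f] closure_def)
      then show "pull_sieve C g (pull_sieve C f S) \<in> J (Dom C g)"
        using f by (simp add: pull_sieve_Cmp)
    qed (use f in auto)
    then show ?thesis using f by (auto simp: closure_def)
  qed
  then show ?thesis using 1 by (auto simp: closed_sieves_def)
qed

lemma closed_sieves_pull:
  assumes "f \<in> Mor C" "S \<in> closed_sieves (Cod C f)"
  shows "pull_sieve C f S \<in> closed_sieves (Dom C f)"
  unfolding closed_sieves_def
proof (intro CollectI conjI ballI impI; (elim conjE)?)
  show "is_sieve C (Dom C f) (pull_sieve C f S)"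
    using assms is_sieve_pull by (auto simp: closed_sieves_def)
  fix g assume g: "g \<in> Mor C" "Cod C g = Dom C f" "pull_sieve C g (pull_sieve C f S) \<in> J (Dom C g)"
  then have "Cmp C f g \<in> S"
    using assms by (simp add: closed_sieves_def pull_sieve_Cmp[symmetric])
  then show "g \<in> pull_sieve C f S" using g by (simp add: pull_sieve_def)
qed

lemma maximal_closed: "X \<in> Ob C \<Longrightarrow> {f \<in> Mor C. Cod C f = X} \<in> closed_sieves X"
  by (simp add: closed_sieves_def is_sieve_maximal)

lemma closed_sieves_separated:
  assumes X: "X \<in> Ob C" and R: "R \<in> J X" and S: "S \<in> closed_sieves X" and S': "S' \<in> closed_sieves X"
    and eq: "\<And>f. f \<in> R \<Longrightarrow> pull_sieve C f S = pull_sieve C f S'"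
  shows "S = S'"
proof -
  have "A \<subseteq> B" if A: "A \<in> closed_sieves X" and B: "B \<in> closed_sieves X"
    and eq: "\<And>f. f \<in> R \<Longrightarrow> pull_sieve C f A = pull_sieve C f B" for A B
  proof
    fix g assume g: "g \<in> A"
    have A': "is_sieve C X A" and B': "is_sieve C X B" using A B by (auto simp: closed_sieves_def)
    note g' = is_sieveD[OF A' g]
    have "pull_sieve C g B \<in> J (Dom C g)"
    proof (rule covering_superset[of _ "pull_sieve C g R"])
      show "pull_sieve C g R \<in> J (Dom C g)" using stable[of g R] g' R by simp
      show "is_sieve C (Dom C g) (pull_sieve C g B)" using is_sieve_pull[of g B] g' B' by simp
      show "pull_sieve C g R \<subseteq> pull_sieve C g B"
      proof
        fix h assume h: "h \<in> pull_sieve C g R"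
        then have "Cmp C g h \<in> A" "Cmp C g h \<in> R" using g' by (auto simp: pull_sieve_def)
        then have "Cmp C g h \<in> B"
          using eq[of "Cmp C g h"] Id_mem_pull_sieve[of "Cmp C g h"] is_sieveD[OF A'] by blast
        then show "h \<in> pull_sieve C g B" using h by (auto simp: pull_sieve_def)
      qed
    qed (use g' in auto)
    then show "g \<in> B" using B g' by (auto simp: closed_sieves_def)
  qed
  from this[OF S S' eq] this[OF S' S] eq show ?thesis by blast
qed

lemma closed_sieves_glue:
  assumes X: "X \<in> Ob C" and R: "R \<in> J X" and s: "\<And>f. f \<in> R \<Longrightarrow> s f \<in> closed_sieves (Dom C f)"
    and match: "\<And>f g. f \<in> R \<Longrightarrow> g \<in> Mor C \<Longrightarrow> Cod C g = Dom C f \<Longrightarrow> s (Cmp C f g) = pull_sieve C g (s f)"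
  shows "\<exists>S\<in>closed_sieves X. \<forall>f\<in>R. pull_sieve C f S = s f"
proof -
  note R' = is_sieveD[OF sieves[OF X R]]
  define S0 where "S0 = {f \<in> R. Id C (Dom C f) \<in> s f}"
  have s_sieve: "is_sieve C (Dom C f) (s f)" if "f \<in> R" for f
    using s[OF that] by (auto simp: closed_sieves_def)
  \<comment> \<open>\<open>s f\<close> contains exactly the arrows \<open>h\<close> with \<open>f h \<in> S0\<close>\<close>
  have mem: "Cmp C f h \<in> S0 \<longleftrightarrow> h \<in> s f" if "f \<in> R" "h \<in> Mor C" "Cod C h = Dom C f" for f h
    using R'[OF that(1)] that match[OF that] Id_mem_pull_sieve[OF that(2)]
    by (auto simp: S0_def)
  have pull: "pull_sieve C f S0 = s f" if "f \<in> R" for f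
    using mem[OF that] is_sieveD(1,2)[OF s_sieve[OF that]] by (auto simp: pull_sieve_def)
  have S0: "is_sieve C X S0"
    unfolding is_sieve_def
  proof (intro conjI ballI impI)
    show "S0 \<subseteq> {f \<in> Mor C. Cod C f = X}" using R' by (auto simp: S0_def)
    fix f g assume fg: "f \<in> S0" "g \<in> Mor C" "Cod C g = Dom C f"
    then have f: "f \<in> R" "Id C (Dom C f) \<in> s f" by (auto simp: S0_def)
    have "Cmp C (Id C (Dom C f)) g \<in> s f"
      using is_sieveD(3)[OF s_sieve[OF f(1)] f(2)] fg R'[OF f(1)] by simp
    then have "g \<in> s f" using fg by simp
    then show "Cmp C f g \<in> S0" using mem f fg by simp
  qed
  have "pull_sieve C f (closure X S0) = s f" if f: "f \<in> R" for f
  proof -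
    note f' = R'[OF f]
    have "h \<in> pull_sieve C f (closure X S0) \<longleftrightarrow> h \<in> s f" if h: "h \<in> Mor C" "Cod C h = Dom C f" for h
    proof -
      have "h \<in> pull_sieve C f (closure X S0) \<longleftrightarrow> pull_sieve C h (s f) \<in> J (Dom C h)"
        using h f' pull[OF f] by (subst pull_sieve_def) (simp add: closure_def pull_sieve_Cmp)
      also have "\<dots> \<longleftrightarrow> h \<in> s f"
        using s[OF f] h pull_sieve_mem[OF s_sieve[OF f]] maximal[of "Dom C h"]
        by (auto simp: closed_sieves_def)
      finally show ?thesis .
    qed
    then show ?thesis
      using is_sieveD(1,2)[OF s_sieve[OF f]] by (auto simp: pull_sieve_def[of C f "closure X S0"])
  qed
  then show ?thesis using closure_closed[OF X S0] by blast
qed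

end

text \<open>In a \<open>\<U>\<close>-site a closed sieve is determined by its members whose source lies in a small
  topologically generating set of objects.\<close>

lemma (in universe) small_closed_sieves:
  assumes "U_site elts C J" and X: "X \<in> Ob C"
  shows "small elts (grothendieck_topology.closed_sieves C J X)"
proof -
  interpret grothendieck_topology C J using assms by (simp add: U_site_def)
  obtain G where G: "G \<subseteq> Ob C" "small elts G"
    and cov: "\<And>X. X \<in> Ob C \<Longrightarrow> \<exists>S. covering C J X S \<and> Dom C ` S \<subseteq> G"
    using assms(1) unfolding U_site_def by metis
  define H where "H = (\<Union>Y\<in>G. hom C Y X)"
  have "small elts H"
    unfolding H_def
  proof (rule small_UN[OF G(2)])
    show "small elts (hom C Y X)" if "Y \<in> G" for Y
      using assms G(1) that unfolding U_site_def by blast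
  qed
  have mem: "f \<in> S \<longleftrightarrow> (\<forall>g\<in>Mor C. Cod C g = Dom C f \<and> Dom C g \<in> G \<longrightarrow> Cmp C f g \<in> S \<inter> H)"
    if S: "S \<in> closed_sieves X" and f: "f \<in> Mor C" "Cod C f = X" for S f
  proof
    have S': "is_sieve C X S" using S by (auto simp: closed_sieves_def)
    show "\<forall>g\<in>Mor C. Cod C g = Dom C f \<and> Dom C g \<in> G \<longrightarrow> Cmp C f g \<in> S \<inter> H" if "f \<in> S"
      using is_sieveD[OF S' that] by (auto simp: H_def hom_def)
    assume *: "\<forall>g\<in>Mor C. Cod C g = Dom C f \<and> Dom C g \<in> G \<longrightarrow> Cmp C f g \<in> S \<inter> H"
    obtain Q where Q: "covering C J (Dom C f) Q" "Dom C ` Q \<subseteq> G" using cov f by (meson dom_in)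
    have P: "is_sieve C (Dom C f) (pull_sieve C f S)" using is_sieve_pull S' f by auto
    have "Q \<subseteq> pull_sieve C f S" using * Q by (auto simp: pull_sieve_def covering_def)
    then have "generated_sieve C Q \<subseteq> pull_sieve C f S" by (rule generated_least[OF P])
    then have "pull_sieve C f S \<in> J (Dom C f)"
      using covering_superset[OF _ _ P] Q f by (auto simp: covering_def)
    then show "f \<in> S" using S f by (auto simp: closed_sieves_def)
  qed
  show ?thesis
  proof (rule small_inj[OF small_Pow[OF \<open>small elts H\<close>], of "\<lambda>S. S \<inter> H"])
    show "inj_on (\<lambda>S. S \<inter> H) (closed_sieves X)"
    proof (rule inj_onI)
      fix S S' assume *: "S \<in> closed_sieves X" "S' \<in> closed_sieves X" "S \<inter> H = S' \<inter> H"
      have "f \<in> S \<longleftrightarrow> f \<in> S'" if "f \<in> Mor C" "Cod C f = X" for f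
        using mem[OF *(1) that] mem[OF *(2) that] *(3) by simp
      moreover have "S \<subseteq> {f \<in> Mor C. Cod C f = X}" "S' \<subseteq> {f \<in> Mor C. Cod C f = X}"
        using * is_sieve_subset by (auto simp: closed_sieves_def)
      ultimately show "S = S'" by blast
    qed
  qed auto
qed

text \<open>Restricting the sheaf of closed sieves along a continuous functor gives a separated presheaf, in
  which the maximal sieve and the closure of the image of a covering sieve agree locally.\<close>

lemma (in universe) continuous_preserves_covering_sieves:
  assumes "grothendieck_topology C J" and "continuous_functor elts C J D K F"
    and U: "U_site elts D K" and X: "X \<in> Ob C" and R: "R \<in> J X"
  shows "generated_sieve D (Fm F ` R) \<in> K (Fo F X)"
proof -
  interpret C: grothendieck_topology C J by fact
  interpret D: grothendieck_topology D K using U by (simp add: U_site_def)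
  interpret cat_functor C D F using assms(2) by unfold_locales (simp add: continuous_functor_def)
  have pull_Id: "pull_sieve D (Id D Y) S = S" if "Y \<in> Ob D" "S \<in> D.closed_sieves Y" for Y S
    using that D.pull_sieve_Id[of Y S] by (auto simp: D.closed_sieves_def)
  obtain \<Omega> e where \<Omega>: "sheaf elts D K \<Omega>"
    and e: "\<And>Y. Y \<in> Ob D \<Longrightarrow> bij_betw (e Y) (D.closed_sieves Y) (elts (Po \<Omega> Y))"
    and nat: "\<And>f S. f \<in> Mor D \<Longrightarrow> S \<in> D.closed_sieves (Cod D f)
      \<Longrightarrow> Pm \<Omega> f (e (Cod D f) S) = e (Dom D f) (pull_sieve D f S)"
  proof (rule D.sheaf_of_small_sets[of elts D.closed_sieves "pull_sieve D"])
    show "small elts (D.closed_sieves Y)" if "Y \<in> Ob D" for Y using small_closed_sieves[OF U that] .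
  qed ((simp add: D.closed_sieves_pull pull_Id D.pull_sieve_Cmp D.closed_sieves_glue
        D.closed_sieves_separated; fail) | blast)+
  have res: "sheaf elts C J (restrict_presheaf C F \<Omega>)"
    using assms(2) \<Omega> by (auto simp: continuous_functor_def)
  define S where "S = generated_sieve D (Fm F ` R)"
  note R' = C.is_sieveD[OF C.sieves[OF X R]]
  have sub: "Fm F ` R \<subseteq> {f \<in> Mor D. Cod D f = Fo F X}" using R' by auto
  have S: "is_sieve D (Fo F X) S" unfolding S_def using sub by (rule D.is_sieve_generated)
  have FX: "Fo F X \<in> Ob D" using X by simp
  define M where "M = {f \<in> Mor D. Cod D f = Fo F X}"
  have cl: "D.closure (Fo F X) S \<in> D.closed_sieves (Fo F X)" by (rule D.closure_closed[OF FX S])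
  have M: "M \<in> D.closed_sieves (Fo F X)" unfolding M_def by (rule D.maximal_closed[OF FX])
  have "e (Fo F X) (D.closure (Fo F X) S) = e (Fo F X) M"
  proof (rule C.sheaf_separated[OF res X R])
    show "e (Fo F X) (D.closure (Fo F X) S) \<in> elts (Po (restrict_presheaf C F \<Omega>) X)"
      "e (Fo F X) M \<in> elts (Po (restrict_presheaf C F \<Omega>) X)"
      using e[OF FX] cl M X by (auto simp: restrict_presheaf_def bij_betw_def)
    fix f assume f: "f \<in> R"
    note f' = R'[OF f]
    have "Fm F f \<in> S" unfolding S_def by (rule D.generated_superset) (use sub f in auto)
    then have "Fm F f \<in> D.closure (Fo F X) S" using D.closure_superset[OF S] by auto
    moreover have "Fm F f \<in> M" using f' by (simp add: M_def)
    moreover have "is_sieve D (Fo F X) (D.closure (Fo F X) S)" "is_sieve D (Fo F X) M"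
      using cl M by (simp_all add: D.closed_sieves_def)
    ultimately have "pull_sieve D (Fm F f) (D.closure (Fo F X) S) = pull_sieve D (Fm F f) M"
      using D.pull_sieve_mem by simp
    then show "Pm (restrict_presheaf C F \<Omega>) f (e (Fo F X) (D.closure (Fo F X) S))
        = Pm (restrict_presheaf C F \<Omega>) f (e (Fo F X) M)"
      using f' nat[of "Fm F f"] cl M by (simp add: restrict_presheaf_def)
  qed
  then have "D.closure (Fo F X) S = M"
    using e[OF FX] cl M by (auto simp: bij_betw_def inj_on_def)
  then have "Id D (Fo F X) \<in> D.closure (Fo F X) S" using FX by (simp add: M_def)
  then show ?thesis using D.pull_sieve_Id[OF S FX] FX by (auto simp: D.closure_def S_def)
qed


section \<open>Categories of sheaves and restriction functors\<close>

lemma sheaf_cat_simps [simp]: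
  "Ob (sheaf_cat elts C J) = {F. sheaf elts C J F}"
  "Dom (sheaf_cat elts C J) (F, G, \<alpha>) = F"
  "Cod (sheaf_cat elts C J) (F, G, \<alpha>) = G"
  "Id (sheaf_cat elts C J) F = (F, F, \<lambda>X\<in>Ob C. \<lambda>x\<in>elts (Po F X). x)"
  "Cmp (sheaf_cat elts C J) (G', H, \<beta>) (F, G, \<alpha>) =
    (F, H, \<lambda>X\<in>Ob C. compose (elts (Po F X)) (\<beta> X) (\<alpha> X))"
  "(F, G, \<alpha>) \<in> Mor (sheaf_cat elts C J) \<longleftrightarrow>
    sheaf elts C J F \<and> sheaf elts C J G \<and> presheaf_nat elts C F G \<alpha>"
  by (simp_all add: sheaf_cat_def)

lemma hom_sheaf_cat:
  "u \<in> hom (sheaf_cat elts C J) F G \<longleftrightarrow>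
    (\<exists>\<alpha>. u = (F, G, \<alpha>) \<and> sheaf elts C J F \<and> sheaf elts C J G \<and> presheaf_nat elts C F G \<alpha>)"
  by (cases u) (auto simp: hom_def)

lemma presheaf_natD:
  assumes "presheaf_nat elts C F G \<alpha>"
  shows "\<alpha> \<in> extensional (Ob C)"
    and "X \<in> Ob C \<Longrightarrow> \<alpha> X \<in> elts (Po F X) \<rightarrow>\<^sub>E elts (Po G X)"
    and "X \<in> Ob C \<Longrightarrow> x \<in> elts (Po F X) \<Longrightarrow> \<alpha> X x \<in> elts (Po G X)"
    and "f \<in> Mor C \<Longrightarrow> Cod C f = X \<Longrightarrow> x \<in> elts (Po F X) \<Longrightarrow> \<alpha> (Dom C f) (Pm F f x) = Pm G f (\<alpha> X x)"
  using assms by (auto simp: presheaf_nat_def PiE_def Pi_def)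

lemma presheaf_nat_Id:
  assumes "category C" "presheaf elts C F"
  shows "presheaf_nat elts C F F (\<lambda>X\<in>Ob C. \<lambda>x\<in>elts (Po F X). x)"
proof -
  interpret category C by fact
  show ?thesis using presheafD(4)[OF assms(2)] by (auto simp: presheaf_nat_def)
qed

lemma presheaf_nat_compose:
  assumes "category C" "presheaf elts C F" "presheaf_nat elts C F G \<alpha>" "presheaf_nat elts C G H \<beta>"
  shows "presheaf_nat elts C F H (\<lambda>X\<in>Ob C. compose (elts (Po F X)) (\<beta> X) (\<alpha> X))"
proof -
  interpret category C by fact
  note F = presheafD(4)[OF assms(2)] and a = presheaf_natD[OF assms(3)] and b = presheaf_natD[OF assms(4)]
  show ?thesis
    unfolding presheaf_nat_def
  proof (intro conjI ballI)
    fix X assume X: "X \<in> Ob C"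
    show "(\<lambda>X\<in>Ob C. compose (elts (Po F X)) (\<beta> X) (\<alpha> X)) X \<in> elts (Po F X) \<rightarrow>\<^sub>E elts (Po H X)"
      using X a(3) b(3) by (auto simp: compose_def)
  next
    fix f x assume f: "f \<in> Mor C" and x: "x \<in> elts (Po F (Cod C f))"
    then show "(\<lambda>X\<in>Ob C. compose (elts (Po F X)) (\<beta> X) (\<alpha> X)) (Dom C f) (Pm F f x) =
        Pm H f ((\<lambda>X\<in>Ob C. compose (elts (Po F X)) (\<beta> X) (\<alpha> X)) (Cod C f) x)"
      using F a(3,4) b(4) by (simp add: compose_def)
  qed simp
qed

lemma sheaf_cat_category:
  assumes "category C"
  shows "category (sheaf_cat elts C J)"
proof
  interpret category C by fact
  show "Id (sheaf_cat elts C J) F \<in> hom (sheaf_cat elts C J) F F" if "F \<in> Ob (sheaf_cat elts C J)" for F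
    using that presheaf_nat_Id[OF assms sheaf_presheaf] by (simp add: hom_sheaf_cat)
  show "Cmp (sheaf_cat elts C J) v u \<in> hom (sheaf_cat elts C J) F H"
    if "u \<in> hom (sheaf_cat elts C J) F G" "v \<in> hom (sheaf_cat elts C J) G H" for u v F G H
    using that presheaf_nat_compose[OF assms sheaf_presheaf] by (auto simp: hom_sheaf_cat)
  show "Cmp (sheaf_cat elts C J) u (Id (sheaf_cat elts C J) F) = u"
    if "u \<in> hom (sheaf_cat elts C J) F G" for u F G
  proof -
    obtain \<alpha> where u: "u = (F, G, \<alpha>)" and a: "presheaf_nat elts C F G \<alpha>"
      using \<open>u \<in> hom (sheaf_cat elts C J) F G\<close> by (auto simp: hom_sheaf_cat)
    note a = presheaf_natD[OF a]
    have "(\<lambda>X\<in>Ob C. compose (elts (Po F X)) (\<alpha> X) ((\<lambda>X\<in>Ob C. \<lambda>x\<in>elts (Po F X). x) X)) = \<alpha>"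
      using a(1,2) by (intro extensionalityI[of _ "Ob C"]) (auto simp: compose_def PiE_def extensional_def)
    then show ?thesis by (simp add: u)
  qed
  show "Cmp (sheaf_cat elts C J) (Id (sheaf_cat elts C J) G) u = u"
    if "u \<in> hom (sheaf_cat elts C J) F G" for u F G
  proof -
    obtain \<alpha> where u: "u = (F, G, \<alpha>)" and a: "presheaf_nat elts C F G \<alpha>"
      using \<open>u \<in> hom (sheaf_cat elts C J) F G\<close> by (auto simp: hom_sheaf_cat)
    note a = presheaf_natD[OF a]
    have "(\<lambda>X\<in>Ob C. compose (elts (Po F X)) ((\<lambda>X\<in>Ob C. \<lambda>x\<in>elts (Po G X). x) X) (\<alpha> X)) = \<alpha>"
    proof (rule extensionalityI[of _ "Ob C"])
      fix X assume X: "X \<in> Ob C"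
      show "(\<lambda>X\<in>Ob C. compose (elts (Po F X)) ((\<lambda>X\<in>Ob C. \<lambda>x\<in>elts (Po G X). x) X) (\<alpha> X)) X = \<alpha> X"
        using X a(2,3)[OF X] by (auto simp: compose_def PiE_def extensional_def fun_eq_iff)
    qed (simp_all add: a)
    then show ?thesis by (simp add: u)
  qed
  show "Cmp (sheaf_cat elts C J) w (Cmp (sheaf_cat elts C J) v u) =
      Cmp (sheaf_cat elts C J) (Cmp (sheaf_cat elts C J) w v) u"
    if "u \<in> hom (sheaf_cat elts C J) F G" "v \<in> hom (sheaf_cat elts C J) G H"
      "w \<in> hom (sheaf_cat elts C J) H L" for u v w F G H L
  proof -
    obtain \<alpha> \<beta> \<gamma> where eq: "u = (F, G, \<alpha>)" "v = (G, H, \<beta>)" "w = (H, L, \<gamma>)"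
      and a: "presheaf_nat elts C F G \<alpha>"
      using \<open>u \<in> hom (sheaf_cat elts C J) F G\<close> \<open>v \<in> hom (sheaf_cat elts C J) G H\<close>
        \<open>w \<in> hom (sheaf_cat elts C J) H L\<close> by (auto simp: hom_sheaf_cat)
    note a = presheaf_natD[OF a]
    show ?thesis
      unfolding eq using a(3) by (auto simp: compose_def fun_eq_iff restrict_def)
  qed
qed (auto simp: sheaf_cat_def)

lemma sheaf_cat_isoI:
  assumes "category C" and F: "sheaf elts C J F" and G: "sheaf elts C J G"
    and nat: "presheaf_nat elts C F G \<alpha>"
    and bij: "\<And>X. X \<in> Ob C \<Longrightarrow> bij_betw (\<alpha> X) (elts (Po F X)) (elts (Po G X))"
  shows "is_iso (sheaf_cat elts C J) (F, G, \<alpha>)"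
proof -
  interpret category C by fact
  note a = presheaf_natD[OF nat] and Fp = presheafD[OF sheaf_presheaf[OF F]]
    and Gp = presheafD[OF sheaf_presheaf[OF G]]
  define b where "b X = inv_into (elts (Po F X)) (\<alpha> X)" for X
  have b: "b X y \<in> elts (Po F X)" "\<alpha> X (b X y) = y" if "X \<in> Ob C" "y \<in> elts (Po G X)" for X y
    using bij[OF that(1)] that(2) unfolding b_def bij_betw_def
    by (auto intro: inv_into_into f_inv_into_f)
  have ba: "b X (\<alpha> X x) = x" if "X \<in> Ob C" "x \<in> elts (Po F X)" for X x
    using bij[OF that(1)] that(2) unfolding b_def bij_betw_def by auto
  define \<beta> where "\<beta> = (\<lambda>X\<in>Ob C. \<lambda>y\<in>elts (Po G X). b X y)"
  have "presheaf_nat elts C G F \<beta>"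
    unfolding presheaf_nat_def
  proof (intro conjI ballI)
    fix f y assume f: "f \<in> Mor C" and y: "y \<in> elts (Po G (Cod C f))"
    have "\<alpha> (Dom C f) (Pm F f (b (Cod C f) y)) = Pm G f y"
      using a(4)[OF f refl] b f y by simp
    then have "b (Dom C f) (Pm G f y) = Pm F f (b (Cod C f) y)"
      using ba[of "Dom C f" "Pm F f (b (Cod C f) y)"] b f y Fp(4) by simp
    then show "\<beta> (Dom C f) (Pm G f y) = Pm F f (\<beta> (Cod C f) y)"
      using f y Gp(4) by (simp add: \<beta>_def)
  qed (auto simp: \<beta>_def b)
  moreover have "(\<lambda>X\<in>Ob C. compose (elts (Po F X)) (\<beta> X) (\<alpha> X)) = (\<lambda>X\<in>Ob C. \<lambda>x\<in>elts (Po F X). x)"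
    by (auto simp: \<beta>_def compose_def ba a(3) fun_eq_iff restrict_def)
  moreover have "(\<lambda>X\<in>Ob C. compose (elts (Po G X)) (\<alpha> X) (\<beta> X)) = (\<lambda>X\<in>Ob C. \<lambda>x\<in>elts (Po G X). x)"
    by (auto simp: \<beta>_def compose_def b fun_eq_iff restrict_def)
  ultimately show ?thesis
    using F G nat by (intro isoI[where g = "(G, F, \<beta>)" and X = F and Y = G]) (auto simp: hom_sheaf_cat)
qed

context cat_functor
begin

lemma restrict_presheaf_simps [simp]:
  "X \<in> Ob C \<Longrightarrow> Po (restrict_presheaf C \<Phi> F) X = Po F (Fo \<Phi> X)"
  "f \<in> Mor C \<Longrightarrow> Pm (restrict_presheaf C \<Phi> F) f = Pm F (Fm \<Phi> f)"
  by (simp_all add: restrict_presheaf_def)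

lemma presheaf_restrict:
  assumes "presheaf elts D F"
  shows "presheaf elts C (restrict_presheaf C \<Phi> F)"
proof -
  note F = presheafD[OF assms]
  have "Pm F (Fm \<Phi> f) \<in> elts (Po F (Fo \<Phi> (Cod C f))) \<rightarrow>\<^sub>E elts (Po F (Fo \<Phi> (Dom C f)))"
    if "f \<in> Mor C" for f
    using F(3)[of "Fm \<Phi> f"] that by simp
  moreover have "Po (restrict_presheaf C \<Phi> F) \<in> extensional (Ob C)"
    "Pm (restrict_presheaf C \<Phi> F) \<in> extensional (Mor C)"
    by (simp_all add: restrict_presheaf_def)
  ultimately show ?thesis
    using F(5,6) by (simp add: presheaf_def)
qed

lemma presheaf_nat_restrict:
  assumes "presheaf_nat elts D F G \<alpha>"
  shows "presheaf_nat elts C (restrict_presheaf C \<Phi> F) (restrict_presheaf C \<Phi> G) (\<lambda>X\<in>Ob C. \<alpha> (Fo \<Phi> X))"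
proof -
  note a = presheaf_natD[OF assms]
  have "\<alpha> (Fo \<Phi> (Dom C f)) (Pm F (Fm \<Phi> f) x) = Pm G (Fm \<Phi> f) (\<alpha> (Fo \<Phi> (Cod C f)) x)"
    if "f \<in> Mor C" "x \<in> elts (Po F (Fo \<Phi> (Cod C f)))" for f x
    using a(4)[of "Fm \<Phi> f"] that by simp
  then show ?thesis using a(2) by (simp add: presheaf_nat_def)
qed

lemma restriction_is_functor:
  assumes "\<And>F. sheaf elts D K F \<Longrightarrow> sheaf elts C J (restrict_presheaf C \<Phi> F)"
  shows "is_functor (sheaf_cat elts D K) (sheaf_cat elts C J) (restriction_functor C \<Phi>)"
  unfolding is_functor_def
proof (intro conjI ballI impI)
  show "category (sheaf_cat elts D K)" "category (sheaf_cat elts C J)"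
    by (rule sheaf_cat_category[OF tgt.category_axioms], rule sheaf_cat_category[OF src.category_axioms])
  show "Fo (restriction_functor C \<Phi>) F \<in> Ob (sheaf_cat elts C J)" if "F \<in> Ob (sheaf_cat elts D K)" for F
    using that assms by (simp add: restriction_functor_def)
  show "Fm (restriction_functor C \<Phi>) u \<in> hom (sheaf_cat elts C J)
      (Fo (restriction_functor C \<Phi>) (Dom (sheaf_cat elts D K) u))
      (Fo (restriction_functor C \<Phi>) (Cod (sheaf_cat elts D K) u))"
    if "u \<in> Mor (sheaf_cat elts D K)" for u
    using that assms presheaf_nat_restrict by (cases u) (auto simp: restriction_functor_def hom_sheaf_cat)
  show "Fm (restriction_functor C \<Phi>) (Id (sheaf_cat elts D K) F) =
      Id (sheaf_cat elts C J) (Fo (restriction_functor C \<Phi>) F)" for F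
    by (auto simp: restriction_functor_def restrict_def fun_eq_iff)
  show "Fm (restriction_functor C \<Phi>) (Cmp (sheaf_cat elts D K) v u) = Cmp (sheaf_cat elts C J)
      (Fm (restriction_functor C \<Phi>) v) (Fm (restriction_functor C \<Phi>) u)" for u v
    by (cases u; cases v) (auto simp: restriction_functor_def restrict_def compose_def fun_eq_iff)
qed

end


section \<open>The comparison lemma\<close>

text \<open>A fully faithful functor \<open>\<Phi>\<close> from \<open>C\<close> to a site \<open>D\<close>, such that every object of \<open>D\<close> is covered by
  objects of the form \<open>\<Phi>(Z)\<close>.\<close>

locale dense_subsite = cat_functor C D \<Phi> + site: grothendieck_topology D K
  for C :: "('o, 'a) cat" and D :: "('p, 'b) cat" and \<Phi> :: "('o, 'a, 'p, 'b) functr" and K +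
  assumes fully_faithful: "fully_faithful C D \<Phi>"
    and dense: "X \<in> Ob D \<Longrightarrow> \<exists>S. covering D K X S \<and> Dom D ` S \<subseteq> Fo \<Phi> ` Ob C"
begin

lemma full:
  assumes "X \<in> Ob C" "Y \<in> Ob C" "u \<in> Mor D" "Dom D u = Fo \<Phi> X" "Cod D u = Fo \<Phi> Y"
  shows "\<exists>k. k \<in> Mor C \<and> Dom C k = X \<and> Cod C k = Y \<and> Fm \<Phi> k = u"
proof -
  have "bij_betw (Fm \<Phi>) (hom C X Y) (hom D (Fo \<Phi> X) (Fo \<Phi> Y))"
    using fully_faithful assms by (auto simp: fully_faithful_def)
  moreover have "u \<in> hom D (Fo \<Phi> X) (Fo \<Phi> Y)" using assms by (simp add: hom_def)
  ultimately have "u \<in> Fm \<Phi> ` hom C X Y" by (simp add: bij_betw_def)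
  then show ?thesis by (auto simp: hom_def)
qed

lemma faithful:
  assumes "k \<in> Mor C" "k' \<in> Mor C" "Dom C k = Dom C k'" "Cod C k = Cod C k'" "Fm \<Phi> k = Fm \<Phi> k'"
  shows "k = k'"
proof -
  have "bij_betw (Fm \<Phi>) (hom C (Dom C k) (Cod C k)) (hom D (Fo \<Phi> (Dom C k)) (Fo \<Phi> (Cod C k)))"
    using fully_faithful assms by (auto simp: fully_faithful_def)
  then show ?thesis using assms by (auto simp: bij_betw_def inj_on_def hom_def)
qed

text \<open>The arrow \<open>X \<rightarrow> Y\<close> of \<open>C\<close> with image \<open>u : \<Phi>(X) \<rightarrow> \<Phi>(Y)\<close>. Its source and target are arguments,
  since \<open>u\<close> does not determine them.\<close>

definition lift :: "'o \<Rightarrow> 'o \<Rightarrow> 'b \<Rightarrow> 'a" where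
  "lift X Y u = (SOME k. k \<in> Mor C \<and> Dom C k = X \<and> Cod C k = Y \<and> Fm \<Phi> k = u)"

lemma lift:
  assumes "X \<in> Ob C" "Y \<in> Ob C" "u \<in> Mor D" "Dom D u = Fo \<Phi> X" "Cod D u = Fo \<Phi> Y"
  shows "lift X Y u \<in> Mor C" "Dom C (lift X Y u) = X" "Cod C (lift X Y u) = Y" "Fm \<Phi> (lift X Y u) = u"
  using someI_ex[OF full[OF assms]] by (simp_all add: lift_def)

lemma lift_Fm: "k \<in> Mor C \<Longrightarrow> Dom C k = X \<Longrightarrow> Cod C k = Y \<Longrightarrow> lift X Y (Fm \<Phi> k) = k"
  by (rule faithful) (auto simp: lift)

text \<open>The topology induced on \<open>C\<close>: a sieve is covering if its image generates a covering sieve.\<close>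

definition induced :: "'o \<Rightarrow> 'a set set" where
  "induced X = {R. is_sieve C X R \<and> generated_sieve D (Fm \<Phi> ` R) \<in> K (Fo \<Phi> X)}"

text \<open>The inverse image in \<open>C\<close> of a sieve on \<open>\<Phi>(X)\<close>.\<close>

definition preimage_sieve :: "'o \<Rightarrow> 'b set \<Rightarrow> 'a set" where
  "preimage_sieve X S = {h \<in> Mor C. Cod C h = X \<and> Fm \<Phi> h \<in> S}"

lemma is_sieve_preimage:
  assumes "is_sieve D (Fo \<Phi> X) S"
  shows "is_sieve C X (preimage_sieve X S)"
  unfolding is_sieve_def preimage_sieve_def
  using tgt.is_sieveD(3)[OF assms] by auto

lemma image_sieve_subset:
  assumes "is_sieve C X R"
  shows "Fm \<Phi> ` R \<subseteq> {f \<in> Mor D. Cod D f = Fo \<Phi> X}"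
  using src.is_sieve_subset[OF assms] by auto

text \<open>By full faithfulness, a sieve of \<open>C\<close> is recovered from the sieve that its image generates.\<close>

lemma preimage_generated:
  assumes R: "is_sieve C X R" and k: "k \<in> Mor C" "Cod C k = X"
  shows "Fm \<Phi> k \<in> generated_sieve D (Fm \<Phi> ` R) \<longleftrightarrow> k \<in> R"
proof
  note R' = src.is_sieveD[OF R]
  show "k \<in> R \<Longrightarrow> Fm \<Phi> k \<in> generated_sieve D (Fm \<Phi> ` R)"
    using image_sieve_subset[OF R] by (intro tgt.generated_superset) auto
  assume "Fm \<Phi> k \<in> generated_sieve D (Fm \<Phi> ` R)"
  then obtain r m where r: "r \<in> R" and m: "m \<in> Mor D" "Cod D m = Dom D (Fm \<Phi> r)"
    and eq: "Fm \<Phi> k = Cmp D (Fm \<Phi> r) m" by (auto simp: generated_sieve_def)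
  have r': "r \<in> Mor C" "Cod C r = X" using R'[OF r] by auto
  have "Dom D m = Fo \<Phi> (Dom C k)" using eq m r' k by (metis Fm_mor tgt.Cmp_mor(2))
  then obtain n where n: "n \<in> Mor C" "Dom C n = Dom C k" "Cod C n = Dom C r" "Fm \<Phi> n = m"
    using full[of "Dom C k" "Dom C r" m] m k r' by auto
  have "k = Cmp C r n" by (rule faithful) (use k r' n eq in auto)
  then show "k \<in> R" using R'(3)[OF r n(1)] n by simp
qed

text \<open>A covering sieve remains covering when only its members that factor through the image of \<open>C\<close>,
  inside the sieve, are kept.\<close>

lemma dense_part:
  assumes X: "X \<in> Ob D" and S: "S \<in> K X"
  shows "generated_sieve D {g \<in> S. Dom D g \<in> Fo \<Phi> ` Ob C} \<in> K X"
proof (rule site.covering_local[OF X S])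
  note S' = tgt.is_sieveD[OF site.sieves[OF X S]]
  let ?S = "{g \<in> S. Dom D g \<in> Fo \<Phi> ` Ob C}"
  show "is_sieve D X (generated_sieve D ?S)"
    by (rule tgt.is_sieve_generated) (use S' in auto)
  fix f assume f: "f \<in> S"
  note f' = S'[OF f]
  obtain Q where Q: "covering D K (Dom D f) Q" "Dom D ` Q \<subseteq> Fo \<Phi> ` Ob C"
    using dense[of "Dom D f"] f' by auto
  then have Q': "Q \<subseteq> {g \<in> Mor D. Cod D g = Dom D f}" by (simp add: covering_def)
  show "\<exists>Q\<in>K (Dom D f). \<forall>h\<in>Q. Cmp D f h \<in> generated_sieve D ?S"
  proof (intro bexI ballI)
    show "generated_sieve D Q \<in> K (Dom D f)" using Q by (simp add: covering_def)
    fix h assume "h \<in> generated_sieve D Q"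
    then obtain q m where q: "q \<in> Q" and m: "m \<in> Mor D" "Cod D m = Dom D q" and h: "h = Cmp D q m"
      by (auto simp: generated_sieve_def)
    have "Cmp D f h = Cmp D (Cmp D f q) m" "Cmp D f q \<in> ?S" "Cod D m = Dom D (Cmp D f q)"
      using q Q(2) Q' f' h m by (auto simp: tgt.Cmp_assoc subset_iff)
    then show "Cmp D f h \<in> generated_sieve D ?S" using m unfolding generated_sieve_def by blast
  qed
qed

lemma preimage_induced:
  assumes X: "X \<in> Ob C" and S: "S \<in> K (Fo \<Phi> X)"
  shows "preimage_sieve X S \<in> induced X"
proof -
  have X': "Fo \<Phi> X \<in> Ob D" using X by simp
  have S': "is_sieve D (Fo \<Phi> X) S" by (rule site.sieves[OF X' S])
  have sieve: "is_sieve C X (preimage_sieve X S)" by (rule is_sieve_preimage[OF S'])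
  have "{g \<in> S. Dom D g \<in> Fo \<Phi> ` Ob C} \<subseteq> Fm \<Phi> ` preimage_sieve X S"
  proof
    fix g assume "g \<in> {g \<in> S. Dom D g \<in> Fo \<Phi> ` Ob C}"
    then obtain Z where g: "g \<in> S" "Z \<in> Ob C" "Dom D g = Fo \<Phi> Z" by blast
    obtain k where "k \<in> Mor C" "Dom C k = Z" "Cod C k = X" "Fm \<Phi> k = g"
      using full[of Z X g] g X tgt.is_sieveD(1,2)[OF S' g(1)] by auto
    then show "g \<in> Fm \<Phi> ` preimage_sieve X S" using g by (auto simp: preimage_sieve_def)
  qed
  then have "generated_sieve D {g \<in> S. Dom D g \<in> Fo \<Phi> ` Ob C} \<subseteq> generated_sieve D (Fm \<Phi> ` preimage_sieve X S)"
    by (rule tgt.generated_mono)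
  then have "generated_sieve D (Fm \<Phi> ` preimage_sieve X S) \<in> K (Fo \<Phi> X)"
    using site.covering_superset[OF X' dense_part[OF X' S]]
      tgt.is_sieve_generated[OF image_sieve_subset[OF sieve]] by blast
  then show ?thesis using sieve by (simp add: induced_def)
qed

lemma induced_topology: "grothendieck_topology C induced"
proof unfold_locales
  show "is_sieve C X R" if "R \<in> induced X" for X R using that by (simp add: induced_def)
  show "pull_sieve C f R \<in> induced (Dom C f)" if f: "f \<in> Mor C" and R: "R \<in> induced (Cod C f)" for f R
  proof -
    let ?S = "generated_sieve D (Fm \<Phi> ` R)"
    have R': "is_sieve C (Cod C f) R" "?S \<in> K (Fo \<Phi> (Cod C f))" using R by (simp_all add: induced_def)
    have "pull_sieve D (Fm \<Phi> f) ?S \<in> K (Fo \<Phi> (Dom C f))"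
      using site.stable[of "Fm \<Phi> f" ?S] f R' by simp
    then have "preimage_sieve (Dom C f) (pull_sieve D (Fm \<Phi> f) ?S) \<in> induced (Dom C f)"
      using preimage_induced f by simp
    moreover have "preimage_sieve (Dom C f) (pull_sieve D (Fm \<Phi> f) ?S) = pull_sieve C f R"
    proof -
      have "Cmp D (Fm \<Phi> f) (Fm \<Phi> h) \<in> ?S \<longleftrightarrow> Cmp C f h \<in> R" if "h \<in> Mor C" "Cod C h = Dom C f" for h
        using preimage_generated[OF R'(1), of "Cmp C f h"] f that by simp
      then show ?thesis using f by (auto simp: preimage_sieve_def pull_sieve_def)
    qed
    ultimately show ?thesis by simp
  qed
  show "S \<in> induced X"
    if X: "X \<in> Ob C" and R: "R \<in> induced X" and S: "is_sieve C X S"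
      and loc: "\<And>f. f \<in> R \<Longrightarrow> pull_sieve C f S \<in> induced (Dom C f)" for X R S
  proof -
    have R': "is_sieve C X R" "generated_sieve D (Fm \<Phi> ` R) \<in> K (Fo \<Phi> X)" using R by (simp_all add: induced_def)
    have "generated_sieve D (Fm \<Phi> ` S) \<in> K (Fo \<Phi> X)"
    proof (rule site.covering_local[OF _ R'(2)])
      show "Fo \<Phi> X \<in> Ob D" using X by simp
      show "is_sieve D (Fo \<Phi> X) (generated_sieve D (Fm \<Phi> ` S))"
        by (rule tgt.is_sieve_generated[OF image_sieve_subset[OF S]])
      fix u assume "u \<in> generated_sieve D (Fm \<Phi> ` R)"
      then obtain f m where f: "f \<in> R" and m: "m \<in> Mor D" "Cod D m = Dom D (Fm \<Phi> f)"
        and u: "u = Cmp D (Fm \<Phi> f) m" by (auto simp: generated_sieve_def)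
      have f': "f \<in> Mor C" "Cod C f = X" using src.is_sieveD[OF R'(1) f] by auto
      let ?P = "generated_sieve D (Fm \<Phi> ` pull_sieve C f S)"
      have "?P \<in> K (Cod D m)" using loc[OF f] m f' by (simp add: induced_def)
      then have P: "pull_sieve D m ?P \<in> K (Dom D u)" using site.stable[of m ?P] m u f' by simp
      show "\<exists>Q\<in>K (Dom D u). \<forall>h\<in>Q. Cmp D u h \<in> generated_sieve D (Fm \<Phi> ` S)"
      proof (rule bexI[OF ballI P])
        fix h assume "h \<in> pull_sieve D m ?P"
        then obtain k n where h: "h \<in> Mor D" "Cod D h = Dom D m"
          and k: "k \<in> Mor C" "Cod C k = Dom C f" "Cmp C f k \<in> S"
          and n: "n \<in> Mor D" "Cod D n = Dom D (Fm \<Phi> k)" and mh: "Cmp D m h = Cmp D (Fm \<Phi> k) n"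
          by (auto simp: pull_sieve_def generated_sieve_def)
        have "Cmp D u h = Cmp D (Fm \<Phi> f) (Cmp D (Fm \<Phi> k) n)"
          using u h m f' by (simp add: tgt.Cmp_assoc mh)
        also have "\<dots> = Cmp D (Fm \<Phi> (Cmp C f k)) n" using k n f' by (simp add: tgt.Cmp_assoc)
        finally have "Cmp D u h = Cmp D (Fm \<Phi> (Cmp C f k)) n" .
        moreover have "Cod D n = Dom D (Fm \<Phi> (Cmp C f k))" using k n f' by simp
        ultimately show "Cmp D u h \<in> generated_sieve D (Fm \<Phi> ` S)"
          using k(3) n(1) unfolding generated_sieve_def by blast
      qed
    qed
    then show ?thesis using S by (simp add: induced_def)
  qed
  show "{f \<in> Mor C. Cod C f = X} \<in> induced X" if "X \<in> Ob C" for X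
  proof -
    have "preimage_sieve X {f \<in> Mor D. Cod D f = Fo \<Phi> X} = {f \<in> Mor C. Cod C f = X}"
      by (auto simp: preimage_sieve_def)
    then show ?thesis using preimage_induced[OF that site.maximal] that by simp
  qed
qed

text \<open>Sections of a sheaf over \<open>X\<close> are determined by, and can be glued from, their restrictions along
  the arrows \<open>\<Phi>(Z) \<rightarrow> X\<close> of a covering sieve. Since \<open>\<Phi>\<close> need not be injective on objects, the
  compatible family \<open>t\<close> to be glued also depends on \<open>Z\<close>.\<close>

lemma dense_separated:
  assumes F: "sheaf elts D K F" and X: "X \<in> Ob D" and R: "R \<in> K X"
    and x: "x \<in> elts (Po F X)" "y \<in> elts (Po F X)"
    and eq: "\<And>Z g. Z \<in> Ob C \<Longrightarrow> g \<in> R \<Longrightarrow> Dom D g = Fo \<Phi> Z \<Longrightarrow> Pm F g x = Pm F g y"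
  shows "x = y"
proof (rule site.sheaf_separated[OF F X dense_part[OF X R] x])
  note P = presheafD[OF sheaf_presheaf[OF F]] and R' = tgt.is_sieveD[OF site.sieves[OF X R]]
  fix f assume "f \<in> generated_sieve D {g \<in> R. Dom D g \<in> Fo \<Phi> ` Ob C}"
  then obtain g m where g: "g \<in> R" "Dom D g \<in> Fo \<Phi> ` Ob C" and m: "m \<in> Mor D" "Cod D m = Dom D g"
    and f: "f = Cmp D g m" by (auto simp: generated_sieve_def)
  have "Pm F g x = Pm F g y" using eq g by blast
  then show "Pm F f x = Pm F f y" using P(6)[OF m(1) _ m(2)] R'(1,2)[OF g(1)] f x by simp
qed

lemma dense_glue:
  assumes F: "sheaf elts D K F" and X: "X \<in> Ob D" and R: "R \<in> K X"
    and t_in: "\<And>Z g. Z \<in> Ob C \<Longrightarrow> g \<in> R \<Longrightarrow> Dom D g = Fo \<Phi> Z \<Longrightarrow> t Z g \<in> elts (Po F (Fo \<Phi> Z))"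
    and t_nat: "\<And>g k. k \<in> Mor C \<Longrightarrow> g \<in> R \<Longrightarrow> Dom D g = Fo \<Phi> (Cod C k)
      \<Longrightarrow> t (Dom C k) (Cmp D g (Fm \<Phi> k)) = Pm F (Fm \<Phi> k) (t (Cod C k) g)"
  shows "\<exists>x\<in>elts (Po F X). \<forall>Z\<in>Ob C. \<forall>g\<in>R. Dom D g = Fo \<Phi> Z \<longrightarrow> Pm F g x = t Z g"
proof -
  note P = presheafD[OF sheaf_presheaf[OF F]] and R' = tgt.is_sieveD[OF site.sieves[OF X R]]
  let ?R0 = "generated_sieve D {g \<in> R. Dom D g \<in> Fo \<Phi> ` Ob C}"
  define rep where "rep f Z g m \<longleftrightarrow> Z \<in> Ob C \<and> g \<in> R \<and> Dom D g = Fo \<Phi> Z \<and> m \<in> Mor D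
    \<and> Cod D m = Dom D g \<and> f = Cmp D g m" for f Z g m
  have rep_ex: "\<exists>Z g m. rep f Z g m" if "f \<in> ?R0" for f
    using that unfolding generated_sieve_def rep_def by blast
  \<comment> \<open>two factorizations of an arrow of the sieve give the same restriction, as can be checked on the
    arrows \<open>\<Phi>(W) \<rightarrow> Dom D m\<close>\<close>
  have well_def: "Pm F m (t Z g) = Pm F m' (t Z' g')" if r: "rep f Z g m" "rep f Z' g' m'" for f Z g m Z' g' m'
  proof (rule dense_separated[OF F])
    have m: "Z \<in> Ob C" "g \<in> R" "Dom D g = Fo \<Phi> Z" "m \<in> Mor D" "Cod D m = Fo \<Phi> Z"
      "Z' \<in> Ob C" "g' \<in> R" "Dom D g' = Fo \<Phi> Z'" "m' \<in> Mor D" "Cod D m' = Fo \<Phi> Z'"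
      and eq: "Cmp D g m = Cmp D g' m'"
      using r by (auto simp: rep_def)
    have g: "g \<in> Mor D" "g' \<in> Mor D" using m R' by auto
    have dom: "Dom D m = Dom D m'"
      using eq g m tgt.Cmp_mor(2)[of m g] tgt.Cmp_mor(2)[of m' g'] by simp
    show "Dom D m \<in> Ob D" using m by simp
    then show "{f \<in> Mor D. Cod D f = Dom D m} \<in> K (Dom D m)" by (rule site.maximal)
    show "Pm F m (t Z g) \<in> elts (Po F (Dom D m))" using P(4) t_in m by simp
    show "Pm F m' (t Z' g') \<in> elts (Po F (Dom D m))" unfolding dom using P(4) t_in m by simp
    fix W h assume W: "W \<in> Ob C" and h: "h \<in> {f \<in> Mor D. Cod D f = Dom D m}" "Dom D h = Fo \<Phi> W"
    have *: "Pm F h (Pm F n (t Y v)) = t W (Cmp D (Cmp D v n) h)"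
      if Y: "Y \<in> Ob C" "v \<in> R" "v \<in> Mor D" "Dom D v = Fo \<Phi> Y" "n \<in> Mor D" "Cod D n = Fo \<Phi> Y"
        "Dom D n = Dom D m" for Y v n
    proof -
      obtain k where k: "k \<in> Mor C" "Dom C k = W" "Cod C k = Y" "Fm \<Phi> k = Cmp D n h"
        using full[of W Y "Cmp D n h"] W h Y by auto
      have "Pm F h (Pm F n (t Y v)) = Pm F (Cmp D n h) (t Y v)"
        using P(6)[of h n "Fo \<Phi> Y"] h Y t_in by simp
      also have "\<dots> = t W (Cmp D v (Cmp D n h))" using t_nat[of k v] k Y by simp
      finally show ?thesis using h Y by (simp add: tgt.Cmp_assoc)
    qed
    show "Pm F h (Pm F m (t Z g)) = Pm F h (Pm F m' (t Z' g'))"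
      using *[of Z g m] *[of Z' g' m'] m g dom eq by simp
  qed
  define s where "s f = (SOME y. \<exists>Z g m. rep f Z g m \<and> y = Pm F m (t Z g))" for f
  have s: "s f = Pm F m (t Z g)" if "rep f Z g m" for f Z g m
  proof -
    have "\<exists>Z g m. rep f Z g m \<and> s f = Pm F m (t Z g)" unfolding s_def by (rule someI_ex) (use that in blast)
    then show ?thesis using well_def that by metis
  qed
  have "matching_family elts D F ?R0 s"
    unfolding matching_family_def
  proof (intro conjI ballI impI)
    fix f assume "f \<in> ?R0"
    then obtain Z g m where r: "rep f Z g m" using rep_ex by blast
    then have m: "Z \<in> Ob C" "g \<in> R" "Dom D g = Fo \<Phi> Z" "m \<in> Mor D" "Cod D m = Fo \<Phi> Z" "f = Cmp D g m"
      by (auto simp: rep_def)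
    have g: "g \<in> Mor D" using m R' by auto
    show "s f \<in> elts (Po F (Dom D f))" unfolding s[OF r] using m g P(4) t_in by simp
    fix h assume h: "h \<in> Mor D" "Cod D h = Dom D f"
    then have "rep (Cmp D f h) Z g (Cmp D m h)" using m g by (simp add: rep_def tgt.Cmp_assoc)
    from s[OF this] show "s (Cmp D f h) = Pm F h (s f)"
      unfolding s[OF r] using h m g P(6)[of h m "Fo \<Phi> Z"] t_in by simp
  qed
  from sheaf_glue[OF F X dense_part[OF X R] this]
  obtain x where x: "x \<in> elts (Po F X)" "\<And>f. f \<in> ?R0 \<Longrightarrow> Pm F f x = s f" by blast
  show ?thesis
  proof (intro bexI[OF _ x(1)] ballI impI)
    fix Z g assume Z: "Z \<in> Ob C" and g: "g \<in> R" "Dom D g = Fo \<Phi> Z"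
    have "g \<in> {g \<in> R. Dom D g \<in> Fo \<Phi> ` Ob C}" using Z g by auto
    then have "g \<in> ?R0" by (rule tgt.generated_superset[rotated]) (use R' in auto)
    moreover have "rep g Z g (Id D (Fo \<Phi> Z))" using Z g R' by (simp add: rep_def)
    ultimately show "Pm F g x = t Z g" using s x(2) P(5) t_in Z g by simp
  qed
qed

text \<open>Restriction along \<open>\<Phi>\<close> takes sheaves on \<open>D\<close> to sheaves for the induced topology.\<close>

lemma sheaf_restrict:
  assumes F: "sheaf elts D K F"
  shows "sheaf elts C induced (restrict_presheaf C \<Phi> F)"
  unfolding sheaf_def
proof (intro conjI ballI allI impI)
  note P = presheafD[OF sheaf_presheaf[OF F]]
  let ?F = "restrict_presheaf C \<Phi> F"
  show "presheaf elts C ?F" by (rule presheaf_restrict[OF sheaf_presheaf[OF F]])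
  fix X R s assume X: "X \<in> Ob C" and R: "R \<in> induced X" and s: "matching_family elts C ?F R s"
  let ?R = "generated_sieve D (Fm \<Phi> ` R)"
  have RK: "is_sieve C X R" "?R \<in> K (Fo \<Phi> X)" using R by (simp_all add: induced_def)
  note R' = src.is_sieveD[OF RK(1)]
  have X': "Fo \<Phi> X \<in> Ob D" using X by simp
  note S' = tgt.is_sieveD[OF site.sieves[OF X' RK(2)]]
  have lift_R: "lift Z X g \<in> R" "lift Z X g \<in> Mor C" "Dom C (lift Z X g) = Z" "Cod C (lift Z X g) = X"
      "Fm \<Phi> (lift Z X g) = g"
    if "Z \<in> Ob C" "g \<in> ?R" "Dom D g = Fo \<Phi> Z" for Z g
    using lift[of Z X g] that X S'(1,2)[OF that(2)] preimage_generated[OF RK(1), of "lift Z X g"] by simp_all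
  have "\<exists>x\<in>elts (Po F (Fo \<Phi> X)). \<forall>Z\<in>Ob C. \<forall>g\<in>?R. Dom D g = Fo \<Phi> Z \<longrightarrow> Pm F g x = s (lift Z X g)"
  proof (rule dense_glue[OF F X' RK(2)])
    show "s (lift Z X g) \<in> elts (Po F (Fo \<Phi> Z))" if "Z \<in> Ob C" "g \<in> ?R" "Dom D g = Fo \<Phi> Z" for Z g
    proof -
      have "s (lift Z X g) \<in> elts (Po ?F (Dom C (lift Z X g)))"
        using s lift_R(1)[OF that] unfolding matching_family_def by blast
      then show ?thesis using that by (simp add: lift_R)
    qed
    show "s (lift (Dom C k) X (Cmp D g (Fm \<Phi> k))) = Pm F (Fm \<Phi> k) (s (lift (Cod C k) X g))"
      if k: "k \<in> Mor C" "g \<in> ?R" "Dom D g = Fo \<Phi> (Cod C k)" for g k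
    proof -
      note l = lift_R[OF _ k(2,3)]
      have "lift (Dom C k) X (Cmp D g (Fm \<Phi> k)) = Cmp C (lift (Cod C k) X g) k"
        using lift_Fm[of "Cmp C (lift (Cod C k) X g) k" "Dom C k" X] k l by simp
      moreover have "s (Cmp C (lift (Cod C k) X g) k) = Pm ?F k (s (lift (Cod C k) X g))"
        using s k l unfolding matching_family_def by simp
      ultimately show ?thesis using k by simp
    qed
  qed
  then obtain x where x: "x \<in> elts (Po F (Fo \<Phi> X))"
    and xs: "\<And>Z g. Z \<in> Ob C \<Longrightarrow> g \<in> ?R \<Longrightarrow> Dom D g = Fo \<Phi> Z \<Longrightarrow> Pm F g x = s (lift Z X g)" by blast
  show "\<exists>!x. x \<in> elts (Po ?F X) \<and> (\<forall>f\<in>R. Pm ?F f x = s f)"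
  proof (rule ex1I[of _ x], intro conjI ballI)
    show "x \<in> elts (Po ?F X)" using x X by simp
    fix f assume f: "f \<in> R"
    then have "Fm \<Phi> f \<in> ?R" using preimage_generated[OF RK(1)] R' by simp
    then show "Pm ?F f x = s f" using xs[of "Dom C f" "Fm \<Phi> f"] R'(1,2)[OF f] lift_Fm[of f] by simp
  next
    fix y assume y: "y \<in> elts (Po ?F X) \<and> (\<forall>f\<in>R. Pm ?F f y = s f)"
    show "y = x"
    proof (rule dense_separated[OF F X' RK(2) _ x])
      show "y \<in> elts (Po F (Fo \<Phi> X))" using y X by simp
      fix Z g assume Z: "Z \<in> Ob C" "g \<in> ?R" "Dom D g = Fo \<Phi> Z"
      have "Pm ?F (lift Z X g) y = s (lift Z X g)" using y lift_R(1)[OF Z] by blast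
      then show "Pm F g y = Pm F g x" using xs[OF Z] by (simp add: lift_R[OF Z])
    qed
  qed
qed

lemma restriction_fully_faithful:
  "fully_faithful (sheaf_cat elts D K) (sheaf_cat elts C L) (restriction_functor C \<Phi>)"
  if L: "\<And>F. sheaf elts D K F \<Longrightarrow> sheaf elts C L (restrict_presheaf C \<Phi> F)"
  unfolding fully_faithful_def
proof (intro ballI)
  fix F G assume "F \<in> Ob (sheaf_cat elts D K)" "G \<in> Ob (sheaf_cat elts D K)"
  then have F: "sheaf elts D K F" and G: "sheaf elts D K G" by simp_all
  note PF = presheafD[OF sheaf_presheaf[OF F]] and PG = presheafD[OF sheaf_presheaf[OF G]]
  let ?r = "restriction_functor C \<Phi>" and ?rF = "restrict_presheaf C \<Phi> F" and ?rG = "restrict_presheaf C \<Phi> G"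
  have Fo_r: "Fo ?r F = ?rF" "Fo ?r G = ?rG" by (simp_all add: restriction_functor_def)
  have Fm_r: "Fm ?r (F, G, \<alpha>) = (?rF, ?rG, \<lambda>X\<in>Ob C. \<alpha> (Fo \<Phi> X))" for \<alpha>
    by (simp add: restriction_functor_def)
  have inj: "\<alpha> = \<beta>"
    if nat: "presheaf_nat elts D F G \<alpha>" "presheaf_nat elts D F G \<beta>"
      and eq: "\<And>Z. Z \<in> Ob C \<Longrightarrow> \<alpha> (Fo \<Phi> Z) = \<beta> (Fo \<Phi> Z)" for \<alpha> \<beta>
  proof (rule extensionalityI[of _ "Ob D"])
    note a = presheaf_natD[OF nat(1)] and b = presheaf_natD[OF nat(2)]
    show "\<alpha> \<in> extensional (Ob D)" "\<beta> \<in> extensional (Ob D)" using a(1) b(1) .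
    fix X assume X: "X \<in> Ob D"
    have "\<alpha> X x = \<beta> X x" if x: "x \<in> elts (Po F X)" for x
    proof (rule dense_separated[OF G X site.maximal[OF X]])
      show "\<alpha> X x \<in> elts (Po G X)" "\<beta> X x \<in> elts (Po G X)" using a(3) b(3) X x by auto
      fix Z g assume g: "Z \<in> Ob C" "g \<in> {f \<in> Mor D. Cod D f = X}" "Dom D g = Fo \<Phi> Z"
      then show "Pm G g (\<alpha> X x) = Pm G g (\<beta> X x)"
        using a(4)[of g X x] b(4)[of g X x] eq[OF g(1)] x by simp
    qed
    then show "\<alpha> X = \<beta> X" using a(2)[OF X] b(2)[OF X] by (rule PiE_ext[rotated 2])
  qed
  have surj: "\<exists>\<alpha>. presheaf_nat elts D F G \<alpha> \<and> (\<lambda>X\<in>Ob C. \<alpha> (Fo \<Phi> X)) = \<gamma>"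
    if nat: "presheaf_nat elts C ?rF ?rG \<gamma>" for \<gamma>
  proof -
    note c = presheaf_natD[OF nat]
    have c3: "\<gamma> Z x \<in> elts (Po G (Fo \<Phi> Z))" if "Z \<in> Ob C" "x \<in> elts (Po F (Fo \<Phi> Z))" for Z x
      using c(3)[of Z x] that by simp
    have c4: "\<gamma> (Dom C k) (Pm F (Fm \<Phi> k) x) = Pm G (Fm \<Phi> k) (\<gamma> (Cod C k) x)"
      if "k \<in> Mor C" "x \<in> elts (Po F (Fo \<Phi> (Cod C k)))" for k x
      using c(4)[of k "Cod C k" x] that by simp
    \<comment> \<open>\<open>char X x y\<close>: the section \<open>y\<close> can be the image of \<open>x\<close> under the extension of \<open>\<gamma>\<close>\<close>
    define char where "char X x y \<longleftrightarrow> y \<in> elts (Po G X) \<and> (\<forall>Z\<in>Ob C. \<forall>g\<in>{f \<in> Mor D. Cod D f = X}.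
      Dom D g = Fo \<Phi> Z \<longrightarrow> Pm G g y = \<gamma> Z (Pm F g x))" for X x y
    have char_ex: "\<exists>y. char X x y" if X: "X \<in> Ob D" and x: "x \<in> elts (Po F X)" for X x
    proof -
      have "\<exists>y\<in>elts (Po G X). \<forall>Z\<in>Ob C. \<forall>g\<in>{f \<in> Mor D. Cod D f = X}.
          Dom D g = Fo \<Phi> Z \<longrightarrow> Pm G g y = \<gamma> Z (Pm F g x)"
      proof (rule dense_glue[OF G X site.maximal[OF X]])
        show "\<gamma> Z (Pm F g x) \<in> elts (Po G (Fo \<Phi> Z))"
          if "Z \<in> Ob C" "g \<in> {f \<in> Mor D. Cod D f = X}" "Dom D g = Fo \<Phi> Z" for Z g
          using that c3 PF(4)[of g X x] x by simp
        show "\<gamma> (Dom C k) (Pm F (Cmp D g (Fm \<Phi> k)) x) = Pm G (Fm \<Phi> k) (\<gamma> (Cod C k) (Pm F g x))"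
          if "k \<in> Mor C" "g \<in> {f \<in> Mor D. Cod D f = X}" "Dom D g = Fo \<Phi> (Cod C k)" for g k
          using that c4[of k "Pm F g x"] PF(4)[of g X x] PF(6)[of "Fm \<Phi> k" g X x] x by simp
      qed
      then show ?thesis by (auto simp: char_def)
    qed
    have char_unique: "y = y'" if "X \<in> Ob D" "char X x y" "char X x y'" for X x y y'
      by (rule dense_separated[OF G that(1) site.maximal[OF that(1)]]) (use that in \<open>auto simp: char_def\<close>)
    define \<alpha> where "\<alpha> = (\<lambda>X\<in>Ob D. \<lambda>x\<in>elts (Po F X). SOME y. char X x y)"
    have \<alpha>: "char X x (\<alpha> X x)" if "X \<in> Ob D" "x \<in> elts (Po F X)" for X x
      using someI_ex[OF char_ex[OF that]] that by (simp add: \<alpha>_def)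
    have \<alpha>_in: "\<alpha> X x \<in> elts (Po G X)" if "X \<in> Ob D" "x \<in> elts (Po F X)" for X x
      using \<alpha>[OF that] by (simp add: char_def)
    have \<alpha>_eq: "Pm G g (\<alpha> X x) = \<gamma> Z (Pm F g x)"
      if "X \<in> Ob D" "x \<in> elts (Po F X)" "Z \<in> Ob C" "g \<in> Mor D" "Cod D g = X" "Dom D g = Fo \<Phi> Z" for X x Z g
      using \<alpha>[OF that(1,2)] that(3-) by (simp add: char_def)
    have nat': "presheaf_nat elts D F G \<alpha>"
      unfolding presheaf_nat_def
    proof (intro conjI ballI)
      show "\<alpha> \<in> extensional (Ob D)" by (simp add: \<alpha>_def)
      show "\<alpha> X \<in> elts (Po F X) \<rightarrow>\<^sub>E elts (Po G X)" if "X \<in> Ob D" for X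
        using \<alpha>_in[OF that] that by (auto simp: PiE_def \<alpha>_def)
      fix f x assume f: "f \<in> Mor D" and x: "x \<in> elts (Po F (Cod D f))"
      note fx = PF(4)[OF f refl x]
      show "\<alpha> (Dom D f) (Pm F f x) = Pm G f (\<alpha> (Cod D f) x)"
      proof (rule char_unique[OF _ \<alpha>])
        show "char (Dom D f) (Pm F f x) (Pm G f (\<alpha> (Cod D f) x))"
          unfolding char_def
        proof (intro conjI ballI impI)
          show "Pm G f (\<alpha> (Cod D f) x) \<in> elts (Po G (Dom D f))" using PG(4) \<alpha>_in f x by simp
          fix Z g assume g: "Z \<in> Ob C" "g \<in> {h \<in> Mor D. Cod D h = Dom D f}" "Dom D g = Fo \<Phi> Z"
          have "Pm G g (Pm G f (\<alpha> (Cod D f) x)) = Pm G (Cmp D f g) (\<alpha> (Cod D f) x)"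
            using PG(6)[of g f "Cod D f"] g f x \<alpha>_in by simp
          also have "\<dots> = \<gamma> Z (Pm F (Cmp D f g) x)"
            using \<alpha>_eq[of "Cod D f" x Z "Cmp D f g"] g f x by simp
          also have "\<dots> = \<gamma> Z (Pm F g (Pm F f x))" using PF(6)[of g f "Cod D f" x] g f x by simp
          finally show "Pm G g (Pm G f (\<alpha> (Cod D f) x)) = \<gamma> Z (Pm F g (Pm F f x))" .
        qed
      qed (use f fx in auto)
    qed
    moreover have "(\<lambda>X\<in>Ob C. \<alpha> (Fo \<Phi> X)) = \<gamma>"
    proof (rule extensionalityI[of _ "Ob C"])
      show "\<gamma> \<in> extensional (Ob C)" by (rule c(1))
      fix Z assume Z: "Z \<in> Ob C"
      then have Z': "Fo \<Phi> Z \<in> Ob D" by simp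
      have "\<alpha> (Fo \<Phi> Z) x = \<gamma> Z x" if x: "x \<in> elts (Po F (Fo \<Phi> Z))" for x
        using \<alpha>_eq[OF Z' x Z, of "Id D (Fo \<Phi> Z)"] Z' PG(5)[OF Z' \<alpha>_in[OF Z' x]] PF(5)[OF Z' x] by simp
      moreover have "\<alpha> (Fo \<Phi> Z) \<in> elts (Po F (Fo \<Phi> Z)) \<rightarrow>\<^sub>E elts (Po G (Fo \<Phi> Z))"
        using presheaf_natD(2)[OF nat' Z'] .
      moreover have "\<gamma> Z \<in> elts (Po F (Fo \<Phi> Z)) \<rightarrow>\<^sub>E elts (Po G (Fo \<Phi> Z))" using c(2)[OF Z] Z by simp
      ultimately have "\<alpha> (Fo \<Phi> Z) = \<gamma> Z" by (intro PiE_ext)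
      then show "(\<lambda>X\<in>Ob C. \<alpha> (Fo \<Phi> X)) Z = \<gamma> Z" using Z by simp
    qed simp
    ultimately show ?thesis by blast
  qed
  show "bij_betw (Fm ?r) (hom (sheaf_cat elts D K) F G) (hom (sheaf_cat elts C L) (Fo ?r F) (Fo ?r G))"
    unfolding bij_betw_def Fo_r
  proof
    show "inj_on (Fm ?r) (hom (sheaf_cat elts D K) F G)"
    proof (rule inj_onI)
      fix u v assume "u \<in> hom (sheaf_cat elts D K) F G" "v \<in> hom (sheaf_cat elts D K) F G" "Fm ?r u = Fm ?r v"
      then obtain \<alpha> \<beta> where uv: "u = (F, G, \<alpha>)" "v = (F, G, \<beta>)" "presheaf_nat elts D F G \<alpha>"
        "presheaf_nat elts D F G \<beta>" and eq: "(\<lambda>X\<in>Ob C. \<alpha> (Fo \<Phi> X)) = (\<lambda>X\<in>Ob C. \<beta> (Fo \<Phi> X))"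
        by (auto simp: hom_sheaf_cat Fm_r)
      have "\<alpha> (Fo \<Phi> Z) = \<beta> (Fo \<Phi> Z)" if "Z \<in> Ob C" for Z using fun_cong[OF eq, of Z] that by simp
      then show "u = v" using inj uv by simp
    qed
    show "Fm ?r ` hom (sheaf_cat elts D K) F G = hom (sheaf_cat elts C L) ?rF ?rG"
    proof
      show "Fm ?r ` hom (sheaf_cat elts D K) F G \<subseteq> hom (sheaf_cat elts C L) ?rF ?rG"
        using L presheaf_nat_restrict by (auto simp: hom_sheaf_cat Fm_r)
      show "hom (sheaf_cat elts C L) ?rF ?rG \<subseteq> Fm ?r ` hom (sheaf_cat elts D K) F G"
      proof
        fix w assume "w \<in> hom (sheaf_cat elts C L) ?rF ?rG"
        then obtain \<gamma> where w: "w = (?rF, ?rG, \<gamma>)" "presheaf_nat elts C ?rF ?rG \<gamma>"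
          by (auto simp: hom_sheaf_cat)
        from surj[OF w(2)] obtain \<alpha> where "presheaf_nat elts D F G \<alpha>" "(\<lambda>X\<in>Ob C. \<alpha> (Fo \<Phi> X)) = \<gamma>" by blast
        then have "w = Fm ?r (F, G, \<alpha>)" "(F, G, \<alpha>) \<in> hom (sheaf_cat elts D K) F G"
          using w F G by (auto simp: hom_sheaf_cat Fm_r)
        then show "w \<in> Fm ?r ` hom (sheaf_cat elts D K) F G" by blast
      qed
    qed
  qed
qed

end


section \<open>Extension of sheaves from a dense subcategory\<close>

context dense_subsite
begin

text \<open>The arrows \<open>\<Phi>(Z) \<rightarrow> X\<close>, each with its \<open>Z\<close>, which the arrow alone does not determine.\<close>

definition dense_arrows :: "'p \<Rightarrow> ('o \<times> 'b) set" where
  "dense_arrows X = {(Z, g). Z \<in> Ob C \<and> g \<in> Mor D \<and> Dom D g = Fo \<Phi> Z \<and> Cod D g = X}"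

text \<open>The extension of a sheaf \<open>G\<close> on \<open>C\<close> to \<open>D\<close> sends \<open>X\<close> to the limit of \<open>G\<close> over the arrows
  \<open>\<Phi>(Z) \<rightarrow> X\<close>, that is, to the set of the compatible families of elements of the sets \<open>G(Z)\<close>. The
  families are extensional, so that they are equal when their components are.\<close>

definition compatible_families :: "('u \<Rightarrow> 'u set) \<Rightarrow> ('o, 'a, 'u) psh \<Rightarrow> 'p \<Rightarrow> ('o \<times> 'b \<Rightarrow> 'u) set" where
  "compatible_families elts G X = {t \<in> extensional (dense_arrows X).
     (\<forall>Z g. (Z, g) \<in> dense_arrows X \<longrightarrow> t (Z, g) \<in> elts (Po G Z))
   \<and> (\<forall>k\<in>Mor C. \<forall>g. (Cod C k, g) \<in> dense_arrows X \<longrightarrow>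
        t (Dom C k, Cmp D g (Fm \<Phi> k)) = Pm G k (t (Cod C k, g)))}"

text \<open>The restriction of compatible families along an arrow \<open>f\<close> of \<open>D\<close>.\<close>

definition restrict_family :: "'b \<Rightarrow> ('o \<times> 'b \<Rightarrow> 'u) \<Rightarrow> 'o \<times> 'b \<Rightarrow> 'u" where
  "restrict_family f t = (\<lambda>(Z, g)\<in>dense_arrows (Dom D f). t (Z, Cmp D f g))"

lemma dense_arrows_Id: "Z \<in> Ob C \<Longrightarrow> (Z, Id D (Fo \<Phi> Z)) \<in> dense_arrows (Fo \<Phi> Z)"
  by (simp add: dense_arrows_def)

lemma dense_arrows_Cmp:
  "(Z, g) \<in> dense_arrows (Dom D f) \<Longrightarrow> f \<in> Mor D \<Longrightarrow> (Z, Cmp D f g) \<in> dense_arrows (Cod D f)"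
  by (simp add: dense_arrows_def)

lemma dense_arrows_Fm:
  "(Cod C k, g) \<in> dense_arrows X \<Longrightarrow> k \<in> Mor C \<Longrightarrow> (Dom C k, Cmp D g (Fm \<Phi> k)) \<in> dense_arrows X"
  by (simp add: dense_arrows_def)

lemma compatible_familiesD:
  assumes "t \<in> compatible_families elts G X"
  shows "(Z, g) \<in> dense_arrows X \<Longrightarrow> t (Z, g) \<in> elts (Po G Z)"
    and "k \<in> Mor C \<Longrightarrow> (Cod C k, g) \<in> dense_arrows X
      \<Longrightarrow> t (Dom C k, Cmp D g (Fm \<Phi> k)) = Pm G k (t (Cod C k, g))"
    and "t \<in> extensional (dense_arrows X)"
  using assms by (auto simp: compatible_families_def)

lemma compatible_families_eqI:
  assumes "t \<in> compatible_families elts G X" "t' \<in> compatible_families elts G X"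
    and "\<And>Z g. (Z, g) \<in> dense_arrows X \<Longrightarrow> t (Z, g) = t' (Z, g)"
  shows "t = t'"
  by (rule extensionalityI[OF compatible_familiesD(3)[OF assms(1)] compatible_familiesD(3)[OF assms(2)]])
    (use assms(3) in auto)

lemma restrict_family_app:
  "(Z, g) \<in> dense_arrows (Dom D f) \<Longrightarrow> restrict_family f t (Z, g) = t (Z, Cmp D f g)"
  by (simp add: restrict_family_def)

lemma restrict_family_in:
  assumes f: "f \<in> Mor D" and t: "t \<in> compatible_families elts G (Cod D f)"
  shows "restrict_family f t \<in> compatible_families elts G (Dom D f)"
  unfolding compatible_families_def
proof (intro CollectI conjI allI ballI impI)
  note t' = compatible_familiesD[OF t]
  show "restrict_family f t \<in> extensional (dense_arrows (Dom D f))" by (simp add: restrict_family_def)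
  show "restrict_family f t (Z, g) \<in> elts (Po G Z)" if "(Z, g) \<in> dense_arrows (Dom D f)" for Z g
    using restrict_family_app[OF that, of t] t'(1) dense_arrows_Cmp[OF that f] by simp
  fix k g assume k: "k \<in> Mor C" and g: "(Cod C k, g) \<in> dense_arrows (Dom D f)"
  have "Cmp D (Cmp D f g) (Fm \<Phi> k) = Cmp D f (Cmp D g (Fm \<Phi> k))"
    using g k f by (intro tgt.Cmp_assoc) (auto simp: dense_arrows_def)
  then show "restrict_family f t (Dom C k, Cmp D g (Fm \<Phi> k)) = Pm G k (restrict_family f t (Cod C k, g))"
    using restrict_family_app[OF g, of t] restrict_family_app[OF dense_arrows_Fm[OF g k], of t]
      t'(2)[OF k dense_arrows_Cmp[OF g f]] by simp
qed

lemma restrict_family_Id: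
  assumes X: "X \<in> Ob D" and t: "t \<in> compatible_families elts G X"
  shows "restrict_family (Id D X) t = t"
proof (rule compatible_families_eqI[OF _ t])
  show "restrict_family (Id D X) t \<in> compatible_families elts G X"
    using restrict_family_in[of "Id D X" t] X t by simp
  fix Z g assume "(Z, g) \<in> dense_arrows X"
  then show "restrict_family (Id D X) t (Z, g) = t (Z, g)"
    using X by (simp add: restrict_family_def dense_arrows_def)
qed

lemma restrict_family_Cmp:
  assumes f: "f \<in> Mor D" "g \<in> Mor D" "Cod D f = Dom D g" and t: "t \<in> compatible_families elts G (Cod D g)"
  shows "restrict_family (Cmp D g f) t = restrict_family f (restrict_family g t)"
proof (rule compatible_families_eqI[of _ _ G "Dom D f"])
  show "restrict_family (Cmp D g f) t \<in> compatible_families elts G (Dom D f)"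
    using restrict_family_in[of "Cmp D g f" t] f t by simp
  show "restrict_family f (restrict_family g t) \<in> compatible_families elts G (Dom D f)"
    using restrict_family_in[of f] restrict_family_in[OF f(2) t] f by simp
  fix Z h assume h: "(Z, h) \<in> dense_arrows (Dom D f)"
  have "(Z, Cmp D f h) \<in> dense_arrows (Dom D g)" using dense_arrows_Cmp[OF h f(1)] f by simp
  moreover have "Cmp D (Cmp D g f) h = Cmp D g (Cmp D f h)"
    using f h by (intro tgt.Cmp_assoc) (auto simp: dense_arrows_def)
  ultimately show "restrict_family (Cmp D g f) t (Z, h) = restrict_family f (restrict_family g t) (Z, h)"
    using f h by (simp add: restrict_family_app)
qed

lemma pull_preimage_induced:
  assumes X: "X \<in> Ob D" and R: "R \<in> K X" and g: "(Z, g) \<in> dense_arrows X"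
  shows "preimage_sieve Z (pull_sieve D g R) \<in> induced Z"
proof (rule preimage_induced)
  show "pull_sieve D g R \<in> K (Fo \<Phi> Z)" using site.stable[of g R] R g by (auto simp: dense_arrows_def)
qed (use g in \<open>simp add: dense_arrows_def\<close>)

lemma mem_pull_preimage:
  assumes "(Z, g) \<in> dense_arrows X"
  shows "h \<in> preimage_sieve Z (pull_sieve D g R) \<longleftrightarrow> h \<in> Mor C \<and> Cod C h = Z \<and> Cmp D g (Fm \<Phi> h) \<in> R"
  using assms by (auto simp: preimage_sieve_def pull_sieve_def dense_arrows_def)

lemma compatible_family_at:
  assumes t: "t \<in> compatible_families elts G X" and g: "(Z, g) \<in> dense_arrows X"
  shows "t (Z, g) = restrict_family g t (Z, Id D (Fo \<Phi> Z))"
  using g dense_arrows_Id[of Z] by (auto simp: restrict_family_def dense_arrows_def)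

text \<open>The next two lemmas say that the compatible families form a sheaf on \<open>D\<close>. A component at
  \<open>(Z, g)\<close> is an element of \<open>G(Z)\<close>, which can be tested and glued on the inverse image in \<open>C\<close> of the
  given covering sieve, because \<open>G\<close> is a sheaf for the induced topology.\<close>

lemma compatible_families_separated:
  assumes G: "sheaf elts C induced G" and X: "X \<in> Ob D" and R: "R \<in> K X"
    and t: "t \<in> compatible_families elts G X" "t' \<in> compatible_families elts G X"
    and eq: "\<And>f. f \<in> R \<Longrightarrow> restrict_family f t = restrict_family f t'"
  shows "t = t'"
proof (rule compatible_families_eqI[OF t])
  interpret ind: grothendieck_topology C induced by (rule induced_topology)
  fix Z g assume g: "(Z, g) \<in> dense_arrows X"
  have Z: "Z \<in> Ob C" using g by (simp add: dense_arrows_def)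
  show "t (Z, g) = t' (Z, g)"
  proof (rule ind.sheaf_separated[OF G Z pull_preimage_induced[OF X R g]])
    show "t (Z, g) \<in> elts (Po G Z)" "t' (Z, g) \<in> elts (Po G Z)"
      using compatible_familiesD(1)[OF t(1) g] compatible_familiesD(1)[OF t(2) g] .
    fix h assume "h \<in> preimage_sieve Z (pull_sieve D g R)"
    then have h: "h \<in> Mor C" "Cod C h = Z" "Cmp D g (Fm \<Phi> h) \<in> R" using mem_pull_preimage[OF g] by simp_all
    have gh: "(Dom C h, Cmp D g (Fm \<Phi> h)) \<in> dense_arrows X" using dense_arrows_Fm[of h g X] g h by simp
    show "Pm G h (t (Z, g)) = Pm G h (t' (Z, g))"
      using compatible_familiesD(2)[OF t(1) h(1), of g] compatible_familiesD(2)[OF t(2) h(1), of g]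
        compatible_family_at[OF t(1) gh] compatible_family_at[OF t(2) gh] eq[OF h(3)] g h by simp
  qed
qed

lemma compatible_families_glue:
  assumes G: "sheaf elts C induced G" and X: "X \<in> Ob D" and R: "R \<in> K X"
    and s: "\<And>f. f \<in> R \<Longrightarrow> s f \<in> compatible_families elts G (Dom D f)"
    and match: "\<And>f g. f \<in> R \<Longrightarrow> g \<in> Mor D \<Longrightarrow> Cod D g = Dom D f \<Longrightarrow> s (Cmp D f g) = restrict_family g (s f)"
  shows "\<exists>t\<in>compatible_families elts G X. \<forall>f\<in>R. restrict_family f t = s f"
proof -
  interpret ind: grothendieck_topology C induced by (rule induced_topology)
  note P = presheafD[OF sheaf_presheaf[OF G]] and R' = tgt.is_sieveD[OF site.sieves[OF X R]]
  \<comment> \<open>the component at \<open>(Z, g)\<close> is glued from the components at the identities of the families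
    \<open>s (g \<circ> \<Phi>(h))\<close>, for the arrows \<open>h\<close> such that \<open>g \<circ> \<Phi>(h)\<close> is in \<open>R\<close>\<close>
  define P where "P g Z = preimage_sieve Z (pull_sieve D g R)" for g Z
  define u where "u g h = s (Cmp D g (Fm \<Phi> h)) (Dom C h, Id D (Fo \<Phi> (Dom C h)))" for g h
  have u_s: "s f (Dom C k, Fm \<Phi> k) = u f k" if f: "f \<in> R" and k: "k \<in> Mor C" "Dom D f = Fo \<Phi> (Cod C k)" for f k
    using match[OF f, of "Fm \<Phi> k"] k dense_arrows_Id[of "Dom C k"] by (simp add: u_def restrict_family_app)
  have ex1: "\<exists>!x. x \<in> elts (Po G Z) \<and> (\<forall>h\<in>P g Z. Pm G h x = u g h)" if g: "(Z, g) \<in> dense_arrows X" for Z g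
  proof (rule sheaf_glue[OF G])
    have g': "g \<in> Mor D" "Dom D g = Fo \<Phi> Z" "Cod D g = X" using g by (simp_all add: dense_arrows_def)
    show "Z \<in> Ob C" using g by (simp add: dense_arrows_def)
    show "P g Z \<in> induced Z" unfolding P_def by (rule pull_preimage_induced[OF X R g])
    show "matching_family elts C G (P g Z) (u g)"
      unfolding matching_family_def
    proof (intro conjI ballI impI)
      fix h assume "h \<in> P g Z"
      then have h: "h \<in> Mor C" "Cod C h = Z" "Cmp D g (Fm \<Phi> h) \<in> R"
        using mem_pull_preimage[OF g] by (simp_all add: P_def)
      note sh = s[OF h(3)]
      have dom: "Dom D (Cmp D g (Fm \<Phi> h)) = Fo \<Phi> (Dom C h)" using g' h by simp
      have id: "(Dom C h, Id D (Fo \<Phi> (Dom C h))) \<in> dense_arrows (Fo \<Phi> (Dom C h))"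
        using dense_arrows_Id h by simp
      show "u g h \<in> elts (Po G (Dom C h))"
        unfolding u_def using compatible_familiesD(1)[OF sh] id dom by simp
      fix k assume k: "k \<in> Mor C" "Cod C k = Dom C h"
      have "u g (Cmp C h k) = u (Cmp D g (Fm \<Phi> h)) k"
        unfolding u_def using k h g' by (simp add: tgt.Cmp_assoc)
      also have "\<dots> = s (Cmp D g (Fm \<Phi> h)) (Dom C k, Fm \<Phi> k)"
        using u_s[OF h(3) k(1)] dom k by simp
      also have "\<dots> = Pm G k (u g h)"
        unfolding u_def using compatible_familiesD(2)[OF sh k(1), of "Id D (Fo \<Phi> (Dom C h))"] id dom k by simp
      finally show "u g (Cmp C h k) = Pm G k (u g h)" .
    qed
  qed
  define t where "t = (\<lambda>(Z, g)\<in>dense_arrows X. THE x. x \<in> elts (Po G Z) \<and> (\<forall>h\<in>P g Z. Pm G h x = u g h))"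
  have t: "t (Z, g) \<in> elts (Po G Z)" "\<And>h. h \<in> P g Z \<Longrightarrow> Pm G h (t (Z, g)) = u g h"
    if "(Z, g) \<in> dense_arrows X" for Z g
    using theI'[OF ex1[OF that]] that by (simp_all add: t_def)
  have t_in: "t \<in> compatible_families elts G X"
    unfolding compatible_families_def
  proof (intro CollectI conjI allI ballI impI)
    show "t \<in> extensional (dense_arrows X)" by (simp add: t_def)
    show "t (Z, g) \<in> elts (Po G Z)" if "(Z, g) \<in> dense_arrows X" for Z g using t(1)[OF that] .
    fix k g assume k: "k \<in> Mor C" and g: "(Cod C k, g) \<in> dense_arrows X"
    note gk = dense_arrows_Fm[OF g k]
    have g': "g \<in> Mor D" "Dom D g = Fo \<Phi> (Cod C k)" "Cod D g = X" using g by (simp_all add: dense_arrows_def)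
    show "t (Dom C k, Cmp D g (Fm \<Phi> k)) = Pm G k (t (Cod C k, g))"
    proof (rule ind.sheaf_separated[OF G _ pull_preimage_induced[OF X R gk] t(1)[OF gk]])
      show "Dom C k \<in> Ob C" using k by simp
      show "Pm G k (t (Cod C k, g)) \<in> elts (Po G (Dom C k))" using P(4) k t(1)[OF g] by simp
      fix h assume hP: "h \<in> preimage_sieve (Dom C k) (pull_sieve D (Cmp D g (Fm \<Phi> k)) R)"
      then have h: "h \<in> Mor C" "Cod C h = Dom C k" "Cmp D (Cmp D g (Fm \<Phi> k)) (Fm \<Phi> h) \<in> R"
        using mem_pull_preimage[OF gk] by simp_all
      have assoc: "Cmp D (Cmp D g (Fm \<Phi> k)) (Fm \<Phi> h) = Cmp D g (Fm \<Phi> (Cmp C k h))"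
        using h k g' by (simp add: tgt.Cmp_assoc)
      have kh: "Cmp C k h \<in> P g (Cod C k)"
        unfolding P_def mem_pull_preimage[OF g] using h k assoc by simp
      have "Pm G h (t (Dom C k, Cmp D g (Fm \<Phi> k))) = u (Cmp D g (Fm \<Phi> k)) h"
        using t(2)[OF gk] hP by (simp add: P_def)
      also have "\<dots> = u g (Cmp C k h)" unfolding u_def assoc using h k by simp
      also have "\<dots> = Pm G (Cmp C k h) (t (Cod C k, g))" using t(2)[OF g kh] by simp
      also have "\<dots> = Pm G h (Pm G k (t (Cod C k, g)))"
        using P(6)[OF h(1) k h(2) refl] t(1)[OF g] by simp
      finally show "Pm G h (t (Dom C k, Cmp D g (Fm \<Phi> k))) = Pm G h (Pm G k (t (Cod C k, g)))" .
    qed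
  qed
  moreover have "restrict_family f t = s f" if f: "f \<in> R" for f
  proof (rule compatible_families_eqI[OF _ s[OF f]])
    have f': "f \<in> Mor D" "Cod D f = X" using R'(1,2)[OF f] .
    show "restrict_family f t \<in> compatible_families elts G (Dom D f)"
      using restrict_family_in[OF f'(1)] t_in f' by simp
    fix Z g assume g: "(Z, g) \<in> dense_arrows (Dom D f)"
    have Z: "Z \<in> Ob C" and g': "g \<in> Mor D" "Dom D g = Fo \<Phi> Z" "Cod D g = Dom D f"
      using g by (simp_all add: dense_arrows_def)
    have fg: "(Z, Cmp D f g) \<in> dense_arrows X" using dense_arrows_Cmp[OF g f'(1)] f' by simp
    have fgR: "Cmp D f g \<in> R" using R'(3)[OF f] g' by simp
    have "Id C Z \<in> P (Cmp D f g) Z"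
      unfolding P_def mem_pull_preimage[OF fg] using Z fgR f' g' by simp
    from t(2)[OF fg this] have "t (Z, Cmp D f g) = u (Cmp D f g) (Id C Z)"
      using P(5)[OF Z t(1)[OF fg]] by simp
    also have "\<dots> = restrict_family g (s f) (Z, Id D (Fo \<Phi> Z))"
      using Z f' g' match[OF f, of g] by (simp add: u_def)
    also have "\<dots> = s f (Z, g)" using compatible_family_at[OF s[OF f] g] by simp
    finally show "restrict_family f t (Z, g) = s f (Z, g)" using restrict_family_app[OF g, of t] by simp
  qed
  ultimately show ?thesis by blast
qed

text \<open>On the objects \<open>\<Phi>(Z)\<close>, a compatible family is the same as an element of \<open>G(Z)\<close>.\<close>

lemma compatible_families_at_image:
  assumes G: "presheaf elts C G" and Z: "Z \<in> Ob C"
  shows "bij_betw (\<lambda>t. t (Z, Id D (Fo \<Phi> Z))) (compatible_families elts G (Fo \<Phi> Z)) (elts (Po G Z))"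
  unfolding bij_betw_def
proof
  note P = presheafD[OF G] and id = dense_arrows_Id[OF Z]
  have at: "t (W, g) = Pm G (lift W Z g) (t (Z, Id D (Fo \<Phi> Z)))"
    if t: "t \<in> compatible_families elts G (Fo \<Phi> Z)" and g: "(W, g) \<in> dense_arrows (Fo \<Phi> Z)" for t W g
  proof -
    note l = lift[of W Z g]
    have "g \<in> Mor D" "Dom D g = Fo \<Phi> W" "Cod D g = Fo \<Phi> Z" "W \<in> Ob C" using g by (simp_all add: dense_arrows_def)
    then show ?thesis
      using compatible_familiesD(2)[OF t, of "lift W Z g" "Id D (Fo \<Phi> Z)"] l id Z by simp
  qed
  show "inj_on (\<lambda>t. t (Z, Id D (Fo \<Phi> Z))) (compatible_families elts G (Fo \<Phi> Z))"
  proof (rule inj_onI)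
    fix t t' assume t: "t \<in> compatible_families elts G (Fo \<Phi> Z)" "t' \<in> compatible_families elts G (Fo \<Phi> Z)"
      and eq: "t (Z, Id D (Fo \<Phi> Z)) = t' (Z, Id D (Fo \<Phi> Z))"
    show "t = t'" by (rule compatible_families_eqI[OF t]) (simp only: at[OF t(1)] at[OF t(2)] eq)
  qed
  show "(\<lambda>t. t (Z, Id D (Fo \<Phi> Z))) ` compatible_families elts G (Fo \<Phi> Z) = elts (Po G Z)"
  proof
    show "(\<lambda>t. t (Z, Id D (Fo \<Phi> Z))) ` compatible_families elts G (Fo \<Phi> Z) \<subseteq> elts (Po G Z)"
      using compatible_familiesD(1)[OF _ id] by blast
    show "elts (Po G Z) \<subseteq> (\<lambda>t. t (Z, Id D (Fo \<Phi> Z))) ` compatible_families elts G (Fo \<Phi> Z)"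
    proof
      fix x assume x: "x \<in> elts (Po G Z)"
      define t where "t = (\<lambda>(W, g)\<in>dense_arrows (Fo \<Phi> Z). Pm G (lift W Z g) x)"
      have "t \<in> compatible_families elts G (Fo \<Phi> Z)"
        unfolding compatible_families_def
      proof (intro CollectI conjI allI ballI impI)
        show "t \<in> extensional (dense_arrows (Fo \<Phi> Z))" by (simp add: t_def)
        show "t (W, g) \<in> elts (Po G W)" if g: "(W, g) \<in> dense_arrows (Fo \<Phi> Z)" for W g
          using g Z lift[of W Z g] P(4)[of "lift W Z g" Z x] x by (simp add: t_def dense_arrows_def)
        fix k g assume k: "k \<in> Mor C" and g: "(Cod C k, g) \<in> dense_arrows (Fo \<Phi> Z)"
        then have g': "g \<in> Mor D" "Dom D g = Fo \<Phi> (Cod C k)" "Cod D g = Fo \<Phi> Z" by (simp_all add: dense_arrows_def)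
        note l = lift[OF src.dom_cod_Ob(2)[OF k] Z g']
        have "lift (Dom C k) Z (Cmp D g (Fm \<Phi> k)) = Cmp C (lift (Cod C k) Z g) k"
          using lift_Fm[of "Cmp C (lift (Cod C k) Z g) k" "Dom C k" Z] k l by simp
        then show "t (Dom C k, Cmp D g (Fm \<Phi> k)) = Pm G k (t (Cod C k, g))"
          using P(6)[of k "lift (Cod C k) Z g" Z x] k l x g dense_arrows_Fm[OF g k] by (simp add: t_def)
      qed
      moreover have "t (Z, Id D (Fo \<Phi> Z)) = x"
        using id lift_Fm[of "Id C Z" Z Z] Z P(5)[OF Z x] by (simp add: t_def)
      ultimately show "x \<in> (\<lambda>t. t (Z, Id D (Fo \<Phi> Z))) ` compatible_families elts G (Fo \<Phi> Z)" by blast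
    qed
  qed
qed

text \<open>For every \<open>X\<close>, the arrows \<open>\<Phi>(Z) \<rightarrow> X\<close> all factor through a small set of such arrows. The sets of
  compatible families are then small, although \<open>C\<close> need not be.\<close>

definition small_dense_arrows :: "('u \<Rightarrow> 'u set) \<Rightarrow> bool" where
  "small_dense_arrows elts \<longleftrightarrow> (\<forall>X\<in>Ob D. \<exists>N\<subseteq>dense_arrows X. small elts N \<and>
     (\<forall>(Z, g)\<in>dense_arrows X. \<exists>(W, n)\<in>N. \<exists>k\<in>Mor C. Dom C k = Z \<and> Cod C k = W \<and> g = Cmp D n (Fm \<Phi> k)))"

lemma small_compatible_families:
  assumes "universe elts" "small_dense_arrows elts" and X: "X \<in> Ob D"
  shows "small elts (compatible_families elts G X)"
proof -
  interpret universe elts by fact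
  obtain N where N: "N \<subseteq> dense_arrows X" "small elts N"
    and fac: "\<And>Z g. (Z, g) \<in> dense_arrows X \<Longrightarrow>
      \<exists>W n k. (W, n) \<in> N \<and> k \<in> Mor C \<and> Dom C k = Z \<and> Cod C k = W \<and> g = Cmp D n (Fm \<Phi> k)"
    using assms(2) X unfolding small_dense_arrows_def by (smt (verit) case_prodD case_prodE)
  have "small elts (\<Pi>\<^sub>E (Z, g)\<in>N. elts (Po G Z))"
    by (rule small_PiE[OF N(2)]) (auto split: prod.split)
  then show ?thesis
  proof (rule small_inj)
    show "inj_on (\<lambda>t. restrict t N) (compatible_families elts G X)"
    proof (rule inj_onI)
      fix t t' assume t: "t \<in> compatible_families elts G X" "t' \<in> compatible_families elts G X"
        and eq: "restrict t N = restrict t' N"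
      show "t = t'"
      proof (rule compatible_families_eqI[OF t])
        fix Z g assume "(Z, g) \<in> dense_arrows X"
        then obtain W n k where n: "(W, n) \<in> N" "k \<in> Mor C" "Dom C k = Z" "Cod C k = W" "g = Cmp D n (Fm \<Phi> k)"
          using fac by blast
        have "t (W, n) = t' (W, n)" using fun_cong[OF eq, of "(W, n)"] n by simp
        then show "t (Z, g) = t' (Z, g)"
          using compatible_familiesD(2)[OF t(1), of k n] compatible_familiesD(2)[OF t(2), of k n] n N(1) by auto
      qed
    qed
    show "(\<lambda>t. restrict t N) ` compatible_families elts G X \<subseteq> (\<Pi>\<^sub>E (Z, g)\<in>N. elts (Po G Z))"
    proof (rule image_subsetI)
      fix t assume t: "t \<in> compatible_families elts G X"
      show "restrict t N \<in> (\<Pi>\<^sub>E (Z, g)\<in>N. elts (Po G Z))"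
        using compatible_familiesD(1)[OF t] N(1) by (intro restrict_PiE_iff[THEN iffD2]) auto
    qed
  qed
qed

lemma restriction_essentially_surjective:
  assumes U: "universe elts" and small: "small_dense_arrows elts" and G: "sheaf elts C induced G"
  shows "\<exists>F \<alpha>. sheaf elts D K F \<and> presheaf_nat elts C (restrict_presheaf C \<Phi> F) G \<alpha>
    \<and> (\<forall>X\<in>Ob C. bij_betw (\<alpha> X) (elts (Po (restrict_presheaf C \<Phi> F) X)) (elts (Po G X)))"
proof -
  let ?A = "compatible_families elts G"
  obtain F e where F: "sheaf elts D K F"
    and e: "\<And>X. X \<in> Ob D \<Longrightarrow> bij_betw (e X) (?A X) (elts (Po F X))"
    and nat: "\<And>f t. f \<in> Mor D \<Longrightarrow> t \<in> ?A (Cod D f)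
      \<Longrightarrow> Pm F f (e (Cod D f) t) = e (Dom D f) (restrict_family f t)"
  proof (rule site.sheaf_of_small_sets[of elts ?A restrict_family])
    show "small elts (?A X)" if "X \<in> Ob D" for X using small_compatible_families[OF U small that] .
    show "restrict_family f t \<in> ?A (Dom D f)" if "f \<in> Mor D" "t \<in> ?A (Cod D f)" for f t
      using restrict_family_in[OF that] .
    show "restrict_family (Id D X) t = t" if "X \<in> Ob D" "t \<in> ?A X" for X t
      using restrict_family_Id[OF that] .
    show "restrict_family (Cmp D g f) t = restrict_family f (restrict_family g t)"
      if "f \<in> Mor D" "g \<in> Mor D" "Cod D f = Dom D g" "t \<in> ?A (Cod D g)" for f g t
      using restrict_family_Cmp[OF that] .
    show "\<exists>t\<in>?A X. \<forall>f\<in>R. restrict_family f t = s f"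
      if "X \<in> Ob D" "R \<in> K X" "\<And>f. f \<in> R \<Longrightarrow> s f \<in> ?A (Dom D f)"
        "\<And>f g. f \<in> R \<Longrightarrow> g \<in> Mor D \<Longrightarrow> Cod D g = Dom D f \<Longrightarrow> s (Cmp D f g) = restrict_family g (s f)" for X R s
      using compatible_families_glue[OF G that] .
    show "t = t'"
      if "X \<in> Ob D" "R \<in> K X" "t \<in> ?A X" "t' \<in> ?A X"
        "\<And>f. f \<in> R \<Longrightarrow> restrict_family f t = restrict_family f t'" for X R t t'
      using compatible_families_separated[OF G that] .
  qed blast
  let ?F = "restrict_presheaf C \<Phi> F"
  define d where "d X = inv_into (?A X) (e X)" for X
  have d: "bij_betw (d X) (elts (Po F X)) (?A X)" if "X \<in> Ob D" for X
    unfolding d_def by (rule bij_betw_inv_into[OF e[OF that]])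
  have d_in: "d X y \<in> ?A X" "e X (d X y) = y" if "X \<in> Ob D" "y \<in> elts (Po F X)" for X y
    using e[OF that(1)] that(2) unfolding d_def bij_betw_def
    by (simp_all add: inv_into_into f_inv_into_f)
  have de: "d X (e X t) = t" if "X \<in> Ob D" "t \<in> ?A X" for X t
    using e[OF that(1)] that(2) unfolding d_def bij_betw_def by auto
  define ev where "ev Z = (\<lambda>t :: 'o \<times> 'b \<Rightarrow> 'c. t (Z, Id D (Fo \<Phi> Z)))" for Z
  define \<alpha> where "\<alpha> = (\<lambda>Z\<in>Ob C. \<lambda>y\<in>elts (Po F (Fo \<Phi> Z)). ev Z (d (Fo \<Phi> Z) y))"
  have bij: "bij_betw (\<alpha> Z) (elts (Po ?F Z)) (elts (Po G Z))" if Z: "Z \<in> Ob C" for Z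
  proof -
    have "bij_betw (ev Z \<circ> d (Fo \<Phi> Z)) (elts (Po F (Fo \<Phi> Z))) (elts (Po G Z))"
      unfolding ev_def
      by (rule bij_betw_trans[OF d compatible_families_at_image[OF sheaf_presheaf[OF G] Z]]) (use Z in simp)
    then have "bij_betw (\<alpha> Z) (elts (Po F (Fo \<Phi> Z))) (elts (Po G Z))"
      by (rule bij_betw_cong[THEN iffD1, rotated]) (use Z in \<open>simp add: \<alpha>_def\<close>)
    then show ?thesis using Z by simp
  qed
  have "presheaf_nat elts C ?F G \<alpha>"
    unfolding presheaf_nat_def
  proof (intro conjI ballI)
    show "\<alpha> \<in> extensional (Ob C)" by (simp add: \<alpha>_def)
    show "\<alpha> Z \<in> elts (Po ?F Z) \<rightarrow>\<^sub>E elts (Po G Z)" if Z: "Z \<in> Ob C" for Z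
      using bij[OF Z] Z by (auto simp: bij_betw_def PiE_def \<alpha>_def)
    fix f y assume f: "f \<in> Mor C" and y: "y \<in> elts (Po ?F (Cod C f))"
    define t where "t = d (Fo \<Phi> (Cod C f)) y"
    have y': "y \<in> elts (Po F (Fo \<Phi> (Cod C f)))" using y f by simp
    then have t: "t \<in> ?A (Fo \<Phi> (Cod C f))" "e (Fo \<Phi> (Cod C f)) t = y"
      using d_in f by (simp_all add: t_def)
    have res: "restrict_family (Fm \<Phi> f) t \<in> ?A (Fo \<Phi> (Dom C f))"
      using restrict_family_in[of "Fm \<Phi> f"] t f by simp
    have "Pm F (Fm \<Phi> f) y = e (Fo \<Phi> (Dom C f)) (restrict_family (Fm \<Phi> f) t)"
      using nat[of "Fm \<Phi> f" t] t f by simp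
    then have "d (Fo \<Phi> (Dom C f)) (Pm F (Fm \<Phi> f) y) = restrict_family (Fm \<Phi> f) t"
      using de[OF _ res] f by simp
    moreover have "Pm F (Fm \<Phi> f) y \<in> elts (Po F (Fo \<Phi> (Dom C f)))"
      using presheafD(4)[OF sheaf_presheaf[OF F], of "Fm \<Phi> f"] y' f by simp
    ultimately have "\<alpha> (Dom C f) (Pm ?F f y) = t (Dom C f, Fm \<Phi> f)"
      using f dense_arrows_Id[of "Dom C f"] by (simp add: \<alpha>_def ev_def restrict_family_app)
    also have "\<dots> = Pm G f (t (Cod C f, Id D (Fo \<Phi> (Cod C f))))"
      using compatible_familiesD(2)[OF t(1) f dense_arrows_Id] f by simp
    also have "\<dots> = Pm G f (\<alpha> (Cod C f) y)" using f y' by (simp add: \<alpha>_def ev_def t_def)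
    finally show "\<alpha> (Dom C f) (Pm ?F f y) = Pm G f (\<alpha> (Cod C f) y)" .
  qed
  then show ?thesis using F bij by blast
qed

theorem comparison_lemma:
  assumes U: "universe elts" and small: "small_dense_arrows elts"
    and L: "\<And>X. X \<in> Ob C \<Longrightarrow> L X = induced X"
  shows "is_equivalence (sheaf_cat elts D K) (sheaf_cat elts C L) (restriction_functor C \<Phi>)"
proof -
  have sheaf_L: "sheaf elts C L F \<longleftrightarrow> sheaf elts C induced F" for F
    using L by (simp add: sheaf_def)
  have res: "sheaf elts C L (restrict_presheaf C \<Phi> F)" if "sheaf elts D K F" for F
    unfolding sheaf_L by (rule sheaf_restrict[OF that])
  show ?thesis
  proof (rule is_equivalenceI)
    show "is_functor (sheaf_cat elts D K) (sheaf_cat elts C L) (restriction_functor C \<Phi>)"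
      by (rule restriction_is_functor[OF res])
    show "fully_faithful (sheaf_cat elts D K) (sheaf_cat elts C L) (restriction_functor C \<Phi>)"
      by (rule restriction_fully_faithful[OF res])
    fix G assume "G \<in> Ob (sheaf_cat elts C L)"
    then have G: "sheaf elts C L G" by simp
    then obtain F \<alpha> where F: "sheaf elts D K F"
      and nat: "presheaf_nat elts C (restrict_presheaf C \<Phi> F) G \<alpha>"
      and bij: "\<And>X. X \<in> Ob C \<Longrightarrow> bij_betw (\<alpha> X) (elts (Po (restrict_presheaf C \<Phi> F) X)) (elts (Po G X))"
      using restriction_essentially_surjective[OF U small] unfolding sheaf_L by blast
    have "is_iso (sheaf_cat elts C L) (restrict_presheaf C \<Phi> F, G, \<alpha>)"
      by (rule sheaf_cat_isoI[OF src.category_axioms res[OF F] G nat bij])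
    moreover have "(restrict_presheaf C \<Phi> F, G, \<alpha>) \<in> hom (sheaf_cat elts C L) (Fo (restriction_functor C \<Phi>) F) G"
      using res[OF F] G nat by (simp add: hom_sheaf_cat restriction_functor_def)
    ultimately show "\<exists>X\<in>Ob (sheaf_cat elts D K). \<exists>e. e \<in> hom (sheaf_cat elts C L) (Fo (restriction_functor C \<Phi>) X) G
        \<and> is_iso (sheaf_cat elts C L) e"
      using F by auto
  qed
qed

end


section \<open>The coinduced topology\<close>

text \<open>For a functor \<open>\<Phi> : C \<rightarrow> D\<close> and a topology \<open>L\<close> on \<open>C\<close>, the sieves on \<open>X\<close> all of whose inverse
  images along arrows \<open>\<Phi>(Z) \<rightarrow> X\<close> are covering in \<open>C\<close> form a topology on \<open>D\<close>.\<close>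

context cat_functor
begin

text \<open>The inverse image in \<open>C\<close> of a sieve on \<open>X\<close>, along an arrow \<open>g : \<Phi>(Z) \<rightarrow> X\<close>.\<close>

definition trace_sieve :: "'o \<Rightarrow> 'b \<Rightarrow> 'b set \<Rightarrow> 'a set" where
  "trace_sieve Z g S = {h \<in> Mor C. Cod C h = Z \<and> Cmp D g (Fm \<Phi> h) \<in> S}"

definition coinduced :: "('o \<Rightarrow> 'a set set) \<Rightarrow> 'p \<Rightarrow> 'b set set" where
  "coinduced L X = {S. is_sieve D X S \<and>
     (\<forall>Z\<in>Ob C. \<forall>g\<in>Mor D. Dom D g = Fo \<Phi> Z \<and> Cod D g = X \<longrightarrow> trace_sieve Z g S \<in> L Z)}"

lemma coinduced_topology:
  assumes "grothendieck_topology C L"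
  shows "grothendieck_topology D (coinduced L)"
proof -
  interpret C: grothendieck_topology C L by fact
  have sieve: "is_sieve C Z (trace_sieve Z g S)"
    if g: "g \<in> Mor D" "Dom D g = Fo \<Phi> Z" "Cod D g = X" and S: "is_sieve D X S" for Z g S X
    unfolding is_sieve_def
  proof (intro conjI ballI impI)
    show "trace_sieve Z g S \<subseteq> {f \<in> Mor C. Cod C f = Z}" by (auto simp: trace_sieve_def)
    fix h k assume "h \<in> trace_sieve Z g S" and k: "k \<in> Mor C" "Cod C k = Dom C h"
    then have h: "h \<in> Mor C" "Cod C h = Z" "Cmp D g (Fm \<Phi> h) \<in> S" by (auto simp: trace_sieve_def)
    have "Cmp D (Cmp D g (Fm \<Phi> h)) (Fm \<Phi> k) \<in> S" using tgt.is_sieveD(3)[OF S h(3)] g h k by simp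
    then show "Cmp C h k \<in> trace_sieve Z g S" using g h k by (simp add: trace_sieve_def tgt.Cmp_assoc)
  qed
  show ?thesis
  proof unfold_locales
    show "is_sieve D X R" if "R \<in> coinduced L X" for X R using that by (simp add: coinduced_def)
    show "pull_sieve D f R \<in> coinduced L (Dom D f)" if f: "f \<in> Mor D" and R: "R \<in> coinduced L (Cod D f)" for f R
    proof -
      have "trace_sieve Z g (pull_sieve D f R) = trace_sieve Z (Cmp D f g) R"
        if "Z \<in> Ob C" "g \<in> Mor D" "Dom D g = Fo \<Phi> Z" "Cod D g = Dom D f" for Z g
        using f that by (auto simp: trace_sieve_def pull_sieve_def tgt.Cmp_assoc)
      then show ?thesis using f R tgt.is_sieve_pull[of f R] by (simp add: coinduced_def)
    qed
    show "S \<in> coinduced L X"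
      if X: "X \<in> Ob D" and R: "R \<in> coinduced L X" and S: "is_sieve D X S"
        and loc: "\<And>f. f \<in> R \<Longrightarrow> pull_sieve D f S \<in> coinduced L (Dom D f)" for X R S
      unfolding coinduced_def
    proof (intro CollectI conjI S ballI impI)
      fix Z g assume Z: "Z \<in> Ob C" and "g \<in> Mor D" "Dom D g = Fo \<Phi> Z \<and> Cod D g = X"
      then have g: "g \<in> Mor D" "Dom D g = Fo \<Phi> Z" "Cod D g = X" by auto
      have tr: "trace_sieve Z g R \<in> L Z" using R Z g by (simp add: coinduced_def)
      show "trace_sieve Z g S \<in> L Z"
      proof (rule C.local_character[OF Z tr sieve[OF g S]])
        fix h assume "h \<in> trace_sieve Z g R"
        then have h: "h \<in> Mor C" "Cod C h = Z" "Cmp D g (Fm \<Phi> h) \<in> R" by (auto simp: trace_sieve_def)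
        have "trace_sieve (Dom C h) (Id D (Fo \<Phi> (Dom C h))) (pull_sieve D (Cmp D g (Fm \<Phi> h)) S) \<in> L (Dom C h)"
          using loc[OF h(3)] g h by (simp add: coinduced_def)
        moreover have "trace_sieve (Dom C h) (Id D (Fo \<Phi> (Dom C h))) (pull_sieve D (Cmp D g (Fm \<Phi> h)) S)
            = pull_sieve C h (trace_sieve Z g S)"
          using g h by (auto simp: trace_sieve_def pull_sieve_def tgt.Cmp_assoc)
        ultimately show "pull_sieve C h (trace_sieve Z g S) \<in> L (Dom C h)" by simp
      qed
    qed
    show "{f \<in> Mor D. Cod D f = X} \<in> coinduced L X" if "X \<in> Ob D" for X
    proof -
      have "trace_sieve Z g {f \<in> Mor D. Cod D f = X} = {f \<in> Mor C. Cod C f = Z}"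
        if "Z \<in> Ob C" "g \<in> Mor D" "Dom D g = Fo \<Phi> Z" "Cod D g = X" for Z g
        using that by (auto simp: trace_sieve_def)
      then show ?thesis using C.maximal tgt.is_sieve_maximal by (simp add: coinduced_def)
    qed
  qed
qed

end


section \<open>Generators of the co-evanescent topology\<close>

lemma fibre_simps [simp]:
  "V \<in> Ob (fibre E I \<pi> i) \<longleftrightarrow> V \<in> Ob E \<and> Fo \<pi> V = i"
  "u \<in> Mor (fibre E I \<pi> i) \<longleftrightarrow> u \<in> Mor E \<and> Fo \<pi> (Dom E u) = i \<and> Fo \<pi> (Cod E u) = i \<and> Fm \<pi> u = Id I i"
  "Dom (fibre E I \<pi> i) = Dom E" "Cod (fibre E I \<pi> i) = Cod E" "Id (fibre E I \<pi> i) = Id E"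
  "Cmp (fibre E I \<pi> i) = Cmp E"
  by (auto simp: fibre_def)

lemma generated_sieve_fibre: "generated_sieve (fibre E I \<pi> i) S \<subseteq> generated_sieve E S"
  unfolding generated_sieve_def by auto

text \<open>A functor with a choice of an arrow \<open>cl f V : f\<^sup>+(V) \<rightarrow> V\<close> over every arrow \<open>f\<close>; these arrows
  are not yet required to be cartesian.\<close>

locale cleaved = cat_functor E I \<pi>
  for E :: "('e, 'm) cat" and I :: "('i, 'k) cat" and \<pi> :: "('e, 'm, 'i, 'k) functr" +
  fixes cl :: "'k \<Rightarrow> 'e \<Rightarrow> 'm"
  assumes cl: "f \<in> Mor I \<Longrightarrow> V \<in> Ob E \<Longrightarrow> Fo \<pi> V = Cod I f
    \<Longrightarrow> cl f V \<in> Mor E \<and> Cod E (cl f V) = V \<and> Fm \<pi> (cl f V) = f"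
begin

lemma cl_simps:
  assumes "f \<in> Mor I" "V \<in> Ob E" "Fo \<pi> V = Cod I f"
  shows "cl f V \<in> Mor E" "Cod E (cl f V) = V" "Fm \<pi> (cl f V) = f" "Fo \<pi> (Dom E (cl f V)) = Dom I f"
  using cl[OF assms] Fm_mor(2)[of "cl f V"] by auto

text \<open>Up to the choice of isomorphisms, the generating families of the second kind are the families
  of the arrows \<open>cl f V\<close>, for \<open>f\<close> in a covering family of \<open>I\<close>.\<close>

lemma cartesian_family_cl:
  assumes V: "V \<in> Ob E" and N: "covering I J (Fo \<pi> V) N"
  shows "cartesian_family I J E \<pi> cl V ((\<lambda>f. cl f V) ` N)"
proof -
  have N': "f \<in> Mor I" "Cod I f = Fo \<pi> V" if "f \<in> N" for f using N that by (auto simp: covering_def)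
  note c = cl_simps[OF N'(1) V N'(2)[symmetric]]
  have "Fm \<pi> ` (\<lambda>f. cl f V) ` N = N" using c by (auto simp: image_image)
  moreover have "is_iso (fibre E I \<pi> (Dom I f)) (Id E (Dom E (cl f V)))" if f: "f \<in> N" for f
    using c[OF f f] f by (intro isoI[where g = "Id E (Dom E (cl f V))"]) (auto simp: hom_def)
  ultimately show ?thesis
    unfolding cartesian_family_def
    using V N c by (intro conjI exI[of _ "Fm \<pi>"] exI[of _ "\<lambda>u. Id E (Dom E u)"]) (auto simp: inverse_image_def)
qed

lemma cartesian_family_generates:
  assumes "cartesian_family I J E \<pi> cl V S"
  shows "\<exists>N. covering I J (Fo \<pi> V) N \<and> S \<subseteq> {f \<in> Mor E. Cod E f = V}
    \<and> generated_sieve E ((\<lambda>f. cl f V) ` N) \<subseteq> generated_sieve E S"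
proof -
  obtain f w where V: "V \<in> Ob E" and S: "S \<subseteq> Mor E" and N: "covering I J (Fo \<pi> V) (f ` S)"
    and w: "\<And>u. u \<in> S \<Longrightarrow> is_iso (fibre E I \<pi> (Dom I (f u))) (w u)
      \<and> Dom E (w u) = Dom E u \<and> Cod E (w u) = Dom E (cl (f u) V) \<and> u = Cmp E (cl (f u) V) (w u)"
    using assms by (auto simp: cartesian_family_def inverse_image_def)
  have f: "f u \<in> Mor I" "Fo \<pi> V = Cod I (f u)" if "u \<in> S" for u using N that by (auto simp: covering_def)
  note c = cl_simps[OF f(1) V f(2)]
  have "S \<subseteq> {f \<in> Mor E. Cod E f = V}"
  proof
    fix u assume u: "u \<in> S"
    have m: "w u \<in> Mor E" "Cod E (w u) = Dom E (cl (f u) V)" using w[OF u] by (simp_all add: is_iso_def)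
    have "Cod E (Cmp E (cl (f u) V) (w u)) = V" using m c[OF u u] by (simp only: src.Cmp_mor)
    moreover have "u = Cmp E (cl (f u) V) (w u)" using w[OF u] by blast
    ultimately show "u \<in> {f \<in> Mor E. Cod E f = V}" using S u by auto
  qed
  moreover from this have sieve: "is_sieve E V (generated_sieve E S)" by (rule src.is_sieve_generated)
  have "(\<lambda>f. cl f V) ` f ` S \<subseteq> generated_sieve E S"
  proof clarify
    fix u assume u: "u \<in> S"
    note c = c[OF u u] and wu = w[OF u]
    have wm: "w u \<in> Mor E" using wu by (simp add: is_iso_def)
    obtain v where v: "v \<in> Mor E" "Dom E v = Cod E (w u)" "Cod E v = Dom E (w u)"
        "Cmp E (w u) v = Id E (Cod E (w u))"
      using wu by (auto simp: is_iso_def hom_def)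
    have "Cmp E u v = Cmp E (Cmp E (cl (f u) V) (w u)) v" using wu by simp
    also have "\<dots> = Cmp E (cl (f u) V) (Cmp E (w u) v)"
      using c wm wu v by (intro src.Cmp_assoc) auto
    also have "\<dots> = cl (f u) V" using v c wu by simp
    finally have "cl (f u) V = Cmp E u v" by simp
    moreover have "Cod E v = Dom E u" using v wu by simp
    ultimately show "cl (f u) V \<in> generated_sieve E S" using u v(1) unfolding generated_sieve_def by blast
  qed
  then have "generated_sieve E ((\<lambda>f. cl f V) ` f ` S) \<subseteq> generated_sieve E S"
    by (rule src.generated_least[OF sieve])
  ultimately show ?thesis using N by blast
qed

lemma coevanescent_topology_topology: "grothendieck_topology E (coevanescent_topology I J E \<pi> cl T)"
  unfolding coevanescent_topology_def by (rule src.generated_topology_topology)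

lemma coevanescent_vertical:
  assumes "i \<in> Ob I" and S: "covering (fibre E I \<pi> i) (T i) V S"
  shows "generated_sieve E S \<in> coevanescent_topology I J E \<pi> cl T V"
proof -
  have "covering E (coevanescent_topology I J E \<pi> cl T) V S"
    unfolding coevanescent_topology_def
    by (rule src.generated_topology_covering) (use assms in \<open>auto simp: vertical_family_def covering_def\<close>)
  then show ?thesis by (simp add: covering_def)
qed

lemma coevanescent_cartesian:
  assumes V: "V \<in> Ob E" and N: "covering I J (Fo \<pi> V) N"
  shows "generated_sieve E ((\<lambda>f. cl f V) ` N) \<in> coevanescent_topology I J E \<pi> cl T V"
proof -
  have "(\<lambda>f. cl f V) ` N \<subseteq> {f \<in> Mor E. Cod E f = V}" using N V cl_simps by (auto simp: covering_def)
  then have "covering E (coevanescent_topology I J E \<pi> cl T) V ((\<lambda>f. cl f V) ` N)"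
    unfolding coevanescent_topology_def
    by (intro src.generated_topology_covering) (use V cartesian_family_cl[OF V N] in auto)
  then show ?thesis by (simp add: covering_def)
qed

lemma coevanescent_least:
  assumes L: "grothendieck_topology E L"
    and vert: "\<And>i V S. i \<in> Ob I \<Longrightarrow> covering (fibre E I \<pi> i) (T i) V S \<Longrightarrow> generated_sieve E S \<in> L V"
    and cart: "\<And>V N. V \<in> Ob E \<Longrightarrow> covering I J (Fo \<pi> V) N \<Longrightarrow> generated_sieve E ((\<lambda>f. cl f V) ` N) \<in> L V"
  shows "coevanescent_topology I J E \<pi> cl T V \<subseteq> L V"
  unfolding coevanescent_topology_def
proof (rule src.generated_topology_least[OF L])
  interpret L: grothendieck_topology E L by (rule L)
  fix Y S assume Y: "Y \<in> Ob E" and "S \<in> {S. vertical_family I E \<pi> T Y S \<or> cartesian_family I J E \<pi> cl Y S}"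
  then consider "vertical_family I E \<pi> T Y S" | "cartesian_family I J E \<pi> cl Y S" by blast
  then show "covering E L Y S"
  proof cases
    case 1
    then obtain i where i: "i \<in> Ob I" "covering (fibre E I \<pi> i) (T i) Y S" by (auto simp: vertical_family_def)
    then show ?thesis using vert[OF i] Y by (auto simp: covering_def)
  next
    case 2
    then obtain N where N: "covering I J (Fo \<pi> Y) N" "S \<subseteq> {f \<in> Mor E. Cod E f = Y}"
        "generated_sieve E ((\<lambda>f. cl f Y) ` N) \<subseteq> generated_sieve E S"
      using cartesian_family_generates by blast
    have "generated_sieve E S \<in> L Y"
      using L.covering_superset[OF Y cart[OF Y N(1)] src.is_sieve_generated[OF N(2)] N(3)] .
    then show ?thesis using Y N(2) by (simp add: covering_def)
  qed
qed

end

text \<open>A fibred category with a normalized cleavage.\<close>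

locale fibred_category = cat_functor E I \<pi>
  for E :: "('e, 'm) cat" and I :: "('i, 'k) cat" and \<pi> :: "('e, 'm, 'i, 'k) functr" +
  fixes cl :: "'k \<Rightarrow> 'e \<Rightarrow> 'm"
  assumes fibred: "fibred E I \<pi>" and cleavage: "normalized_cleavage E I \<pi> cl"
begin

sublocale cleaved E I \<pi> cl
  by unfold_locales (use cleavage in \<open>auto simp: normalized_cleavage_def cartesian_def\<close>)

lemma cartesian_cl: "f \<in> Mor I \<Longrightarrow> V \<in> Ob E \<Longrightarrow> Fo \<pi> V = Cod I f \<Longrightarrow> cartesian E I \<pi> (cl f V)"
  using cleavage by (auto simp: normalized_cleavage_def)

lemma cartesian_factor:
  assumes "cartesian E I \<pi> u" "v \<in> Mor E" "Cod E v = Cod E u" "Fm \<pi> v = Fm \<pi> u"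
  shows "\<exists>!w. w \<in> hom (fibre E I \<pi> (Fo \<pi> (Dom E u))) (Dom E v) (Dom E u) \<and> Cmp E u w = v"
  using assms by (auto simp: cartesian_def)

lemma cl_factor:
  assumes V: "V \<in> Ob E" and g: "g \<in> Mor E" "Cod E g = V"
  obtains w where "w \<in> Mor E" "Dom E w = Dom E g" "Cod E w = Dom E (cl (Fm \<pi> g) V)"
    "Fm \<pi> w = Id I (Fo \<pi> (Dom E g))" "Cmp E (cl (Fm \<pi> g) V) w = g"
proof -
  have f: "Fm \<pi> g \<in> Mor I" "Fo \<pi> V = Cod I (Fm \<pi> g)" using g by auto
  note c = cl_simps[OF f(1) V f(2)]
  obtain w where "w \<in> hom (fibre E I \<pi> (Fo \<pi> (Dom E (cl (Fm \<pi> g) V)))) (Dom E g) (Dom E (cl (Fm \<pi> g) V))"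
    "Cmp E (cl (Fm \<pi> g) V) w = g"
    using cartesian_factor[OF cartesian_cl[OF f(1) V f(2)] g(1)] c g by auto
  then show thesis using that c g by (auto simp: hom_def)
qed

text \<open>Since a composite of cartesian arrows is cartesian, an arrow to \<open>V\<close> over \<open>n \<circ> p\<close> factors
  through \<open>cl n V\<close>.\<close>

lemma cl_factor_Cmp:
  assumes V: "V \<in> Ob E" and g: "g \<in> Mor E" "Cod E g = V"
    and n: "n \<in> Mor I" "Cod I n = Fo \<pi> V" and p: "p \<in> Mor I" "Cod I p = Dom I n" and eq: "Fm \<pi> g = Cmp I n p"
  obtains m where "m \<in> Mor E" "Cod E m = Dom E (cl n V)" "g = Cmp E (cl n V) m"
proof -
  note c = cl_simps[OF n(1) V n(2)[symmetric]]
  let ?W = "Dom E (cl n V)"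
  have W: "?W \<in> Ob E" "Fo \<pi> ?W = Cod I p" using c p by auto
  note d = cl_simps[OF p(1) W]
  have "cartesian E I \<pi> (Cmp E (cl n V) (cl p ?W))"
    using fibred cartesian_cl[OF n(1) V n(2)[symmetric]] cartesian_cl[OF p(1) W] d unfolding fibred_def by blast
  then obtain w where w: "w \<in> Mor E" "Cod E w = Dom E (cl p ?W)" "Cmp E (Cmp E (cl n V) (cl p ?W)) w = g"
    using cartesian_factor[of "Cmp E (cl n V) (cl p ?W)" g] g eq c d by (auto simp: hom_def)
  show thesis
  proof (rule that[of "Cmp E (cl p ?W) w"])
    show "g = Cmp E (cl n V) (Cmp E (cl p ?W) w)" using w c d by (simp add: src.Cmp_assoc[symmetric])
  qed (use w d in simp_all)
qed

lemma inverse_image_arrow: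
  assumes f: "f \<in> Mor I" and u: "u \<in> Mor (fibre E I \<pi> (Cod I f))"
  shows "Fm (inverse_image E I \<pi> cl f) u \<in> Mor E"
    and "Dom E (Fm (inverse_image E I \<pi> cl f) u) = Dom E (cl f (Dom E u))"
    and "Cod E (Fm (inverse_image E I \<pi> cl f) u) = Dom E (cl f (Cod E u))"
    and "Cmp E (cl f (Cod E u)) (Fm (inverse_image E I \<pi> cl f) u) = Cmp E u (cl f (Dom E u))"
proof -
  have u': "u \<in> Mor E" "Fo \<pi> (Dom E u) = Cod I f" "Fo \<pi> (Cod E u) = Cod I f" "Fm \<pi> u = Id I (Cod I f)"
    using u by simp_all
  have dom: "Dom E u \<in> Ob E" and cod: "Cod E u \<in> Ob E" using u' by auto
  note d = cl_simps[OF f dom u'(2)] and c = cl_simps[OF f cod u'(3)]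
  let ?P = "\<lambda>w. w \<in> hom (fibre E I \<pi> (Dom I f)) (Dom E (cl f (Dom E u))) (Dom E (cl f (Cod E u)))
    \<and> Cmp E (cl f (Cod E u)) w = Cmp E u (cl f (Dom E u))"
  have "\<exists>!w. ?P w"
    using cartesian_factor[OF cartesian_cl[OF f cod u'(3)], of "Cmp E u (cl f (Dom E u))"] c d u' f by simp
  from theI'[OF this] have "?P (Fm (inverse_image E I \<pi> cl f) u)" by (simp add: inverse_image_def)
  then show "Fm (inverse_image E I \<pi> cl f) u \<in> Mor E"
    and "Dom E (Fm (inverse_image E I \<pi> cl f) u) = Dom E (cl f (Dom E u))"
    and "Cod E (Fm (inverse_image E I \<pi> cl f) u) = Dom E (cl f (Cod E u))"
    and "Cmp E (cl f (Cod E u)) (Fm (inverse_image E I \<pi> cl f) u) = Cmp E u (cl f (Dom E u))"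
    by (simp_all add: hom_def)
qed

end


section \<open>Base change\<close>

text \<open>The base change of a fibred category \<open>E\<close> over \<open>I\<close> along a functor \<open>\<phi> : I' \<rightarrow> I\<close>.\<close>

locale base_change = fib: fibred_category E I \<pi> cl + phi: cat_functor I' I \<phi>
  for E :: "('e, 'm) cat" and I :: "('i, 'k) cat" and \<pi> cl
    and I' :: "('i', 'k') cat" and \<phi> :: "('i', 'k', 'i, 'k) functr"
begin

abbreviation E' :: "('e \<times> 'i', 'm \<times> 'k') cat" where
  "E' \<equiv> base_change_cat E \<pi> I' \<phi>"

abbreviation \<pi>' :: "('e \<times> 'i', 'm \<times> 'k', 'i', 'k') functr" where
  "\<pi>' \<equiv> base_change_functor"

abbreviation \<Phi> :: "('e \<times> 'i', 'm \<times> 'k', 'e, 'm) functr" where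
  "\<Phi> \<equiv> base_change_projection"

abbreviation cl' :: "'k' \<Rightarrow> 'e \<times> 'i' \<Rightarrow> 'm \<times> 'k'" where
  "cl' \<equiv> base_change_cleavage \<phi> cl"

lemma E'_simps [simp]:
  "(V, i) \<in> Ob E' \<longleftrightarrow> V \<in> Ob E \<and> i \<in> Ob I' \<and> Fo \<pi> V = Fo \<phi> i"
  "(u, f) \<in> Mor E' \<longleftrightarrow> u \<in> Mor E \<and> f \<in> Mor I' \<and> Fm \<pi> u = Fm \<phi> f
    \<and> Fo \<pi> (Dom E u) = Fo \<phi> (Dom I' f) \<and> Fo \<pi> (Cod E u) = Fo \<phi> (Cod I' f)"
  "Dom E' (u, f) = (Dom E u, Dom I' f)" "Cod E' (u, f) = (Cod E u, Cod I' f)"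
  "Id E' (V, i) = (Id E V, Id I' i)" "Cmp E' (v, g) (u, f) = (Cmp E v u, Cmp I' g f)"
  by (auto simp: base_change_cat_def)

lemma projection_simps [simp]:
  "Fo \<pi>' (V, i) = i" "Fm \<pi>' (u, f) = f" "Fo \<Phi> (V, i) = V" "Fm \<Phi> (u, f) = u"
  by (simp_all add: base_change_functor_def base_change_projection_def)

lemma category_E': "category E'"
  by unfold_locales
    (auto simp: hom_def fib.src.Cmp_assoc phi.src.Cmp_assoc)

lemma functor_projection: "is_functor E' E \<Phi>"
  unfolding is_functor_def
  using category_E' fib.src.category_axioms by (auto simp: hom_def)

lemma functor_base: "is_functor E' I' \<pi>'"
  unfolding is_functor_def
  using category_E' phi.src.category_axioms by (auto simp: hom_def)

sublocale proj: cat_functor E' E \<Phi>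
  by unfold_locales (rule functor_projection)

sublocale cleaved' : cleaved E' I' \<pi>' cl'
proof
  show "is_functor E' I' \<pi>'" by (rule functor_base)
  fix f V assume f: "f \<in> Mor I'" and "V \<in> Ob E'" "Fo \<pi>' V = Cod I' f"
  then obtain W where V: "V = (W, Cod I' f)" and W: "W \<in> Ob E" "Fo \<pi> W = Cod I (Fm \<phi> f)"
    by (cases V) auto
  show "cl' f V \<in> Mor E' \<and> Cod E' (cl' f V) = V \<and> Fm \<pi>' (cl' f V) = f"
    using fib.cl_simps[OF _ W] f W by (simp add: V base_change_cleavage_def)
qed

lemma cl'_eq: "cl' f (V, i) = (cl (Fm \<phi> f) V, f)"
  by (simp add: base_change_cleavage_def)

lemma fully_faithful_projection:
  assumes ff: "fully_faithful I' I \<phi>"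
  shows "fully_faithful E' E \<Phi>"
  unfolding fully_faithful_def
proof (intro ballI)
  fix X Y assume "X \<in> Ob E'" "Y \<in> Ob E'"
  moreover obtain V i W j where XY: "X = (V, i)" "Y = (W, j)" by (metis surj_pair)
  ultimately have X: "i \<in> Ob I'" "Fo \<pi> V = Fo \<phi> i" and Y: "j \<in> Ob I'" "Fo \<pi> W = Fo \<phi> j" by auto
  have bij: "bij_betw (Fm \<phi>) (hom I' i j) (hom I (Fo \<phi> i) (Fo \<phi> j))"
    using ff X Y by (auto simp: fully_faithful_def)
  show "bij_betw (Fm \<Phi>) (hom E' X Y) (hom E (Fo \<Phi> X) (Fo \<Phi> Y))"
    unfolding bij_betw_def XY
  proof
    show "inj_on (Fm \<Phi>) (hom E' (V, i) (W, j))"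
      using bij by (auto simp: inj_on_def bij_betw_def hom_def)
    show "Fm \<Phi> ` hom E' (V, i) (W, j) = hom E (Fo \<Phi> (V, i)) (Fo \<Phi> (W, j))"
    proof
      show "Fm \<Phi> ` hom E' (V, i) (W, j) \<subseteq> hom E (Fo \<Phi> (V, i)) (Fo \<Phi> (W, j))"
        by (auto simp: hom_def)
      show "hom E (Fo \<Phi> (V, i)) (Fo \<Phi> (W, j)) \<subseteq> Fm \<Phi> ` hom E' (V, i) (W, j)"
      proof
        fix u assume "u \<in> hom E (Fo \<Phi> (V, i)) (Fo \<Phi> (W, j))"
        then have u: "u \<in> Mor E" "Dom E u = V" "Cod E u = W" by (simp_all add: hom_def)
        have "Fm \<pi> u \<in> hom I (Fo \<phi> i) (Fo \<phi> j)" using u X Y by (simp add: hom_def)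
        then obtain f where "f \<in> hom I' i j" "Fm \<phi> f = Fm \<pi> u"
          using bij by (metis bij_betw_def imageE)
        then have "(u, f) \<in> hom E' (V, i) (W, j)" "u = Fm \<Phi> (u, f)" using u X Y by (auto simp: hom_def)
        then show "u \<in> Fm \<Phi> ` hom E' (V, i) (W, j)" by (rule image_eqI[rotated])
      qed
    qed
  qed
qed

end

text \<open>A base change along a dense fully faithful functor \<open>\<phi>\<close>, with topologies \<open>T i\<close> on the fibres of
  \<open>E\<close>. The functors \<open>\<phi>\<close> and \<open>f\<^sup>+\<close> send covering sieves to covering sieves, and the topology \<open>J'\<close> is
  at least as fine as the one induced by \<open>J\<close>.\<close>

locale dense_base_change = base_change E I \<pi> cl I' \<phi> + base: dense_subsite I' I \<phi> J
  for E :: "('e, 'm) cat" and I :: "('i, 'k) cat" and \<pi> cl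
    and I' :: "('i', 'k') cat" and \<phi> :: "('i', 'k', 'i, 'k) functr" and J +
  fixes J' :: "'i' \<Rightarrow> 'k' set set" and T :: "'i \<Rightarrow> 'e \<Rightarrow> 'm set set"
  assumes topology_J': "grothendieck_topology I' J'"
    and J'_covering: "\<And>i R. i \<in> Ob I' \<Longrightarrow> R \<in> J' i \<Longrightarrow> generated_sieve I (Fm \<phi> ` R) \<in> J (Fo \<phi> i)"
    and induced_J': "\<And>i. i \<in> Ob I' \<Longrightarrow> base.induced i \<subseteq> J' i"
    and topology_T: "\<And>i. i \<in> Ob I \<Longrightarrow> grothendieck_topology (fibre E I \<pi> i) (T i)"
    and inverse_image_covering: "\<And>f V R. f \<in> Mor I \<Longrightarrow> V \<in> Ob (fibre E I \<pi> (Cod I f)) \<Longrightarrow> R \<in> T (Cod I f) V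
      \<Longrightarrow> generated_sieve (fibre E I \<pi> (Dom I f)) (Fm (inverse_image E I \<pi> cl f) ` R)
        \<in> T (Dom I f) (Fo (inverse_image E I \<pi> cl f) V)"
begin

abbreviation K where "K \<equiv> coevanescent_topology I J E \<pi> cl T"

abbreviation T' where "T' \<equiv> base_change_fibre_topology I' \<phi> T"

abbreviation K' where "K' \<equiv> coevanescent_topology I' J' E' \<pi>' cl' T'"

sublocale top: dense_subsite E' E \<Phi> K
proof (intro dense_subsite.intro proj.cat_functor_axioms fib.coevanescent_topology_topology dense_subsite_axioms.intro)
  show "fully_faithful E' E \<Phi>" by (rule fully_faithful_projection[OF base.fully_faithful])
  fix V assume V: "V \<in> Ob E"
  then obtain N where N: "covering I J (Fo \<pi> V) N" "Dom I ` N \<subseteq> Fo \<phi> ` Ob I'"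
    using base.dense[of "Fo \<pi> V"] by auto
  have N': "f \<in> Mor I" "Fo \<pi> V = Cod I f" if "f \<in> N" for f using N(1) that by (auto simp: covering_def)
  note c = fib.cl_simps[OF N'(1) V N'(2)]
  have "covering E K V ((\<lambda>f. cl f V) ` N)"
    using fib.coevanescent_cartesian[OF V N(1)] V c by (auto simp: covering_def)
  moreover have "Dom E (cl f V) \<in> Fo \<Phi> ` Ob E'" if f: "f \<in> N" for f
  proof -
    obtain i where "i \<in> Ob I'" "Dom I f = Fo \<phi> i" using N(2) f by auto
    then have "(Dom E (cl f V), i) \<in> Ob E'" using c[OF f f] by simp
    then show ?thesis by (rule image_eqI[rotated]) simp
  qed
  ultimately show "\<exists>S. covering E K V S \<and> Dom E ` S \<subseteq> Fo \<Phi> ` Ob E'" by (intro exI conjI) auto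
qed

lemma topology_K': "grothendieck_topology E' K'"
  by (rule cleaved'.coevanescent_topology_topology)

text \<open>The generating families of \<open>E'\<close> are covering for the induced topology.\<close>

lemma vertical_induced:
  assumes i: "i \<in> Ob I'" and S: "covering (fibre E' I' \<pi>' i) (T' i) X S"
  shows "generated_sieve E' S \<in> top.induced X"
proof -
  interpret ind: grothendieck_topology E' top.induced by (rule top.induced_topology)
  obtain V where X: "X = (V, i)" and XO: "(V, i) \<in> Ob E'"
    using S by (cases X) (auto simp: covering_def)
  then have V: "V \<in> Ob (fibre E I \<pi> (Fo \<phi> i))" and i': "Fo \<phi> i \<in> Ob I" using i by auto
  interpret fibre: grothendieck_topology "fibre E I \<pi> (Fo \<phi> i)" "T (Fo \<phi> i)" by (rule topology_T[OF i'])
  obtain R where R: "R \<in> T (Fo \<phi> i) V" and eq: "generated_sieve (fibre E' I' \<pi>' i) S = (\<lambda>u. (u, Id I' i)) ` R"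
    using S by (auto simp: covering_def base_change_fibre_topology_def X)
  have S': "S \<subseteq> {f \<in> Mor E'. Cod E' f = X}" using S by (auto simp: covering_def)
  have RK: "generated_sieve E R \<in> K V"
    by (rule fib.coevanescent_vertical[of "Fo \<phi> i"]) (use i' fibre.covering_sieve[OF V R] in auto)
  have sub: "top.preimage_sieve X (generated_sieve E R) \<subseteq> generated_sieve E' S"
  proof
    fix h assume "h \<in> top.preimage_sieve X (generated_sieve E R)"
    then obtain u f where h: "h = (u, f)" "h \<in> Mor E'" "Cod E u = V" "Cod I' f = i" and "u \<in> generated_sieve E R"
      by (cases h) (auto simp: top.preimage_sieve_def X)
    then obtain r m where r: "r \<in> R" and m: "m \<in> Mor E" "Cod E m = Dom E r" and u: "u = Cmp E r m"
      by (auto simp: generated_sieve_def)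
    have r': "r \<in> Mor E" "Cod E r = V" "Fo \<pi> (Dom E r) = Fo \<phi> i" "Fm \<pi> r = Id I (Fo \<phi> i)"
      using fibre.is_sieveD(1,2)[OF fibre.sieves[OF V R] r] by auto
    have "(r, Id I' i) \<in> generated_sieve E' S" using r eq generated_sieve_fibre[of E' I' \<pi>' i S] by blast
    moreover have "h = Cmp E' (r, Id I' i) (m, f)" using h u by simp
    moreover have "(m, f) \<in> Mor E'" using h m r' i u by simp
    ultimately show "h \<in> generated_sieve E' S"
      using proj.src.is_sieveD(3)[OF proj.src.is_sieve_generated[OF S'], of "(r, Id I' i)" "(m, f)"]
        m h i by simp
  qed
  show ?thesis
  proof (rule ind.covering_superset[OF _ _ proj.src.is_sieve_generated[OF S'] sub])
    show "X \<in> Ob E'" using X XO by simp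
    show "top.preimage_sieve X (generated_sieve E R) \<in> top.induced X"
      by (rule top.preimage_induced) (use X XO RK in simp_all)
  qed
qed

lemma cartesian_induced:
  assumes X: "X \<in> Ob E'" and N: "covering I' J' (Fo \<pi>' X) N"
  shows "generated_sieve E' ((\<lambda>f. cl' f X) ` N) \<in> top.induced X"
proof -
  interpret ind: grothendieck_topology E' top.induced by (rule top.induced_topology)
  obtain V i where Xeq: "X = (V, i)" by (cases X)
  with X have V: "V \<in> Ob E" and i: "i \<in> Ob I'" and Vi: "Fo \<pi> V = Fo \<phi> i" by auto
  have N': "n \<in> Mor I'" "Cod I' n = i" if "n \<in> N" for n using N that by (auto simp: covering_def Xeq)
  have c': "cl' n X \<in> Mor E'" "Cod E' (cl' n X) = X" if "n \<in> N" for n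
    using cleaved'.cl_simps[OF N'(1) X, of n] N' that by (auto simp: Xeq)
  have sub_N: "(\<lambda>f. cl' f X) ` N \<subseteq> {f \<in> Mor E'. Cod E' f = X}" using c' by auto
  note sieve = proj.src.is_sieve_generated[OF sub_N]
  have phi_N: "Fm \<phi> ` N \<subseteq> {f \<in> Mor I. Cod I f = Fo \<phi> i}" using N' by auto
  have "generated_sieve I (Fm \<phi> ` N) \<in> J (Fo \<phi> i)"
  proof (rule base.site.covering_superset)
    show "generated_sieve I (Fm \<phi> ` generated_sieve I' N) \<in> J (Fo \<phi> i)"
      by (rule J'_covering[OF i]) (use N in \<open>simp add: covering_def Xeq\<close>)
    show "is_sieve I (Fo \<phi> i) (generated_sieve I (Fm \<phi> ` N))" by (rule fib.tgt.is_sieve_generated[OF phi_N])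
    show "generated_sieve I (Fm \<phi> ` generated_sieve I' N) \<subseteq> generated_sieve I (Fm \<phi> ` N)"
    proof (rule fib.tgt.generated_least[OF fib.tgt.is_sieve_generated[OF phi_N]])
      show "Fm \<phi> ` generated_sieve I' N \<subseteq> generated_sieve I (Fm \<phi> ` N)"
      proof clarify
        fix f assume "f \<in> generated_sieve I' N"
        then obtain n g where "n \<in> N" "g \<in> Mor I'" "Cod I' g = Dom I' n" "f = Cmp I' n g"
          by (auto simp: generated_sieve_def)
        moreover from this have "Fm \<phi> f = Cmp I (Fm \<phi> n) (Fm \<phi> g)" "Cod I (Fm \<phi> g) = Dom I (Fm \<phi> n)"
          using N' by simp_all
        ultimately show "Fm \<phi> f \<in> generated_sieve I (Fm \<phi> ` N)"
          using phi.Fm_mor(1) unfolding generated_sieve_def by blast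
      qed
    qed
  qed (use i in simp)
  then have cov: "covering I J (Fo \<pi> V) (Fm \<phi> ` N)" using phi_N i by (simp add: covering_def Vi)
  let ?S = "generated_sieve E ((\<lambda>f. cl f V) ` Fm \<phi> ` N)"
  have SK: "?S \<in> K V" by (rule fib.coevanescent_cartesian[OF V cov])
  have sub: "top.preimage_sieve X ?S \<subseteq> generated_sieve E' ((\<lambda>f. cl' f X) ` N)"
  proof
    fix h assume "h \<in> top.preimage_sieve X ?S"
    then obtain u f where h: "h = (u, f)" "(u, f) \<in> Mor E'" "Cod I' f = i" and "u \<in> ?S"
      by (cases h) (auto simp: top.preimage_sieve_def Xeq)
    then obtain n m where n: "n \<in> N" and m: "m \<in> Mor E" "Cod E m = Dom E (cl (Fm \<phi> n) V)"
      and u: "u = Cmp E (cl (Fm \<phi> n) V) m" by (auto simp: generated_sieve_def)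
    have "Fm \<phi> n \<in> Mor I" "Fo \<pi> V = Cod I (Fm \<phi> n)" using N'[OF n] Vi by simp_all
    note c = fib.cl_simps[OF this(1) V this(2)]
    have pm: "Fm \<pi> m \<in> Mor I" "Dom I (Fm \<pi> m) = Fo \<phi> (Dom I' f)" "Cod I (Fm \<pi> m) = Fo \<phi> (Dom I' n)"
      using m c h(2) N'[OF n] u by auto
    then obtain k where k: "k \<in> Mor I'" "Dom I' k = Dom I' f" "Cod I' k = Dom I' n" "Fm \<phi> k = Fm \<pi> m"
      using base.full[of "Dom I' f" "Dom I' n" "Fm \<pi> m"] h(2) N'[OF n] by auto
    have "f = Cmp I' n k"
    proof (rule base.faithful)
      show "Fm \<phi> f = Fm \<phi> (Cmp I' n k)" using h(2) u c m k N'[OF n] by auto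
    qed (use h k N'[OF n] in auto)
    then have "h = Cmp E' (cl' n X) (m, k)" using h u by (simp add: Xeq cl'_eq)
    moreover have "(m, k) \<in> Mor E'" "Cod E' (m, k) = Dom E' (cl' n X)"
      using m k pm h(2) u c N'[OF n] by (auto simp: Xeq cl'_eq)
    ultimately show "h \<in> generated_sieve E' ((\<lambda>f. cl' f X) ` N)" using n unfolding generated_sieve_def by blast
  qed
  show ?thesis
  proof (rule ind.covering_superset[OF X _ sieve sub])
    show "top.preimage_sieve X ?S \<in> top.induced X"
      by (rule top.preimage_induced[OF X]) (use SK in \<open>simp add: Xeq\<close>)
  qed
qed

text \<open>The generating families of \<open>E\<close> are covering for the topology coinduced by that of \<open>E'\<close>.\<close>

lemma vertical_coinduced:
  assumes i: "i \<in> Ob I" and S: "covering (fibre E I \<pi> i) (T i) V S"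
  shows "generated_sieve E S \<in> proj.coinduced K' V"
  unfolding proj.coinduced_def
proof (intro CollectI conjI ballI impI)
  interpret K': grothendieck_topology E' K' by (rule topology_K')
  have V: "V \<in> Ob E" "Fo \<pi> V = i" and S': "S \<subseteq> {f \<in> Mor E. Cod E f = V}"
    using S by (auto simp: covering_def)
  show sieve: "is_sieve E V (generated_sieve E S)" by (rule fib.src.is_sieve_generated[OF S'])
  fix X g assume X: "X \<in> Ob E'" and "g \<in> Mor E" "Dom E g = Fo \<Phi> X \<and> Cod E g = V"
  then have g: "g \<in> Mor E" "Dom E g = Fo \<Phi> X" "Cod E g = V" by auto
  obtain W j where Xeq: "X = (W, j)" by (cases X)
  have W: "W \<in> Ob E" "j \<in> Ob I'" "Fo \<pi> W = Fo \<phi> j" "Dom E g = W" using X g by (simp_all add: Xeq)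
  define f where "f = Fm \<pi> g"
  have f: "f \<in> Mor I" "Dom I f = Fo \<phi> j" "Cod I f = i" using g W V by (auto simp: f_def)
  have Vf: "Fo \<pi> V = Cod I f" using V f by simp
  note c = fib.cl_simps[OF f(1) V(1) Vf]
  obtain w where w: "w \<in> Mor E" "Dom E w = W" "Cod E w = Dom E (cl f V)" "Fm \<pi> w = Id I (Fo \<phi> j)"
      "Cmp E (cl f V) w = g"
    using fib.cl_factor[OF V(1) g(1,3)] W unfolding f_def by metis
  \<comment> \<open>the inverse image under \<open>w\<close> of the image under \<open>f\<^sup>+\<close> of the given covering\<close>
  let ?Ei = "fibre E I \<pi> i" and ?Ej = "fibre E I \<pi> (Fo \<phi> j)" and ?Ej' = "fibre E' I' \<pi>' j"
  interpret Tj: grothendieck_topology ?Ej "T (Fo \<phi> j)" by (rule topology_T) (use W in simp)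
  interpret Ti: grothendieck_topology ?Ei "T i" by (rule topology_T[OF i])
  let ?RS = "generated_sieve ?Ei S"
  let ?RF = "generated_sieve ?Ej (Fm (inverse_image E I \<pi> cl f) ` ?RS)"
  let ?RW = "pull_sieve ?Ej w ?RF"
  have R: "?RS \<in> T i V" using S by (simp add: covering_def)
  have "?RF \<in> T (Fo \<phi> j) (Dom E (cl f V))"
    using inverse_image_covering[of f V ?RS] f V R by (simp add: inverse_image_def)
  then have R0: "?RW \<in> T (Fo \<phi> j) W"
    using Tj.stable[of w ?RF] w W c f by simp
  have R0_sieve: "is_sieve ?Ej W ?RW" by (rule Tj.sieves[OF _ R0]) (use W in simp)
  have R0': "u \<in> Mor E" "Cod E u = W" "Fo \<pi> (Dom E u) = Fo \<phi> j" "Fm \<pi> u = Id I (Fo \<phi> j)" if "u \<in> ?RW" for u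
    using Tj.is_sieveD(1,2)[OF R0_sieve that] by auto
  let ?Q = "(\<lambda>u. (u, Id I' j)) ` ?RW"
  have Q_sub: "?Q \<subseteq> {f \<in> Mor ?Ej'. Cod E' f = X}"
    using R0' W by (auto simp: Xeq)
  have Q_gen: "generated_sieve ?Ej' ?Q = ?Q"
  proof
    show "?Q \<subseteq> generated_sieve ?Ej' ?Q"
    proof clarify
      fix u assume u: "u \<in> ?RW"
      have "(u, Id I' j) = Cmp ?Ej' (u, Id I' j) (Id E (Dom E u), Id I' j)"
        using R0'[OF u] W by simp
      moreover have "(Id E (Dom E u), Id I' j) \<in> Mor ?Ej'" using R0'[OF u] W by simp
      moreover have "Cod ?Ej' (Id E (Dom E u), Id I' j) = Dom ?Ej' (u, Id I' j)" using R0'[OF u] W by simp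
      ultimately show "(u, Id I' j) \<in> generated_sieve ?Ej' ?Q" using u unfolding generated_sieve_def by blast
    qed
    show "generated_sieve ?Ej' ?Q \<subseteq> ?Q"
    proof
      fix x assume "x \<in> generated_sieve ?Ej' ?Q"
      then obtain u m k where u: "u \<in> ?RW" and mk: "(m, k) \<in> Mor ?Ej'" "Cod E' (m, k) = Dom E' (u, Id I' j)"
        and x: "x = Cmp E' (u, Id I' j) (m, k)" by (auto simp: generated_sieve_def)
      have k: "k = Id I' j" and m: "m \<in> Mor ?Ej" "Cod E m = Dom E u" using mk W by auto
      have "Cmp E u m \<in> ?RW" using Tj.is_sieveD(3)[OF R0_sieve u m(1)] m by simp
      then show "x \<in> ?Q" using W by (simp add: x k)
    qed
  qed
  have "covering ?Ej' (T' j) X ?Q"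
    using X Q_sub R0 by (auto simp: covering_def Q_gen base_change_fibre_topology_def Xeq)
  then have QK: "generated_sieve E' ?Q \<in> K' X"
    by (rule cleaved'.coevanescent_vertical[OF W(2)])
  have tr_sieve: "is_sieve E' X (proj.trace_sieve X g (generated_sieve E S))"
  proof -
    have "proj.trace_sieve X g (generated_sieve E S) = top.preimage_sieve X (pull_sieve E g (generated_sieve E S))"
      using g by (auto simp: proj.trace_sieve_def top.preimage_sieve_def pull_sieve_def)
    moreover have "is_sieve E (Fo \<Phi> X) (pull_sieve E g (generated_sieve E S))"
      using fib.src.is_sieve_pull[of g "generated_sieve E S"] g sieve by simp
    ultimately show ?thesis using top.is_sieve_preimage by simp
  qed
  show "proj.trace_sieve X g (generated_sieve E S) \<in> K' X"
  proof (rule K'.covering_superset[OF X QK tr_sieve], rule proj.src.generated_least[OF tr_sieve], rule image_subsetI)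
    fix u assume u: "u \<in> ?RW"
    then have "Cmp E w u \<in> ?RF" by (simp add: pull_sieve_def)
    then obtain r n where r: "r \<in> ?RS" and n: "n \<in> Mor E" "Cod E n = Dom E (Fm (inverse_image E I \<pi> cl f) r)"
      and eq: "Cmp E w u = Cmp E (Fm (inverse_image E I \<pi> cl f) r) n"
      by (auto simp: generated_sieve_def[of ?Ej])
    have Ri: "is_sieve ?Ei V ?RS" by (rule Ti.sieves[OF _ R]) (use V in simp)
    have r': "r \<in> Mor (fibre E I \<pi> (Cod I f))" "Cod E r = V" using Ti.is_sieveD(1,2)[OF Ri r] f by auto
    note a = fib.inverse_image_arrow[OF f(1) r'(1)]
    have dom_r: "Dom E r \<in> Ob E" "Fo \<pi> (Dom E r) = Cod I f" using r' by auto
    note d = fib.cl_simps[OF f(1) dom_r]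
    let ?z = "Cmp E (cl f (Dom E r)) n"
    have z: "?z \<in> Mor E" "Cod E ?z = Dom E r" using n d a by simp_all
    have "Cmp E g u = Cmp E (cl f V) (Cmp E w u)"
      unfolding w(5)[symmetric] using w R0'[OF u] c by (intro fib.src.Cmp_assoc) auto
    also have "\<dots> = Cmp E (Cmp E (cl f V) (Fm (inverse_image E I \<pi> cl f) r)) n"
      unfolding eq using n a r' c by (intro fib.src.Cmp_assoc[symmetric]) auto
    also have "\<dots> = Cmp E (Cmp E r (cl f (Dom E r))) n" using a(4) r' by simp
    also have "\<dots> = Cmp E r ?z" using n a d r' by (intro fib.src.Cmp_assoc) auto
    finally have "Cmp E g u = Cmp E r ?z" .
    moreover have "r \<in> generated_sieve E S" using r generated_sieve_fibre[of E I \<pi> i S] by blast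
    ultimately have "Cmp E g u \<in> generated_sieve E S" using fib.src.is_sieveD(3)[OF sieve] z by simp
    then show "(u, Id I' j) \<in> proj.trace_sieve X g (generated_sieve E S)"
      using R0'[OF u] W by (simp add: proj.trace_sieve_def Xeq)
  qed
qed

lemma cartesian_coinduced:
  assumes V: "V \<in> Ob E" and N: "covering I J (Fo \<pi> V) N"
  shows "generated_sieve E ((\<lambda>f. cl f V) ` N) \<in> proj.coinduced K' V"
  unfolding proj.coinduced_def
proof (intro CollectI conjI ballI impI)
  interpret K': grothendieck_topology E' K' by (rule topology_K')
  interpret J': grothendieck_topology I' J' by (rule topology_J')
  let ?S = "generated_sieve E ((\<lambda>f. cl f V) ` N)"
  have N': "n \<in> Mor I" "Fo \<pi> V = Cod I n" if "n \<in> N" for n using N that by (auto simp: covering_def)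
  note c = fib.cl_simps[OF N'(1) V N'(2)]
  show sieve: "is_sieve E V ?S" by (rule fib.src.is_sieve_generated) (use c in auto)
  fix X g assume X: "X \<in> Ob E'" and "g \<in> Mor E" "Dom E g = Fo \<Phi> X \<and> Cod E g = V"
  then have g: "g \<in> Mor E" "Dom E g = Fo \<Phi> X" "Cod E g = V" by auto
  obtain W j where Xeq: "X = (W, j)" by (cases X)
  have W: "W \<in> Ob E" "j \<in> Ob I'" "Fo \<pi> W = Fo \<phi> j" "Dom E g = W" using X g by (simp_all add: Xeq)
  define f where "f = Fm \<pi> g"
  have f: "f \<in> Mor I" "Dom I f = Fo \<phi> j" "Cod I f = Fo \<pi> V" using g W V by (auto simp: f_def)
  \<comment> \<open>the inverse image of the given covering of \<open>\<pi>(V)\<close> in \<open>I'\<close>\<close>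
  let ?R = "base.preimage_sieve j (pull_sieve I f (generated_sieve I N))"
  have "pull_sieve I f (generated_sieve I N) \<in> J (Fo \<phi> j)"
    using base.site.stable[of f "generated_sieve I N"] f N by (simp add: covering_def)
  then have "?R \<in> base.induced j" by (rule base.preimage_induced[OF W(2)])
  then have RJ: "?R \<in> J' j" using induced_J'[OF W(2)] by blast
  have R: "h \<in> Mor I'" "Cod I' h = j" "Cmp I f (Fm \<phi> h) \<in> generated_sieve I N" if "h \<in> ?R" for h
    using that by (auto simp: base.preimage_sieve_def pull_sieve_def)
  have QK: "generated_sieve E' ((\<lambda>h. cl' h X) ` ?R) \<in> K' X"
    by (rule cleaved'.coevanescent_cartesian[OF X]) (use J'.covering_sieve[OF W(2) RJ] in \<open>simp add: Xeq\<close>)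
  have tr_sieve: "is_sieve E' X (proj.trace_sieve X g ?S)"
  proof -
    have "proj.trace_sieve X g ?S = top.preimage_sieve X (pull_sieve E g ?S)"
      using g by (auto simp: proj.trace_sieve_def top.preimage_sieve_def pull_sieve_def)
    moreover have "is_sieve E (Fo \<Phi> X) (pull_sieve E g ?S)"
      using fib.src.is_sieve_pull[of g ?S] g sieve by simp
    ultimately show ?thesis using top.is_sieve_preimage by simp
  qed
  show "proj.trace_sieve X g ?S \<in> K' X"
  proof (rule K'.covering_superset[OF X QK tr_sieve], rule proj.src.generated_least[OF tr_sieve], rule image_subsetI)
    fix h assume h: "h \<in> ?R"
    note h' = R[OF h]
    have ph: "Fm \<phi> h \<in> Mor I" "Fo \<pi> W = Cod I (Fm \<phi> h)" using h' W by simp_all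
    note d = fib.cl_simps[OF ph(1) W(1) ph(2)]
    obtain n p where n: "n \<in> N" and p: "p \<in> Mor I" "Cod I p = Dom I n" and eq: "Cmp I f (Fm \<phi> h) = Cmp I n p"
      using h'(3) by (auto simp: generated_sieve_def)
    let ?v = "Cmp E g (cl (Fm \<phi> h) W)"
    have v: "?v \<in> Mor E" "Cod E ?v = V" "Fm \<pi> ?v = Cmp I n p" using d g W eq by (simp_all add: f_def[symmetric])
    obtain m where m: "m \<in> Mor E" "Cod E m = Dom E (cl n V)" "?v = Cmp E (cl n V) m"
      using fib.cl_factor_Cmp[OF V v(1,2) N'(1)[OF n] N'(2)[OF n, symmetric] p v(3)] .
    then have "?v \<in> ?S" using n unfolding generated_sieve_def by blast
    moreover have "cl' h X \<in> Mor E'" "Cod E' (cl' h X) = X" using cleaved'.cl_simps[of h X] h' X by (simp_all add: Xeq)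
    ultimately show "cl' h X \<in> proj.trace_sieve X g ?S" by (simp add: proj.trace_sieve_def Xeq cl'_eq)
  qed
qed

text \<open>The co-evanescent topology of \<open>E'\<close> is induced by that of \<open>E\<close>.\<close>

lemma coevanescent_eq_induced:
  assumes X: "X \<in> Ob E'"
  shows "K' X = top.induced X"
proof
  show "K' X \<subseteq> top.induced X"
    by (rule cleaved'.coevanescent_least[OF top.induced_topology vertical_induced cartesian_induced])
  show "top.induced X \<subseteq> K' X"
  proof
    fix R assume "R \<in> top.induced X"
    then have R: "is_sieve E' X R" "generated_sieve E (Fm \<Phi> ` R) \<in> K (Fo \<Phi> X)" by (simp_all add: top.induced_def)
    have "K (Fo \<Phi> X) \<subseteq> proj.coinduced K' (Fo \<Phi> X)"
      by (rule fib.coevanescent_least[OF proj.coinduced_topology[OF topology_K'] vertical_coinduced cartesian_coinduced])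
    then have "proj.trace_sieve X (Id E (Fo \<Phi> X)) (generated_sieve E (Fm \<Phi> ` R)) \<in> K' X"
      using R(2) X unfolding proj.coinduced_def by auto
    moreover have "proj.trace_sieve X (Id E (Fo \<Phi> X)) (generated_sieve E (Fm \<Phi> ` R)) = R"
    proof (rule set_eqI)
      fix h
      have "Cmp E (Id E (Fo \<Phi> X)) (Fm \<Phi> h) = Fm \<Phi> h" if "h \<in> Mor E'" "Cod E' h = X" using that by simp
      then show "h \<in> proj.trace_sieve X (Id E (Fo \<Phi> X)) (generated_sieve E (Fm \<Phi> ` R)) \<longleftrightarrow> h \<in> R"
        using top.preimage_generated[OF R(1), of h] proj.src.is_sieveD(1,2)[OF R(1), of h]
        unfolding proj.trace_sieve_def by auto
    qed
    ultimately show "R \<in> K' X" by simp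
  qed
qed

text \<open>Every arrow \<open>\<Phi>(W, j) \<rightarrow> X\<close> factors through \<open>cl f X\<close> for an arrow \<open>f : \<phi>(j) \<rightarrow> \<pi>(X)\<close>.\<close>

lemma small_dense_arrows:
  assumes "universe elts" and Ob: "small elts (Ob I')"
    and hom: "\<And>i j. i \<in> Ob I \<Longrightarrow> j \<in> Ob I \<Longrightarrow> small elts (hom I i j)"
  shows "top.small_dense_arrows elts"
  unfolding top.small_dense_arrows_def
proof
  interpret universe elts by fact
  fix X assume X: "X \<in> Ob E"
  define N where "N = (\<lambda>(j, f). ((Dom E (cl f X), j), cl f X)) ` (SIGMA j:Ob I'. hom I (Fo \<phi> j) (Fo \<pi> X))"
  have N_sub: "N \<subseteq> top.dense_arrows X"
    using X fib.cl_simps by (auto simp: N_def top.dense_arrows_def hom_def)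
  have "small elts N" unfolding N_def
    by (intro small_image small_Sigma Ob hom) (use X in simp_all)
  moreover have "\<exists>(Y, n)\<in>N. \<exists>k\<in>Mor E'. Dom E' k = Z \<and> Cod E' k = Y \<and> g = Cmp E n (Fm \<Phi> k)"
    if "(Z, g) \<in> top.dense_arrows X" for Z g
  proof -
    obtain W j where Z: "Z = (W, j)" by (cases Z)
    have g: "g \<in> Mor E" "Cod E g = X" "Dom E g = W" and j: "j \<in> Ob I'" "Fo \<pi> W = Fo \<phi> j"
      using that by (simp_all add: top.dense_arrows_def Z)
    let ?f = "Fm \<pi> g"
    have f: "?f \<in> Mor I" "Fo \<pi> X = Cod I ?f" using g by auto
    note c = fib.cl_simps[OF f(1) X f(2)]
    obtain w where w: "w \<in> Mor E" "Dom E w = Dom E g" "Cod E w = Dom E (cl ?f X)"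
        "Fm \<pi> w = Id I (Fo \<pi> (Dom E g))" "Cmp E (cl ?f X) w = g"
      using fib.cl_factor[OF X g(1,2)] .
    have "((Dom E (cl ?f X), j), cl ?f X) \<in> N"
      unfolding N_def using j g f by (intro image_eqI[of _ _ "(j, ?f)"]) (auto simp: hom_def)
    moreover have "(w, Id I' j) \<in> Mor E'" using w g j c by simp
    moreover have "Dom E' (w, Id I' j) = Z" "Cod E' (w, Id I' j) = (Dom E (cl ?f X), j)"
      "g = Cmp E (cl ?f X) (Fm \<Phi> (w, Id I' j))" using w g j by (simp_all add: Z)
    ultimately show ?thesis by blast
  qed
  ultimately show "\<exists>N\<subseteq>top.dense_arrows X. small elts N \<and> (\<forall>(Z, g)\<in>top.dense_arrows X. \<exists>(Y, n)\<in>N.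
      \<exists>k\<in>Mor E'. Dom E' k = Z \<and> Cod E' k = Y \<and> g = Cmp E n (Fm \<Phi> k))"
    using N_sub by blast
qed

end


section \<open>The equivalence\<close>

theorem proposition5p21:
  fixes elts :: "'u \<Rightarrow> 'u set"
    and I :: "('i, 'k) cat" and J :: "'i \<Rightarrow> 'k set set"
    and E :: "('e, 'm) cat" and \<pi> :: "('e, 'm, 'i, 'k) functr"
    and cl :: "'k \<Rightarrow> 'e \<Rightarrow> 'm" and T :: "'i \<Rightarrow> 'e \<Rightarrow> 'm set set"
    and I' :: "('i', 'k') cat" and J' :: "'i' \<Rightarrow> 'k' set set"
    and \<phi> :: "('i', 'k', 'i, 'k) functr"
  assumes "universe elts"
    and "fibred_site elts I J E \<pi> cl T"
    and "U_site elts I' J'" and "has_fibre_products I'"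
    and "continuous_functor elts I' J' I J \<phi>"
    and "commutes_with_fibre_products I' I \<phi>"
    and "small_category elts I'" and "fully_faithful I' I \<phi>"
    and "induced_topology elts I' J' I J \<phi>"
    and "\<forall>i\<in>Ob I. \<exists>S. covering I J i S \<and> Dom I ` S \<subseteq> Fo \<phi> ` Ob I'"
  defines "E' \<equiv> base_change_cat E \<pi> I' \<phi>"
    and "\<pi>' \<equiv> base_change_functor :: ('e \<times> 'i', 'm \<times> 'k', 'i', 'k') functr"
    and "\<Phi> \<equiv> base_change_projection :: ('e \<times> 'i', 'm \<times> 'k', 'e, 'm) functr"
    and "cl' \<equiv> base_change_cleavage \<phi> cl"
    and "T' \<equiv> base_change_fibre_topology I' \<phi> T"
  shows "is_equivalence
    (sheaf_cat elts E (coevanescent_topology I J E \<pi> cl T))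
    (sheaf_cat elts E' (coevanescent_topology I' J' E' \<pi>' cl' T'))
    (restriction_functor E' \<Phi>)"
proof -
  interpret universe elts by fact
  have U_I: "U_site elts I J" and fibred: "fibred E I \<pi>" "normalized_cleavage E I \<pi> cl"
    and U_fibre: "\<And>i. i \<in> Ob I \<Longrightarrow> U_site elts (fibre E I \<pi> i) (T i)"
    and cont: "\<And>f. f \<in> Mor I \<Longrightarrow> continuous_functor elts (fibre E I \<pi> (Cod I f)) (T (Cod I f))
          (fibre E I \<pi> (Dom I f)) (T (Dom I f)) (inverse_image E I \<pi> cl f)"
    using assms(2) by (auto simp: fibred_site_def)
  have top_I: "grothendieck_topology I J" and top_I': "grothendieck_topology I' J'"
    and top_fibre: "\<And>i. i \<in> Ob I \<Longrightarrow> grothendieck_topology (fibre E I \<pi> i) (T i)"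
    using U_I assms(3) U_fibre by (auto simp: U_site_def)
  interpret fib: fibred_category E I \<pi> cl
    by unfold_locales (use fibred in \<open>auto simp: fibred_def\<close>)
  interpret phi: cat_functor I' I \<phi>
    by unfold_locales (use assms(5) in \<open>simp add: continuous_functor_def\<close>)
  interpret base: dense_subsite I' I \<phi> J
    by (intro dense_subsite.intro phi.cat_functor_axioms top_I dense_subsite_axioms.intro assms(8))
      (use assms(10) in blast)
  interpret dense_base_change E I \<pi> cl I' \<phi> J J' T
  proof (intro dense_base_change.intro base_change.intro fib.fibred_category_axioms phi.cat_functor_axioms
      base.dense_subsite_axioms dense_base_change_axioms.intro)
    show "grothendieck_topology I' J'" by (rule top_I')
    show "generated_sieve I (Fm \<phi> ` R) \<in> J (Fo \<phi> i)" if "i \<in> Ob I'" "R \<in> J' i" for i R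
      by (rule continuous_preserves_covering_sieves[OF top_I' assms(5) U_I that])
    show "base.induced i \<subseteq> J' i" if "i \<in> Ob I'" for i
    proof -
      have "continuous_functor elts I' base.induced I J \<phi>"
        using base.sheaf_restrict phi.is_functor by (auto simp: continuous_functor_def)
      then show ?thesis using assms(9) base.induced_topology that by (auto simp: induced_topology_def)
    qed
    show "grothendieck_topology (fibre E I \<pi> i) (T i)" if "i \<in> Ob I" for i by (rule top_fibre[OF that])
    show "generated_sieve (fibre E I \<pi> (Dom I f)) (Fm (inverse_image E I \<pi> cl f) ` R)
        \<in> T (Dom I f) (Fo (inverse_image E I \<pi> cl f) V)"
      if f: "f \<in> Mor I" and "V \<in> Ob (fibre E I \<pi> (Cod I f))" "R \<in> T (Cod I f) V" for f V R
      by (rule continuous_preserves_covering_sieves[OF top_fibre cont[OF f] U_fibre that(2,3)]) (use f in auto)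
  qed
  have "top.small_dense_arrows elts"
  proof (rule small_dense_arrows[OF assms(1)])
    show "small elts (Ob I')" using assms(7) by (simp add: small_category_def)
    show "small elts (hom I i j)" if "i \<in> Ob I" "j \<in> Ob I" for i j using U_I that by (simp add: U_site_def)
  qed
  then show ?thesis
    unfolding E'_def \<pi>'_def \<Phi>_def cl'_def T'_def
    using top.comparison_lemma[OF assms(1) _ coevanescent_eq_induced] by blast
qed

end
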